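(* Let $\Gamma$ be a core graph, let $\pi:P(\Gamma)\to\mathbb{P}(\Gamma)$ be the iterated blowup of all coordinate linear spaces $L_{\Gamma'}$ attached to the core subgraphs $\Gamma'\subsetneq\Gamma$, and let $Y$ be the strict transform in $P(\Gamma)$ of the graph hypersurface $X_\Gamma$. Then $Y$ does not meet the set $P(\Gamma)(\mathbb{R}^{\ge0})$ of non-negative real points of the toric variety $P(\Gamma)$.
   Context: A graph is a finite multigraph (self-loops and multiple edges allowed, no isolated vertices); a subgraph is determined by a subset of the edges; $|\Gamma|=h_1(\Gamma)$; $\Gamma$ is core if $|\Gamma-e|<|\Gamma|$ for every edge $e$. $\mathbb{P}(\Gamma)$ is the projective space with homogeneous coordinates $A_e$ indexed by the edges of $\Gamma$; $\psi_\Gamma=\sum_T\prod_{e\notin T}A_e$ with $T$ running over spanning trees, and $X_\Gamma=\{\psi_\Gamma=0\}\subset\mathbb{P}(\Gamma)$. For nonempty core $\Gamma'\subsetneq\Gamma$, $L_{\Gamma'}=\{A_e=0,\ e\in\Gamma'\}$. $P(\Gamma)$ is obtained by first blowing up the minimal (under inclusion) elements of $\{L_{\Gamma'}\}$, then the strict transforms of the minimal elements among the remaining ones, and so on (the ones blown up at the same stage are disjoint). It is a toric variety for $T(\Gamma)=(\prod_e\mathbb{G}_m)/\mathbb{G}_m$. For a torus $T=\mathrm{Spec}\,\mathbb{Q}[M]$, $M$ a lattice, $T(\mathbb{R}^{>0})$ is the set of homomorphisms $\phi:\mathbb{Q}[M]\to\mathbb{R}$ with $\phi(m)>0$ for all $m\in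 M$. For a toric variety $V=\coprod_\alpha T_\alpha$ decomposed into torus orbits, $V(\mathbb{R}^{\ge0})=\coprod_\alpha T_\alpha(\mathbb{R}^{>0})$. *)

theory Defs
  imports
    "HOL-Analysis.Analysis"
    "HOL-Library.Poly_Mapping"
    "HOL-Computational_Algebra.Fraction_Field"
    "HOL-Algebra.Generated_Rings"
    "HOL-Algebra.Algebraic_Closure_Type"
begin

section \<open>Graphs\<close>

text \<open>
  As there are no isolated vertices, a graph is a finite set \<open>E\<close> of edges together with a map
  \<open>ends\<close> listing the two (possibly equal) end points of each edge, and a subgraph is a subset
  of \<open>E\<close>.  The order in which \<open>ends\<close> lists the end points is an arbitrary
  orientation, which is needed only to write down the boundary map.
\<close>

lemma lookup_map_mult [simp]:
  "Poly_Mapping.lookup (Poly_Mapping.map ((*) a) c) e = a * Poly_Mapping.lookup c e" for a :: rat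
  by (simp add: Poly_Mapping.map.rep_eq when_def)

interpretation chains: vector_space "\<lambda>(a::rat) (c::'e \<Rightarrow>\<^sub>0 rat). Poly_Mapping.map ((*) a) c"
  by unfold_locales (auto intro!: poly_mapping_eqI simp: lookup_add algebra_simps)

definition boundary :: "('e \<Rightarrow> 'v \<times> 'v) \<Rightarrow> ('e \<Rightarrow>\<^sub>0 rat) \<Rightarrow> ('v \<Rightarrow>\<^sub>0 rat)" where
  "boundary ends c = (\<Sum>e\<in>Poly_Mapping.keys c.
     Poly_Mapping.single (snd (ends e)) (Poly_Mapping.lookup c e) -
     Poly_Mapping.single (fst (ends e)) (Poly_Mapping.lookup c e))"

definition cycle_space :: "('e \<Rightarrow> 'v \<times> 'v) \<Rightarrow> 'e set \<Rightarrow> ('e \<Rightarrow>\<^sub>0 rat) set" where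
  "cycle_space ends F = {c. Poly_Mapping.keys c \<subseteq> F \<and> boundary ends c = 0}"

definition h1 :: "('e \<Rightarrow> 'v \<times> 'v) \<Rightarrow> 'e set \<Rightarrow> nat" where
  "h1 ends F = chains.dim (cycle_space ends F)"

definition core :: "('e \<Rightarrow> 'v \<times> 'v) \<Rightarrow> 'e set \<Rightarrow> bool" where
  "core ends F \<longleftrightarrow> (\<forall>e\<in>F. h1 ends (F - {e}) < h1 ends F)"

definition connected_by :: "('e \<Rightarrow> 'v \<times> 'v) \<Rightarrow> 'e set \<Rightarrow> 'v \<Rightarrow> 'v \<Rightarrow> bool" where
  "connected_by ends F = (symclp (\<lambda>v w. (v, w) \<in> ends ` F))\<^sup>*\<^sup>*"

text \<open>
  A core graph may be disconnected.  A spanning tree is then a union of spanning trees of the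
  connected components; for connected graphs this is the usual notion.
\<close>

definition spanning_tree :: "('e \<Rightarrow> 'v \<times> 'v) \<Rightarrow> 'e set \<Rightarrow> 'e set \<Rightarrow> bool" where
  "spanning_tree ends E T \<longleftrightarrow>
     T \<subseteq> E \<and> h1 ends T = 0 \<and> connected_by ends T = connected_by ends E"


section \<open>Homogeneous coordinates\<close>

text \<open>
  The linear order on the edges only serves to make the polynomial ring an instance of
  \<^class>\<open>idom\<close>.
\<close>

type_synonym 'e mpoly = "('e \<Rightarrow>\<^sub>0 nat) \<Rightarrow>\<^sub>0 rat"
type_synonym 'e ratfun = "'e mpoly fract"

definition coord :: "'e::linorder \<Rightarrow> 'e mpoly" where
  "coord e = Poly_Mapping.single (Poly_Mapping.single e 1) 1"

definition graph_poly :: "('e::linorder \<Rightarrow> 'v \<times> 'v) \<Rightarrow> 'e set \<Rightarrow> 'e mpoly" where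
  "graph_poly ends E = (\<Sum>T | spanning_tree ends E T. \<Prod>e\<in>E - T. coord e)"

definition polys :: "'e::linorder set \<Rightarrow> 'e mpoly set" where
  "polys E = {p. \<forall>m\<in>Poly_Mapping.keys p. Poly_Mapping.keys m \<subseteq> E}"

definition mdeg :: "('e \<Rightarrow>\<^sub>0 nat) \<Rightarrow> nat" where
  "mdeg m = (\<Sum>e\<in>Poly_Mapping.keys m. Poly_Mapping.lookup m e)"

definition homogeneous :: "nat \<Rightarrow> 'e::linorder mpoly \<Rightarrow> bool" where
  "homogeneous d p \<longleftrightarrow> (\<forall>m\<in>Poly_Mapping.keys p. mdeg m = d)"

definition hom_component :: "nat \<Rightarrow> 'e::linorder mpoly \<Rightarrow> 'e mpoly" where
  "hom_component d p =
     (\<Sum>m | m \<in> Poly_Mapping.keys p \<and> mdeg m = d. Poly_Mapping.single m (Poly_Mapping.lookup p m))"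


section \<open>Schemes with a fixed function field\<close>

text \<open>
  All schemes below are integral, separated and of finite type over the rationals, and come with a
  birational map to the same projective space.  Such a scheme is determined by the set of its local
  rings, viewed as subrings of the common function field (the model of the function field in the
  sense of Zariski), and it is represented by this set: a point \<^emph>\<open>is\<close> its local ring.
  Both the closed and the non-closed points are included.  The domains of regularity of the rational
  functions generate the Zariski topology.
\<close>

type_synonym 'k point = "'k set"
type_synonym 'k model = "'k point set"

abbreviation ring_on :: "'a::comm_ring_1 set \<Rightarrow> 'a ring" where
  "ring_on R \<equiv> ring_of_type_algebra\<lparr>carrier := R\<rparr>"

definition zariski :: "'k::field model \<Rightarrow> 'k point topology" where
  "zariski V = topology_generated_by {{S \<in> V. f \<in> S} | f. True}"

definition max_ideal :: "'k::field point \<Rightarrow> 'k set" where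
  "max_ideal S = {f \<in> S. f = 0 \<or> inverse f \<notin> S}"

definition dominates :: "'k::field point \<Rightarrow> 'k point \<Rightarrow> bool" where
  "dominates S' S \<longleftrightarrow> S \<subseteq> S' \<and> max_ideal S \<subseteq> max_ideal S'"

definition localization :: "'k::field set \<Rightarrow> 'k set \<Rightarrow> 'k set" where
  "localization R Q = {a / b | a b. a \<in> R \<and> b \<in> R - Q}"

text \<open>The stalk at \<open>S\<close> of the ideal sheaf of the closed set \<open>Z\<close> with its reduced structure.\<close>

definition ideal_stalk :: "'k::field model \<Rightarrow> 'k point set \<Rightarrow> 'k point \<Rightarrow> 'k set" where
  "ideal_stalk V Z S =
     {f \<in> S. \<exists>U. openin (zariski V) U \<and> S \<in> U \<and> (\<forall>S'\<in>U. f \<in> S') \<and> (\<forall>S'\<in>U \<inter> Z. f \<in> max_ideal S')}"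

text \<open>
  Over the spectrum of the local ring \<open>S\<close>, the blow-up along an ideal \<open>I\<close> is the union
  of the spectra of the rings \<open>S[I/x]\<close>, where \<open>x\<close> runs through the nonzero elements
  of \<open>I\<close>.  The blow-down map sends a point of the blow-up to the point that it dominates.
\<close>

definition blowup :: "'k::field model \<Rightarrow> 'k point set \<Rightarrow> 'k model" where
  "blowup V Z = {localization R Q | R Q. \<exists>S\<in>V. \<exists>x\<in>ideal_stalk V Z S - {0}.
     R = generate_ring ring_of_type_algebra (S \<union> {y / x | y. y \<in> ideal_stalk V Z S}) \<and>
     primeideal Q (ring_on R)}"

definition strict_transform :: "'k::field model \<Rightarrow> 'k point set \<Rightarrow> 'k point set \<Rightarrow> 'k point set" where
  "strict_transform V Z W =
     zariski (blowup V Z) closure_of {S' \<in> blowup V Z. \<exists>S\<in>W - Z. dominates S' S}"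


section \<open>The projective space and its iterated blow-up\<close>

definition proj_primes :: "'e::linorder set \<Rightarrow> 'e mpoly set set" where
  "proj_primes E = {P. primeideal P (ring_on (polys E)) \<and>
     (\<forall>p\<in>P. \<forall>d. hom_component d p \<in> P) \<and> \<not> coord ` E \<subseteq> P}"

definition proj_local_ring :: "'e::linorder set \<Rightarrow> 'e mpoly set \<Rightarrow> 'e ratfun point" where
  "proj_local_ring E P = {Fract f g | f g. f \<in> polys E \<and> g \<in> polys E \<and> g \<notin> P \<and>
     (\<exists>d. homogeneous d f \<and> homogeneous d g)}"

definition proj_space :: "'e::linorder set \<Rightarrow> 'e ratfun model" where
  "proj_space E = proj_local_ring E ` proj_primes E"

definition proj_zeros :: "'e::linorder set \<Rightarrow> 'e mpoly set \<Rightarrow> 'e ratfun point set" where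
  "proj_zeros E F = proj_local_ring E ` {P \<in> proj_primes E. F \<subseteq> P}"

definition graph_hypersurface :: "('e::linorder \<Rightarrow> 'v \<times> 'v) \<Rightarrow> 'e set \<Rightarrow> 'e ratfun point set" where
  "graph_hypersurface ends E = proj_zeros E {graph_poly ends E}"

definition core_subspaces :: "('e::linorder \<Rightarrow> 'v \<times> 'v) \<Rightarrow> 'e set \<Rightarrow> 'e ratfun point set set" where
  "core_subspaces ends E = {proj_zeros E (coord ` F) | F. F \<noteq> {} \<and> F \<subset> E \<and> core ends F}"

definition minimal_sets :: "'a set set \<Rightarrow> 'a set set" where
  "minimal_sets \<L> = {L \<in> \<L>. \<forall>L'\<in>\<L>. \<not> L' \<subset> L}"

primrec remaining :: "('e::linorder \<Rightarrow> 'v \<times> 'v) \<Rightarrow> 'e set \<Rightarrow> nat \<Rightarrow> 'e ratfun point set set" where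
  "remaining ends E 0 = core_subspaces ends E"
| "remaining ends E (Suc k) = remaining ends E k - minimal_sets (remaining ends E k)"

text \<open>
  The result of \<open>k\<close> stages, together with the map that sends a closed set of the projective
  space to its iterated strict transform.  As the centres of one stage are disjoint, blowing up all
  of them is blowing up their union.
\<close>

primrec tower :: "('e::linorder \<Rightarrow> 'v \<times> 'v) \<Rightarrow> 'e set \<Rightarrow> nat \<Rightarrow>
    'e ratfun model \<times> ('e ratfun point set \<Rightarrow> 'e ratfun point set)" where
  "tower ends E 0 = (proj_space E, \<lambda>W. W)"
| "tower ends E (Suc k) =
     (let (V, st) = tower ends E k;
          Z = \<Union>(st ` minimal_sets (remaining ends E k))
      in (blowup V Z, \<lambda>W. strict_transform V Z (st W)))"

definition num_stages :: "('e::linorder \<Rightarrow> 'v \<times> 'v) \<Rightarrow> 'e set \<Rightarrow> nat" where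
  "num_stages ends E = (LEAST k. remaining ends E k = {})"

definition blown_up_space :: "('e::linorder \<Rightarrow> 'v \<times> 'v) \<Rightarrow> 'e set \<Rightarrow> 'e ratfun model" where
  "blown_up_space ends E = fst (tower ends E (num_stages ends E))"

definition strict_hypersurface :: "('e::linorder \<Rightarrow> 'v \<times> 'v) \<Rightarrow> 'e set \<Rightarrow> 'e ratfun point set" where
  "strict_hypersurface ends E =
     snd (tower ends E (num_stages ends E)) (graph_hypersurface ends E)"


section \<open>Torus orbits and non-negative real points\<close>

text \<open>The character lattice of the torus, as a group of rational functions.\<close>

definition characters :: "'e::linorder set \<Rightarrow> 'e ratfun set" where
  "characters E = {\<Prod>e\<in>E. Fract (coord e) 1 powi n e | n :: 'e \<Rightarrow> int. (\<Sum>e\<in>E. n e) = 0}"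

definition scale_poly :: "('e::linorder \<Rightarrow> rat) \<Rightarrow> 'e mpoly \<Rightarrow> 'e mpoly" where
  "scale_poly t p =
     (\<Sum>m\<in>Poly_Mapping.keys p. Poly_Mapping.single m
       (Poly_Mapping.lookup p m * (\<Prod>e\<in>Poly_Mapping.keys m. t e ^ Poly_Mapping.lookup m e)))"

definition torus_act :: "('e::linorder \<Rightarrow> rat) \<Rightarrow> 'e ratfun point \<Rightarrow> 'e ratfun point" where
  "torus_act t S = {Fract (scale_poly t f) (scale_poly t g) | f g. g \<noteq> 0 \<and> Fract f g \<in> S}"

definition torus_invariant :: "'e::linorder ratfun point set \<Rightarrow> bool" where
  "torus_invariant U \<longleftrightarrow> (\<forall>t. (\<forall>e. t e \<noteq> 0) \<longrightarrow> (\<forall>S\<in>U. torus_act t S \<in> U))"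

text \<open>
  The orbits of the torus on a toric variety, as locally closed subsets of the scheme.  The rational
  points are dense in the torus and there are finitely many orbits, hence two points of
  the scheme belong to the same orbit iff no invariant open set separates them.
\<close>

definition torus_orbit :: "'e::linorder ratfun model \<Rightarrow> 'e ratfun point \<Rightarrow> 'e ratfun point set" where
  "torus_orbit V S =
     {S' \<in> V. \<forall>U. openin (zariski V) U \<and> torus_invariant U \<longrightarrow> (S \<in> U \<longleftrightarrow> S' \<in> U)}"

text \<open>The orbit \<open>Orb\<close> is the spectrum of the group algebra of this lattice.\<close>

definition orbit_lattice :: "'e::linorder set \<Rightarrow> 'e ratfun point set \<Rightarrow> 'e ratfun set" where
  "orbit_lattice E Orb = {m \<in> characters E. \<forall>S\<in>Orb. m \<in> S \<and> inverse m \<in> S}"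

text \<open>
  A real point of a scheme is a point together with a local homomorphism from its local ring to the
  reals.  Restricting this homomorphism to the group algebra of the lattice of the orbit turns the
  real points lying on an orbit into the homomorphisms from the group algebra to the reals.
\<close>

definition real_points :: "'k::field model \<Rightarrow> ('k point \<times> ('k \<Rightarrow> real)) set" where
  "real_points V = {(S, \<phi>). S \<in> V \<and> \<phi> \<in> ring_hom (ring_on S) ring_of_type_algebra \<and>
     (\<forall>f\<in>max_ideal S. \<phi> f = 0)}"

definition positive_real_points ::
    "'e::linorder set \<Rightarrow> 'e ratfun point set \<Rightarrow> ('e ratfun point \<times> ('e ratfun \<Rightarrow> real)) set" where
  "positive_real_points E Orb = {(S, \<phi>) \<in> real_points Orb. \<forall>m\<in>orbit_lattice E Orb. \<phi> m > 0}"

definition nonneg_real_points ::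
    "'e::linorder set \<Rightarrow> 'e ratfun model \<Rightarrow> ('e ratfun point \<times> ('e ratfun \<Rightarrow> real)) set" where
  "nonneg_real_points E V = (\<Union>Orb\<in>torus_orbit V ` V. positive_real_points E Orb)"

end

theory Submission
  imports Defs
begin

text \<open>
  Write $a_e$ for the coordinate of the edge \<open>e\<close>.  The local rings \<open>S\<close> of the iterated
  blow-up have the property that in every core subgraph \<open>F\<close> some edge is minimal, that is, its
  coordinate divides the coordinates of all edges of \<open>F\<close> in \<open>S\<close>.  Removing minimal edges
  greedily, and passing to the core part each time, produces a spanning tree $T_0$ whose monomial divides
  all monomials of the graph polynomial in \<open>S\<close>.  The quotient of the graph polynomial by this monomial
  is a sum of characters in \<open>S\<close>, one of which is 1; a non-negative real point takes non-negative
  values on the characters in \<open>S\<close>, hence a positive value on the quotient.  On the strict transform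
  of the hypersurface, the quotient vanishes.

  To see that the blow-ups make the coordinates of \<open>F\<close> principal, one has to know the ideal of the
  strict transform of $L_F$ at the stage when it is blown up.  It is generated by the $a_e / y$, \<open>e\<close>
  in \<open>F\<close>, where \<open>y\<close> is the coordinate of a minimal edge of a larger core graph, chosen
  to be maximal with respect to divisibility in \<open>S\<close>.
\<close>

section \<open>Cycles and forests\<close>

text \<open>Three features of the setting shape the argument. Strict transforms are topological
  closures, so what is claimed of their points must be a closed condition: a failure has to be
  witnessed by finitely many elements of the local ring. Hence \<open>ismin\<close> and
  \<open>unsep\<close> only ask which ratios of coordinates are regular. The centres carry the
  reduced structure, so it is not enough to exhibit functions vanishing on a centre; all of them
  must be generated. The generic point \<open>eta F\<close> settles this: it lies in every
  neighbourhood of a point of the centre, so a function vanishing on the centre vanishes at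
  \<open>eta F\<close>, and there the ideal can be read off. That a blow-up produces a minimal edge
  is a consequence of locality: 1 becomes a combination of quotients of coordinates, so one of these
  quotients is a unit. Finally, positivity of a real point is given only on characters that are
  units along a whole orbit, while the argument needs it for characters that are units at one point.
  The torus must therefore be shown to act on every stage of the tower.\<close>

abbreviation cscale :: "rat \<Rightarrow> ('e \<Rightarrow>\<^sub>0 rat) \<Rightarrow> ('e \<Rightarrow>\<^sub>0 rat)" where
  "cscale a c \<equiv> Poly_Mapping.map ((*) a) c"

section \<open>Cycle spaces, the first Betti number and core subgraphs\<close>

lemma boundary_superset:
  assumes "finite A" "Poly_Mapping.keys c \<subseteq> A"
  shows "boundary ends c = (\<Sum>e\<in>A. Poly_Mapping.single (snd (ends e)) (Poly_Mapping.lookup c e) -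
     Poly_Mapping.single (fst (ends e)) (Poly_Mapping.lookup c e))"
  unfolding boundary_def using assms
  by (intro sum.mono_neutral_left) (auto simp: in_keys_iff)

lemma boundary_add: "boundary ends (c + d) = boundary ends c + boundary ends d"
proof -
  let ?A = "Poly_Mapping.keys c \<union> Poly_Mapping.keys d"
  have "Poly_Mapping.keys (c + d) \<subseteq> ?A" by (rule keys_add)
  thus ?thesis
    by (subst (1 2 3) boundary_superset[of ?A])
       (auto simp: lookup_add single_add sum.distrib[symmetric] intro!: sum.cong)
qed

lemma boundary_scale: "boundary ends (cscale a c) = cscale a (boundary ends c)"
proof -
  let ?A = "Poly_Mapping.keys c"
  have 1: "Poly_Mapping.keys (cscale a c) \<subseteq> ?A" by (auto simp: in_keys_iff)
  have 2: "cscale a (\<Sum>e\<in>?A. f e) = (\<Sum>e\<in>?A. cscale a (f e))" for f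
    by (rule poly_mapping_eqI) (simp add: lookup_sum sum_distrib_left)
  show ?thesis
    unfolding boundary_superset[of ?A, OF finite_keys 1] boundary_superset[of ?A, OF finite_keys order_refl] 2
    by (intro sum.cong refl poly_mapping_eqI) (simp add: lookup_minus lookup_single when_def algebra_simps)
qed

lemma cycle_space_subspace: "chains.subspace (cycle_space ends F)"
  unfolding chains.subspace_def cycle_space_def
proof (intro conjI ballI allI)
  show "0 \<in> {c. Poly_Mapping.keys c \<subseteq> F \<and> boundary ends c = 0}" by (simp add: boundary_def)
next
  fix x y assume "x \<in> {c. Poly_Mapping.keys c \<subseteq> F \<and> boundary ends c = 0}"
    "y \<in> {c. Poly_Mapping.keys c \<subseteq> F \<and> boundary ends c = 0}"
  thus "x + y \<in> {c. Poly_Mapping.keys c \<subseteq> F \<and> boundary ends c = 0}"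
    using keys_add[of x y] by (auto simp: boundary_add)
next
  fix a :: rat and x assume "x \<in> {c. Poly_Mapping.keys c \<subseteq> F \<and> boundary ends c = 0}"
  thus "cscale a x \<in> {c. Poly_Mapping.keys c \<subseteq> F \<and> boundary ends c = 0}"
    by (auto simp: boundary_scale in_keys_iff intro!: poly_mapping_eqI)
qed

lemma cycle_space_mono: "F \<subseteq> G \<Longrightarrow> cycle_space ends F \<subseteq> cycle_space ends G"
  unfolding cycle_space_def by auto

lemma cycle_space_diff:
  "cycle_space ends (F - D) = {c \<in> cycle_space ends F. \<forall>e\<in>D. Poly_Mapping.lookup c e = 0}"
  unfolding cycle_space_def by (auto simp: in_keys_iff)

lemma chains_span_singles:
  assumes "finite F" "Poly_Mapping.keys c \<subseteq> F"
  shows "c \<in> chains.span ((\<lambda>e. Poly_Mapping.single e 1) ` F)"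
proof -
  have "c = (\<Sum>e\<in>F. cscale (Poly_Mapping.lookup c e) (Poly_Mapping.single e 1))"
    using assms by (intro poly_mapping_eqI)
      (auto simp: lookup_sum lookup_single when_def in_keys_iff if_distrib cong: if_cong)
  also have "\<dots> \<in> chains.span ((\<lambda>e. Poly_Mapping.single e 1) ` F)"
    by (intro chains.span_sum chains.span_scale chains.span_base) auto
  finally show ?thesis .
qed

text \<open>The cycle space lies in the span of finitely many single edges, so an independent set in
  it is finite.\<close>

lemma cycle_basis:
  assumes "finite F"
  obtains B where "finite B" "B \<subseteq> cycle_space ends F" "\<not> chains.dependent B"
    "chains.span B = cycle_space ends F" "card B = h1 ends F"
proof -
  obtain B where B: "B \<subseteq> cycle_space ends F" "\<not> chains.dependent B"
    "cycle_space ends F \<subseteq> chains.span B" "card B = chains.dim (cycle_space ends F)"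
    using chains.basis_exists by blast
  have "B \<subseteq> chains.span ((\<lambda>e. Poly_Mapping.single e 1) ` F)"
    using B(1) chains_span_singles[OF assms] by (auto simp: cycle_space_def)
  hence "finite B" using chains.independent_span_bound B(2) assms by blast
  moreover have "chains.span B = cycle_space ends F"
    using B chains.span_minimal[OF B(1) cycle_space_subspace] by auto
  ultimately show ?thesis using B that by (simp add: h1_def)
qed

lemma h1_ge_card_independent:
  assumes "finite F" "B \<subseteq> cycle_space ends F" "\<not> chains.dependent B"
  shows "card B \<le> h1 ends F"
proof -
  obtain C where C: "finite C" "chains.span C = cycle_space ends F" "card C = h1 ends F"
    using cycle_basis[OF assms(1)] by metis
  thus ?thesis using chains.independent_span_bound[OF C(1) assms(3)] assms(2) by auto
qed

lemma h1_mono: "finite G \<Longrightarrow> F \<subseteq> G \<Longrightarrow> h1 ends F \<le> h1 ends G"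
  using cycle_basis[of F ends] h1_ge_card_independent[of G] cycle_space_mono[of F G ends]
  by (metis finite_subset subset_trans)

lemma h1_cong: "cycle_space ends F = cycle_space ends G \<Longrightarrow> h1 ends F = h1 ends G"
  by (simp add: h1_def)

lemma h1_eq_0_iff:
  assumes "finite F"
  shows "h1 ends F = 0 \<longleftrightarrow> cycle_space ends F \<subseteq> {0}"
proof
  assume h: "h1 ends F = 0"
  obtain B where B: "finite B" "chains.span B = cycle_space ends F" "card B = h1 ends F"
    using cycle_basis[OF assms] by metis
  with h have "B = {}" by simp
  thus "cycle_space ends F \<subseteq> {0}" using B by (metis chains.span_empty order_refl)
next
  assume "cycle_space ends F \<subseteq> {0}"
  hence "cycle_space ends F \<subseteq> chains.span {}" by simp
  from chains.dim_le_card[OF this] show "h1 ends F = 0" by (simp add: h1_def)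
qed

text \<open>Subtracting a multiple of one fixed cycle through \<open>e\<close> clears the
  coefficient of \<open>e\<close>, so one generator beyond the cycles avoiding \<open>e\<close>
  suffices.\<close>

lemma h1_remove_le:
  assumes "finite F"
  shows "h1 ends F \<le> Suc (h1 ends (F - {e}))"
proof (cases "\<exists>c\<in>cycle_space ends F. Poly_Mapping.lookup c e \<noteq> 0")
  case False
  hence "cycle_space ends F = cycle_space ends (F - {e})" by (auto simp: cycle_space_diff)
  thus ?thesis using h1_cong[of ends F "F - {e}"] by simp
next
  case True
  then obtain c where c: "c \<in> cycle_space ends F" "Poly_Mapping.lookup c e \<noteq> 0" by blast
  obtain B where B: "finite B" "chains.span B = cycle_space ends (F - {e})"
    "card B = h1 ends (F - {e})"
    using cycle_basis[of "F - {e}"] assms by (metis finite_Diff)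
  have "cycle_space ends F \<subseteq> chains.span (insert c B)"
  proof
    fix d assume d: "d \<in> cycle_space ends F"
    let ?k = "Poly_Mapping.lookup d e / Poly_Mapping.lookup c e"
    have "d - cscale ?k c \<in> cycle_space ends F"
      using cycle_space_subspace d c(1) by (metis chains.subspace_diff chains.subspace_scale)
    hence "d - cscale ?k c \<in> chains.span B"
      unfolding B cycle_space_diff using c(2) by (simp add: lookup_minus)
    thus "d \<in> chains.span (insert c B)" by (auto simp: chains.span_insert)
  qed
  from chains.dim_le_card[OF this] B(1) have "h1 ends F \<le> card (insert c B)" by (simp add: h1_def)
  also have "\<dots> \<le> Suc (card B)" by (rule card_insert_le_m1[THEN order_trans]) (use B(1) in \<open>auto simp: card_insert_if\<close>)
  finally show ?thesis using B by simp
qed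

text \<open>A cycle through \<open>e\<close> lies outside the span of the cycles avoiding
  \<open>e\<close> and enlarges any basis of them.\<close>

lemma h1_remove_less_iff:
  assumes "finite F"
  shows "h1 ends (F - {e}) < h1 ends F \<longleftrightarrow> (\<exists>c\<in>cycle_space ends F. Poly_Mapping.lookup c e \<noteq> 0)"
proof
  assume "h1 ends (F - {e}) < h1 ends F"
  hence "cycle_space ends F \<noteq> cycle_space ends (F - {e})" by (auto simp: h1_def)
  thus "\<exists>c\<in>cycle_space ends F. Poly_Mapping.lookup c e \<noteq> 0" by (auto simp: cycle_space_diff)
next
  assume "\<exists>c\<in>cycle_space ends F. Poly_Mapping.lookup c e \<noteq> 0"
  then obtain c where c: "c \<in> cycle_space ends F" "Poly_Mapping.lookup c e \<noteq> 0" by blast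
  obtain B where B: "finite B" "B \<subseteq> cycle_space ends (F - {e})" "\<not> chains.dependent B"
    "chains.span B = cycle_space ends (F - {e})" "card B = h1 ends (F - {e})"
    using cycle_basis[of "F - {e}"] assms by (metis finite_Diff)
  have nin: "c \<notin> chains.span B" using c(2) B(4) by (simp add: cycle_space_diff)
  hence "\<not> chains.dependent (insert c B)" using B(3) by (simp add: chains.independent_insertI)
  moreover have "insert c B \<subseteq> cycle_space ends F"
    using c B(2) cycle_space_mono[of "F - {e}" F ends] by auto
  ultimately have "card (insert c B) \<le> h1 ends F" using h1_ge_card_independent assms by blast
  moreover have "c \<notin> B" using nin chains.span_base by blast
  ultimately show "h1 ends (F - {e}) < h1 ends F" using B(1,5) by simp
qed

text \<open>A core graph is one without bridges; in this form closure under unions becomes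
  visible.\<close>

lemma core_iff:
  "finite F \<Longrightarrow> core ends F \<longleftrightarrow> (\<forall>e\<in>F. \<exists>c\<in>cycle_space ends F. Poly_Mapping.lookup c e \<noteq> 0)"
  unfolding core_def by (simp add: h1_remove_less_iff)

lemma core_Un:
  assumes "finite F" "finite G" "core ends F" "core ends G"
  shows "core ends (F \<union> G)"
  using assms cycle_space_mono[of F "F \<union> G" ends] cycle_space_mono[of G "F \<union> G" ends]
  by (simp add: core_iff) (meson Un_iff subsetD)

text \<open>The union of the supports of all cycles: \<open>F\<close> without its bridges.\<close>

definition core_part :: "('e \<Rightarrow> 'v \<times> 'v) \<Rightarrow> 'e set \<Rightarrow> 'e set" where
  "core_part ends F = {e \<in> F. \<exists>c\<in>cycle_space ends F. Poly_Mapping.lookup c e \<noteq> 0}"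

lemma core_part_subset: "core_part ends F \<subseteq> F"
  by (auto simp: core_part_def)

lemma cycle_space_core_part: "cycle_space ends (core_part ends F) = cycle_space ends F"
proof
  show "cycle_space ends F \<subseteq> cycle_space ends (core_part ends F)"
  proof
    fix c assume c: "c \<in> cycle_space ends F"
    hence "Poly_Mapping.keys c \<subseteq> core_part ends F"
      by (auto simp: core_part_def cycle_space_def in_keys_iff)
    thus "c \<in> cycle_space ends (core_part ends F)" using c by (simp add: cycle_space_def)
  qed
qed (rule cycle_space_mono[OF core_part_subset])

lemma core_core_part: "finite F \<Longrightarrow> core ends (core_part ends F)"
  using finite_subset[OF core_part_subset]
  by (subst core_iff) (auto simp: cycle_space_core_part, simp add: core_part_def)

lemma h1_le_card_removed:
  assumes "finite F" "finite D"
  shows "h1 ends F \<le> h1 ends (F - D) + card D"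
  using assms(2)
proof (induction D)
  case (insert x D)
  have "h1 ends (F - D) \<le> Suc (h1 ends (F - D - {x}))"
    using assms by (intro h1_remove_le) auto
  moreover have "F - D - {x} = F - insert x D" by auto
  ultimately show ?case using insert by simp
qed simp

text \<open>
  The greedy algorithm: removing from a core graph an edge that is minimal in it and passing to the
  core part of the rest produces the complement of a spanning forest.  Any other such complement
  meets the \<open>i\<close>-th core graph in enough edges to be matched with the removed edges.
\<close>

lemma greedy_cobasis:
  assumes "finite F" "core ends F"
    and "\<And>G. G \<subseteq> F \<Longrightarrow> core ends G \<Longrightarrow> G \<noteq> {} \<Longrightarrow> \<exists>e\<in>G. mn G e"
  shows "\<exists>Gs. length Gs = h1 ends F \<and>
     (\<forall>(G, e)\<in>set Gs. core ends G \<and> G \<subseteq> F \<and> e \<in> G \<and> mn G e) \<and>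
     distinct (map snd Gs) \<and> h1 ends (F - set (map snd Gs)) = 0 \<and>
     (\<forall>B\<subseteq>F. h1 ends (F - B) = 0 \<longrightarrow>
        (\<exists>bs. set bs \<subseteq> B \<and> distinct bs \<and> list_all2 (\<lambda>b (G, e). b \<in> G) bs Gs))"
  using assms
proof (induction "h1 ends F" arbitrary: F)
  case 0
  show ?case using 0 by (intro exI[of _ "[]"]) (auto intro: exI[of _ "[]"])
next
  case (Suc n)
  have "F \<noteq> {}" using Suc.hyps(2) h1_eq_0_iff[of "{}" ends] by (auto simp: cycle_space_def)
  then obtain e where e: "e \<in> F" "mn F e" using Suc.prems by blast
  define F' where "F' = core_part ends (F - {e})"
  have F': "F' \<subseteq> F" "e \<notin> F'" "finite F'" using core_part_subset[of ends "F - {e}"] Suc.prems(1)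
    by (auto simp: F'_def intro: finite_subset)
  have Z: "cycle_space ends F' = cycle_space ends (F - {e})"
    by (simp add: F'_def cycle_space_core_part)
  \<comment> \<open>Being core makes \<open>h1\<close> drop, \<open>h1_remove_le\<close> bounds the
    drop by one, and the core part keeps all cycles.\<close>
  have "h1 ends (F - {e}) < h1 ends F" using Suc.prems(2) e(1) by (simp add: core_def)
  with h1_remove_le[OF Suc.prems(1), of ends e] Suc.hyps(2)
  have n: "n = h1 ends F'" using h1_cong[OF Z] by simp
  have coreF': "core ends F'" unfolding F'_def by (rule core_core_part) (simp add: Suc.prems(1))
  obtain Gs where Gs: "length Gs = h1 ends F'"
    "\<forall>(G, e)\<in>set Gs. core ends G \<and> G \<subseteq> F' \<and> e \<in> G \<and> mn G e"
    "distinct (map snd Gs)" "h1 ends (F' - set (map snd Gs)) = 0"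
    "\<And>B. B \<subseteq> F' \<Longrightarrow> h1 ends (F' - B) = 0 \<Longrightarrow>
        (\<exists>bs. set bs \<subseteq> B \<and> distinct bs \<and> list_all2 (\<lambda>b (G, e). b \<in> G) bs Gs)"
    using Suc.hyps(1)[OF n F'(3) coreF'] Suc.prems(3) F'(1) by (smt (verit) order_trans)
  show ?case
  proof (intro exI[of _ "(F, e) # Gs"] conjI allI impI)
    show "length ((F, e) # Gs) = h1 ends F" using Gs(1) n Suc.hyps(2) by simp
    show "\<forall>(G, e)\<in>set ((F, e) # Gs). core ends G \<and> G \<subseteq> F \<and> e \<in> G \<and> mn G e"
      using Gs(2) e Suc.prems(1,2) order_trans[OF _ F'(1)] by fastforce
    show "distinct (map snd ((F, e) # Gs))" using Gs(2,3) F'(2) by fastforce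
    have "cycle_space ends (F - set (map snd ((F, e) # Gs))) = cycle_space ends (F - {e} - set (map snd Gs))"
      by (rule arg_cong[of _ _ "cycle_space ends"]) auto
    also have "\<dots> = cycle_space ends (F' - set (map snd Gs))"
      by (simp only: cycle_space_diff[of _ _ "set (map snd Gs)"] Z)
    finally show "h1 ends (F - set (map snd ((F, e) # Gs))) = 0" using Gs(4) h1_cong by metis
  next
    fix B assume B: "B \<subseteq> F" "h1 ends (F - B) = 0"
    \<comment> \<open>The part of \<open>B\<close> inside \<open>F'\<close> still meets every
      nonzero cycle of \<open>F'\<close>.\<close>
    have "h1 ends (F' - B \<inter> F') \<le> h1 ends (F - B)"
      using Suc.prems(1) F'(1) by (intro h1_mono) auto
    then obtain bs where bs: "set bs \<subseteq> B \<inter> F'" "distinct bs" "list_all2 (\<lambda>b (G, e). b \<in> G) bs Gs"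
      using Gs(5)[of "B \<inter> F'"] B by auto
    have fB: "finite B" using B(1) Suc.prems(1) finite_subset by blast
    \<comment> \<open>The induction hypothesis uses up \<open>n\<close> edges of \<open>B\<close>,
      but breaking all cycles of \<open>F\<close> takes at least \<open>n + 1\<close>. Any edge left
      over can be matched with \<open>F\<close> itself, which contains all of
      \<open>B\<close>.\<close>
    have "card (set bs) = n" using bs Gs(1) n by (simp add: distinct_card list_all2_lengthD)
    moreover have "Suc n \<le> card B" using h1_le_card_removed[OF Suc.prems(1) fB, of ends] B(2) Suc.hyps(2) by simp
    ultimately obtain b where "b \<in> B" "b \<notin> set bs"
      by (metis card_mono fB not_less_eq_eq List.finite_set subsetI)
    thus "\<exists>bs. set bs \<subseteq> B \<and> distinct bs \<and> list_all2 (\<lambda>b (G, e). b \<in> G) bs ((F, e) # Gs)"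
      using bs B(1) by (intro exI[of _ "b # bs"]) auto
  qed
qed

section \<open>Connectivity and spanning trees\<close>

lemma connected_by_refl: "connected_by ends F v v"
  by (simp add: connected_by_def)

lemma connected_by_trans: "connected_by ends F u v \<Longrightarrow> connected_by ends F v w \<Longrightarrow> connected_by ends F u w"
  by (simp add: connected_by_def)

lemma connected_by_sym: "connected_by ends F u v \<Longrightarrow> connected_by ends F v u"
  unfolding connected_by_def by (metis rtranclp_symclp_sym sympD)

lemma connected_by_edge: "e \<in> F \<Longrightarrow> connected_by ends F (fst (ends e)) (snd (ends e))"
  unfolding connected_by_def by (rule r_into_rtranclp) (auto simp: symclp_def)

lemma connected_by_induct [consumes 1, case_names refl step]:
  assumes "connected_by ends F u v"
    and "P u"
    and "\<And>v w e. connected_by ends F u v \<Longrightarrow> P v \<Longrightarrow> e \<in> F \<Longrightarrow> ends e = (v, w) \<or> ends e = (w, v) \<Longrightarrow> P w"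
  shows "P v"
  using assms(1)[unfolded connected_by_def]
proof (induction rule: rtranclp_induct)
  case base thus ?case by (rule assms(2))
next
  case (step v w)
  then obtain e where "e \<in> F" "ends e = (v, w) \<or> ends e = (w, v)" by (auto simp: symclp_def)
  thus ?case using assms(3) step by (metis connected_by_def)
qed

lemma connected_by_mono:
  assumes "connected_by ends F u v"
    and "\<And>e. e \<in> F \<Longrightarrow> connected_by ends G (fst (ends e)) (snd (ends e))"
  shows "connected_by ends G u v"
  using assms(1)
proof (induction rule: connected_by_induct)
  case refl show ?case by (rule connected_by_refl)
next
  case (step v w e)
  from assms(2)[OF step.hyps(2)] step.hyps(3) have "connected_by ends G v w"
    using connected_by_sym by fastforce
  thus ?case using step.IH connected_by_trans by metis
qed

text \<open>The sum of the boundary over the component of \<open>fst (ends e)\<close> vanishes.\<close>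

lemma cycle_imp_connected:
  assumes "c \<in> cycle_space ends F" "Poly_Mapping.lookup c e \<noteq> 0"
  shows "connected_by ends (F - {e}) (fst (ends e)) (snd (ends e))"
proof (rule ccontr)
  define C where "C = {u. connected_by ends (F - {e}) (fst (ends e)) u}"
  assume "\<not> ?thesis"
  hence out: "snd (ends e) \<notin> C" by (simp add: C_def)
  have "fst (ends e) \<in> C" by (simp add: C_def connected_by_refl)
  let ?l = "Poly_Mapping.lookup c"
  \<comment> \<open>The component may be infinite, so it is cut down to the end points that occur in
    the cycle.\<close>
  define A where "A = insert (fst (ends e)) (fst ` ends ` Poly_Mapping.keys c \<union> snd ` ends ` Poly_Mapping.keys c) \<inter> C"
  have fin: "finite A" by (simp add: A_def)
  have *: "fst (ends e') \<in> C \<longleftrightarrow> snd (ends e') \<in> C" if "e' \<in> Poly_Mapping.keys c" "e' \<noteq> e" for e'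
  proof -
    have "e' \<in> F - {e}" using that assms(1) by (auto simp: cycle_space_def)
    hence "connected_by ends (F - {e}) (fst (ends e')) (snd (ends e'))" by (rule connected_by_edge)
    thus ?thesis unfolding C_def mem_Collect_eq
      using connected_by_trans connected_by_sym by metis
  qed
  have "0 = (\<Sum>u\<in>A. Poly_Mapping.lookup (boundary ends c) u)"
    using assms(1) by (simp add: cycle_space_def)
  also have "\<dots> = (\<Sum>e'\<in>Poly_Mapping.keys c. \<Sum>u\<in>A.
      (?l e' when snd (ends e') = u) - (?l e' when fst (ends e') = u))"
    unfolding boundary_def by (subst sum.swap) (simp add: lookup_sum lookup_minus lookup_single)
  also have "\<dots> = (\<Sum>e'\<in>Poly_Mapping.keys c.
      (if snd (ends e') \<in> C then ?l e' else 0) - (if fst (ends e') \<in> C then ?l e' else 0))"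
    using fin by (intro sum.cong refl) (auto simp: sum_subtractf when_def A_def)
  \<comment> \<open>For edges other than \<open>e\<close> both ends lie on the same side, and the
    two contributions cancel.\<close>
  also have "\<dots> = (\<Sum>e'\<in>Poly_Mapping.keys c. if e' = e then - ?l e else 0)"
    using * out \<open>fst (ends e) \<in> C\<close> by (intro sum.cong refl) auto
  also have "\<dots> = - ?l e" using assms(2) by (simp add: in_keys_iff)
  finally show False using assms(2) by simp
qed

lemma boundary_single: "boundary ends (Poly_Mapping.single e a) =
    Poly_Mapping.single (snd (ends e)) a - Poly_Mapping.single (fst (ends e)) a"
  by (cases "a = 0") (auto simp: boundary_def)

lemma connected_imp_chain:
  assumes "connected_by ends F v w"
  shows "\<exists>c. Poly_Mapping.keys c \<subseteq> F \<and> boundary ends c = Poly_Mapping.single w 1 - Poly_Mapping.single v 1"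
  using assms
proof (induction rule: connected_by_induct)
  case refl
  show ?case by (rule exI[of _ 0]) (simp add: boundary_def)
next
  case (step w x e)
  then obtain c where c: "Poly_Mapping.keys c \<subseteq> F"
    "boundary ends c = Poly_Mapping.single w 1 - Poly_Mapping.single v 1" by blast
  \<comment> \<open>The sign orients \<open>e\<close> in the direction in which the path traverses
    it.\<close>
  define s :: rat where "s = (if ends e = (w, x) then 1 else - 1)"
  have "boundary ends (Poly_Mapping.single e s) = Poly_Mapping.single x 1 - Poly_Mapping.single w 1"
    using step.hyps(3) by (auto simp: boundary_single s_def single_uminus)
  moreover have "Poly_Mapping.keys (c + Poly_Mapping.single e s) \<subseteq> F"
    using c(1) step.hyps(2) keys_add[of c "Poly_Mapping.single e s"] by (auto split: if_splits)
  ultimately show ?case using c(2) by (intro exI[of _ "c + Poly_Mapping.single e s"]) (simp add: boundary_add)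
qed

text \<open>The path in \<open>T\<close> between the ends of \<open>e\<close>, closed up by
  \<open>e\<close> itself.\<close>

lemma spanning_tree_fundamental_cycle:
  assumes "spanning_tree ends E T" "e \<in> E - T"
  shows "\<exists>c\<in>cycle_space ends (insert e T). Poly_Mapping.lookup c e \<noteq> 0"
proof -
  have "connected_by ends T (fst (ends e)) (snd (ends e))"
    using assms connected_by_edge[of e E ends] by (simp add: spanning_tree_def)
  then obtain c where c: "Poly_Mapping.keys c \<subseteq> T"
    "boundary ends c = Poly_Mapping.single (snd (ends e)) 1 - Poly_Mapping.single (fst (ends e)) 1"
    using connected_imp_chain by metis
  let ?d = "c + Poly_Mapping.single e (- 1)"
  have "Poly_Mapping.keys ?d \<subseteq> insert e T"
    using c(1) keys_add[of c "Poly_Mapping.single e (- 1)"] by auto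
  moreover have "boundary ends ?d = 0"
    unfolding boundary_add boundary_single c(2) by (simp add: single_uminus)
  ultimately have "?d \<in> cycle_space ends (insert e T)" by (simp add: cycle_space_def)
  moreover have "Poly_Mapping.lookup ?d e \<noteq> 0"
    using c(1) assms(2) in_keys_iff[of e c] by (auto simp: lookup_add)
  ultimately show ?thesis by blast
qed

text \<open>Removing an edge lowers \<open>h1\<close> by at most one, which bounds
  \<open>h1 ends E\<close> by the size of the complement. Conversely, each complementary edge added
  to the tree closes its fundamental cycle and raises \<open>h1\<close>.\<close>

lemma card_spanning_tree_complement:
  assumes "finite E" "spanning_tree ends E T"
  shows "card (E - T) = h1 ends E"
proof (rule antisym)
  have T: "T \<subseteq> E" "h1 ends T = 0" using assms(2) by (auto simp: spanning_tree_def)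
  hence fT: "finite T" using assms(1) finite_subset by blast
  have "E - (E - T) = T" using T by auto
  thus "h1 ends E \<le> card (E - T)" using h1_le_card_removed[of E "E - T" ends] T assms(1) by simp
  have "card D \<le> h1 ends (T \<union> D)" if "finite D" "D \<subseteq> E - T" for D
    using that
  proof (induction D)
    case (insert x D)
    have "\<exists>c\<in>cycle_space ends (T \<union> insert x D). Poly_Mapping.lookup c x \<noteq> 0"
      using spanning_tree_fundamental_cycle[OF assms(2), of x] insert.prems
        cycle_space_mono[of "insert x T" "T \<union> insert x D" ends] by auto
    hence "h1 ends (T \<union> insert x D - {x}) < h1 ends (T \<union> insert x D)"
      using fT insert by (subst h1_remove_less_iff) auto
    moreover have "T \<union> insert x D - {x} = T \<union> D" using insert by auto
    ultimately show ?case using insert by simp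
  qed simp
  from this[of "E - T"] have "card (E - T) \<le> h1 ends (T \<union> (E - T))" using assms(1) by simp
  also have "T \<union> (E - T) = E" using T by auto
  finally show "card (E - T) \<le> h1 ends E" .
qed

text \<open>By the count, removing all of \<open>B\<close> but one edge \<open>e\<close> cannot
  destroy every cycle. A surviving cycle must run through \<open>e\<close>, and the rest of it joins
  the ends of \<open>e\<close> without using \<open>B\<close>.\<close>

lemma spanning_tree_complement:
  assumes "finite E" "B \<subseteq> E" "card B = h1 ends E" "h1 ends (E - B) = 0"
  shows "spanning_tree ends E (E - B)"
proof -
  have "connected_by ends (E - B) (fst (ends e)) (snd (ends e))" if e: "e \<in> E" for e
  proof (cases "e \<in> B")
    case False
    thus ?thesis using e by (intro connected_by_edge) auto
  next
    case True
    have fB: "finite B" using assms finite_subset by blast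
    have "h1 ends E \<le> h1 ends (E - (B - {e})) + card (B - {e})"
      using assms(1) fB by (intro h1_le_card_removed) auto
    moreover have "Suc (card (B - {e})) = card B" by (rule card_Suc_Diff1[OF fB True])
    ultimately have "h1 ends (E - (B - {e})) \<noteq> 0" using assms(3) by linarith
    then obtain c where c: "c \<in> cycle_space ends (E - (B - {e}))" "c \<noteq> 0"
      using assms(1) h1_eq_0_iff[of "E - (B - {e})" ends] by auto
    have "Poly_Mapping.lookup c e \<noteq> 0"
    proof
      assume "Poly_Mapping.lookup c e = 0"
      hence "c \<in> cycle_space ends (E - (B - {e}) - {e})" using c by (simp add: cycle_space_diff)
      also have "E - (B - {e}) - {e} = E - B" using True by auto
      finally show False using assms c(2) h1_eq_0_iff[of "E - B" ends] by auto
    qed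
    from cycle_imp_connected[OF c(1) this]
    have "connected_by ends (E - (B - {e}) - {e}) (fst (ends e)) (snd (ends e))" .
    also have "E - (B - {e}) - {e} = E - B" using True by auto
    finally show ?thesis .
  qed
  hence "connected_by ends (E - B) = connected_by ends E"
    by (intro ext iffI) (auto elim!: connected_by_mono intro: connected_by_edge)
  thus ?thesis using assms by (auto simp: spanning_tree_def)
qed

section \<open>Local subrings of a field\<close>

definition subring_on :: "'k::field set \<Rightarrow> bool" where
  "subring_on S \<longleftrightarrow> 1 \<in> S \<and> (\<forall>x\<in>S. \<forall>y\<in>S. x - y \<in> S \<and> x * y \<in> S)"

text \<open>\<open>max_ideal S\<close> is the set of nonunits. Stability under multiplication is
  automatic (\<open>max_ideal_mult\<close>), so closure under addition is all that locality has to
  require.\<close>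

definition local_on :: "'k::field set \<Rightarrow> bool" where
  "local_on S \<longleftrightarrow> subring_on S \<and> (\<forall>x\<in>max_ideal S. \<forall>y\<in>max_ideal S. x + y \<in> max_ideal S)"

lemma subring_onD:
  assumes "subring_on S"
  shows "1 \<in> S" "0 \<in> S" "x \<in> S \<Longrightarrow> - x \<in> S" "x \<in> S \<Longrightarrow> y \<in> S \<Longrightarrow> x + y \<in> S"
    "x \<in> S \<Longrightarrow> y \<in> S \<Longrightarrow> x - y \<in> S" "x \<in> S \<Longrightarrow> y \<in> S \<Longrightarrow> x * y \<in> S"
proof -
  show 1: "1 \<in> S" using assms by (auto simp: subring_on_def)
  show d: "x \<in> S \<Longrightarrow> y \<in> S \<Longrightarrow> x - y \<in> S" for x y using assms by (auto simp: subring_on_def)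
  show "x \<in> S \<Longrightarrow> y \<in> S \<Longrightarrow> x * y \<in> S" using assms by (auto simp: subring_on_def)
  show 0: "0 \<in> S" using d[OF 1 1] by simp
  show m: "x \<in> S \<Longrightarrow> - x \<in> S" for x using d[OF 0] by force
  show "x \<in> S \<Longrightarrow> y \<in> S \<Longrightarrow> x + y \<in> S" using d[OF _ m, of x y] by simp
qed

lemma subring_on_power: "subring_on S \<Longrightarrow> x \<in> S \<Longrightarrow> x ^ n \<in> S"
  by (induction n) (auto intro: subring_onD)

lemma subring_on_sum: "subring_on S \<Longrightarrow> (\<And>i. i \<in> A \<Longrightarrow> f i \<in> S) \<Longrightarrow> sum f A \<in> S"
  by (induction A rule: infinite_finite_induct) (auto intro: subring_onD)

lemma subring_on_prod: "subring_on S \<Longrightarrow> (\<And>i. i \<in> A \<Longrightarrow> f i \<in> S) \<Longrightarrow> prod f A \<in> S"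
  by (induction A rule: infinite_finite_induct) (auto intro: subring_onD)

lemma local_onD: "local_on S \<Longrightarrow> subring_on S"
  by (simp add: local_on_def)

lemma max_ideal_subset: "x \<in> max_ideal S \<Longrightarrow> x \<in> S"
  by (simp add: max_ideal_def)

lemma max_ideal_iff: "x \<in> S \<Longrightarrow> x \<notin> max_ideal S \<longleftrightarrow> x \<noteq> 0 \<and> inverse x \<in> S"
  by (auto simp: max_ideal_def)

lemma max_ideal_mult:
  assumes "subring_on S" "x \<in> max_ideal S" "y \<in> S"
  shows "x * y \<in> max_ideal S" "y * x \<in> max_ideal S"
proof -
  show "x * y \<in> max_ideal S"
  proof (rule ccontr)
    assume h: "x * y \<notin> max_ideal S"
    have "x * y \<in> S" using assms by (auto simp: max_ideal_def intro: subring_onD)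
    with h have "x * y \<noteq> 0" "inverse (x * y) \<in> S" by (auto simp: max_ideal_iff)
    hence "x \<noteq> 0" "y * inverse (x * y) = inverse x" by (auto simp: field_simps)
    with subring_onD(6)[OF assms(1,3) \<open>inverse (x * y) \<in> S\<close>] have "x \<noteq> 0" "inverse x \<in> S" by metis+
    thus False using assms by (auto simp: max_ideal_def)
  qed
  thus "y * x \<in> max_ideal S" by (simp add: mult.commute)
qed

lemma max_ideal_add: "local_on S \<Longrightarrow> x \<in> max_ideal S \<Longrightarrow> y \<in> max_ideal S \<Longrightarrow> x + y \<in> max_ideal S"
  by (simp add: local_on_def)

lemma max_ideal_zero: "subring_on S \<Longrightarrow> 0 \<in> max_ideal S"
  by (auto simp: max_ideal_def intro: subring_onD)

lemma max_ideal_one: "subring_on S \<Longrightarrow> 1 \<notin> max_ideal S"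
  by (auto simp: max_ideal_def intro: subring_onD)

lemma max_ideal_sum:
  "local_on S \<Longrightarrow> (\<And>i. i \<in> A \<Longrightarrow> f i \<in> max_ideal S) \<Longrightarrow> sum f A \<in> max_ideal S"
  by (induction A rule: infinite_finite_induct)
    (auto intro: max_ideal_add max_ideal_zero local_onD)

lemma max_ideal_minus:
  "subring_on S \<Longrightarrow> x \<in> max_ideal S \<Longrightarrow> - x \<in> max_ideal S"
  using max_ideal_mult(2)[of S x "-1"] by (auto dest: subring_onD(1,3))

text \<open>Domination keeps nonunits nonunits, so invertibility is reflected from \<open>S'\<close>
  to \<open>S\<close>.\<close>

lemma dominates_unit:
  assumes "dominates S' S" "x \<in> S" "x \<noteq> 0" "inverse x \<in> S'"
  shows "inverse x \<in> S"
  using assms by (auto simp: dominates_def max_ideal_def)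

lemma dominates_refl: "dominates S S"
  by (simp add: dominates_def)

section \<open>Generated rings, prime ideals and localizations inside a field\<close>

lemma ring_on_simps [simp]:
  "carrier (ring_on R) = R" "add (ring_on R) = (+)" "mult (ring_on R) = (*)"
  "one (ring_on R) = 1" "zero (ring_on R) = 0"
  by (simp_all add: ring_of_type_algebra_def)

lemma ring_of_type_algebra_simps [simp]:
  "carrier ring_of_type_algebra = UNIV" "add ring_of_type_algebra = (+)" "mult ring_of_type_algebra = (*)"
  "one ring_of_type_algebra = 1" "zero ring_of_type_algebra = 0"
  by (simp_all add: ring_of_type_algebra_def)

lemma a_inv_ring_of_type_algebra [simp]: "a_inv ring_of_type_algebra (x :: 'a::comm_ring_1) = - x"
proof -
  interpret ring "ring_of_type_algebra :: 'a ring" by (rule ring_from_type_algebra)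
  show ?thesis by (rule minus_equality) auto
qed

abbreviation generated :: "'k::field set \<Rightarrow> 'k set" where
  "generated \<equiv> generate_ring ring_of_type_algebra"

lemma subring_on_generated: "subring_on (generated H)"
  unfolding subring_on_def
proof (intro conjI ballI)
  show "1 \<in> generated H" using generate_ring.one[of ring_of_type_algebra H] by simp
  fix x y assume xy: "x \<in> generated H" "y \<in> generated H"
  show "x * y \<in> generated H" using generate_ring.eng_mult[OF xy] by simp
  show "x - y \<in> generated H"
    using generate_ring.eng_add[OF xy(1) generate_ring.a_inv[OF xy(2)]] by simp
qed

lemma generated_incl: "h \<in> H \<Longrightarrow> h \<in> generated H"
  by (rule generate_ring.incl)

lemma generated_minimal:
  assumes "subring_on S" "H \<subseteq> S" shows "generated H \<subseteq> S"
proof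
  fix x assume "x \<in> generated H"
  thus "x \<in> S"
    by (induction rule: generate_ring.induct) (use assms in \<open>auto intro: subring_onD\<close>)
qed

lemma generated_mono: "H \<subseteq> H' \<Longrightarrow> generated H \<subseteq> generated H'"
  by (rule generated_minimal[OF subring_on_generated]) (auto intro: generated_incl)

lemma primeideal_ring_onD:
  assumes "primeideal Q (ring_on R)"
  shows "Q \<subseteq> R" "0 \<in> Q" "x \<in> Q \<Longrightarrow> y \<in> Q \<Longrightarrow> x + y \<in> Q" "x \<in> R \<Longrightarrow> y \<in> Q \<Longrightarrow> x * y \<in> Q"
    "x \<in> R \<Longrightarrow> y \<in> R \<Longrightarrow> x * y \<in> Q \<Longrightarrow> x \<in> Q \<or> y \<in> Q" "1 \<in> R \<Longrightarrow> 1 \<notin> Q"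
proof -
  interpret primeideal Q "ring_on R" by fact
  show s: "Q \<subseteq> R" using a_subset by simp
  show "0 \<in> Q" using additive_subgroup.zero_closed[OF additive_subgroup_axioms] by simp
  show "x \<in> Q \<Longrightarrow> y \<in> Q \<Longrightarrow> x + y \<in> Q" using additive_subgroup.a_closed[OF additive_subgroup_axioms] by simp
  show m: "x \<in> R \<Longrightarrow> y \<in> Q \<Longrightarrow> x * y \<in> Q" for x y using I_l_closed[of y x] by simp
  show "x \<in> R \<Longrightarrow> y \<in> R \<Longrightarrow> x * y \<in> Q \<Longrightarrow> x \<in> Q \<or> y \<in> Q" using I_prime by simp
  show "1 \<in> R \<Longrightarrow> 1 \<notin> Q"
  proof
    assume "1 \<in> R" "1 \<in> Q"
    hence "Q = R" using m[of _ 1] s by auto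
    thus False using I_notcarr by simp
  qed
qed

lemma cring_ring_on:
  assumes "1 \<in> R" "\<And>x y. x \<in> R \<Longrightarrow> y \<in> R \<Longrightarrow> x - y \<in> R \<and> x * y \<in> R"
  shows "cring (ring_on R)"
proof -
  have 0: "0 \<in> R" using assms(2)[OF assms(1) assms(1)] by simp
  have m: "- x \<in> R" if "x \<in> R" for x using assms(2)[OF 0 that] by simp
  have a: "x + y \<in> R" if "x \<in> R" "y \<in> R" for x y using assms(2)[OF that(1) m[OF that(2)]] by simp
  show ?thesis
  proof (intro cringI abelian_groupI comm_monoidI)
    fix x assume "x \<in> carrier (ring_on R)"
    thus "\<exists>y\<in>carrier (ring_on R). y \<oplus>\<^bsub>ring_on R\<^esub> x = \<zero>\<^bsub>ring_on R\<^esub>"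
      using m by (intro bexI[of _ "- x"]) auto
  qed (use assms(1) assms(2)[THEN conjunct2] 0 a in \<open>simp_all add: algebra_simps\<close>)
qed

lemma primeideal_ring_onI:
  assumes R: "1 \<in> R" "\<And>x y. x \<in> R \<Longrightarrow> y \<in> R \<Longrightarrow> x - y \<in> R \<and> x * y \<in> R"
    and Q: "Q \<subseteq> R" "0 \<in> Q" "\<And>x y. x \<in> Q \<Longrightarrow> y \<in> Q \<Longrightarrow> x + y \<in> Q" "\<And>x y. x \<in> R \<Longrightarrow> y \<in> Q \<Longrightarrow> x * y \<in> Q"
    and prime: "1 \<notin> Q" "\<And>x y. x \<in> R \<Longrightarrow> y \<in> R \<Longrightarrow> x * y \<in> Q \<Longrightarrow> x \<in> Q \<or> y \<in> Q"
  shows "primeideal Q (ring_on R)"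
proof (rule primeidealI)
  show cr: "cring (ring_on R)" using R by (rule cring_ring_on)
  interpret cring "ring_on R" by fact
  have neg: "a_inv (ring_on R) x = - x" if "x \<in> R" for x
    by (rule minus_equality) (use that R(2)[of "1 - 1" x] R(2)[OF R(1) R(1)] in auto)
  have m1: "- 1 \<in> R" using R(2)[OF R(2)[OF R(1) R(1), THEN conjunct1] R(1)] by simp
  show "ideal Q (ring_on R)"
  proof (rule idealI)
    show "subgroup Q (add_monoid (ring_on R))"
    proof (rule add.subgroupI)
      fix x assume "x \<in> Q"
      thus "\<ominus>\<^bsub>ring_on R\<^esub> x \<in> Q" using neg[of x] Q(1) Q(4)[OF m1, of x] by auto
    qed (use Q in auto)
    show "ring (ring_on R)" using cr by (rule cring.axioms)
    fix a x assume "a \<in> Q" "x \<in> carrier (ring_on R)"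
    thus "x \<otimes>\<^bsub>ring_on R\<^esub> a \<in> Q" "a \<otimes>\<^bsub>ring_on R\<^esub> x \<in> Q"
      using Q(4)[of x a] by (simp_all add: mult.commute)
  qed
qed (use prime R in auto)

lemma localization_local:
  assumes R: "subring_on R" and Q: "primeideal Q (ring_on R)"
  shows "local_on (localization R Q)" "R \<subseteq> localization R Q"
    "x \<in> R - Q \<Longrightarrow> inverse x \<in> localization R Q"
proof -
  let ?L = "localization R Q"
  note Qd = primeideal_ring_onD[OF Q]
  note Rd = subring_onD[OF R]
  have 1: "1 \<notin> Q" using Qd(6) Rd(1) by blast
  have mult: "b * d \<in> R - Q" if "b \<in> R - Q" "d \<in> R - Q" for b d using that Qd(5) Rd(6) by auto
  have nz: "b \<noteq> 0" if "b \<in> R - Q" for b using that Qd(2) by auto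
  have I: "a / b \<in> ?L" if "a \<in> R" "b \<in> R - Q" for a b using that by (auto simp: localization_def)
  show "R \<subseteq> ?L" using I[of _ 1] 1 Rd(1) by auto
  show "x \<in> R - Q \<Longrightarrow> inverse x \<in> ?L" using I[of 1 x] Rd(1) by (simp add: inverse_eq_divide)
  have sub: "subring_on ?L"
    unfolding subring_on_def
  proof (intro conjI ballI)
    show "1 \<in> ?L" using I[of 1 1] 1 Rd(1) by auto
    fix x y assume "x \<in> ?L" "y \<in> ?L"
    then obtain a b c d where x: "x = a / b" "a \<in> R" "b \<in> R - Q" and y: "y = c / d" "c \<in> R" "d \<in> R - Q"
      unfolding localization_def by blast
    have "x - y = (a * d - c * b) / (b * d)" "x * y = (a * c) / (b * d)"
      using nz[OF x(3)] nz[OF y(3)] x(1) y(1) by (simp_all add: field_simps)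
    moreover have "a * d - c * b \<in> R" "a * c \<in> R" using x y by (auto intro!: Rd)
    ultimately show "x - y \<in> ?L" "x * y \<in> ?L" using I[OF _ mult[OF x(3) y(3)]] by auto
  qed
  \<comment> \<open>The nonunits are the fractions with numerator in \<open>Q\<close>; their closure
    under addition is then inherited from \<open>Q\<close>.\<close>
  have max: "x \<in> max_ideal ?L \<longleftrightarrow> (\<exists>a b. x = a / b \<and> a \<in> Q \<and> b \<in> R - Q)" for x
  proof
    assume x: "x \<in> max_ideal ?L"
    then obtain a b where ab: "x = a / b" "a \<in> R" "b \<in> R - Q"
      by (auto simp: max_ideal_def localization_def)
    have "a \<in> Q"
    proof (rule ccontr)
      assume a: "a \<notin> Q"
      hence "x \<noteq> 0" "inverse x = b / a" using ab nz[of a] nz[of b] by auto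
      moreover have "b / a \<in> ?L" using ab a by (intro I) auto
      ultimately show False using x by (auto simp: max_ideal_def)
    qed
    with ab show "\<exists>a b. x = a / b \<and> a \<in> Q \<and> b \<in> R - Q" by blast
  next
    assume "\<exists>a b. x = a / b \<and> a \<in> Q \<and> b \<in> R - Q"
    then obtain a b where ab: "x = a / b" "a \<in> Q" "b \<in> R - Q" by blast
    have "x \<in> ?L" using ab Qd(1) I by blast
    moreover have "x = 0" if "inverse x \<in> ?L"
    proof (rule ccontr)
      assume x0: "x \<noteq> 0"
      obtain c d where cd: "inverse x = c / d" "c \<in> R" "d \<in> R - Q" using \<open>inverse x \<in> ?L\<close> by (auto simp: localization_def)
      have "x * (c / d) = 1" using x0 cd(1) by (metis right_inverse)
      hence "c * a = b * d" using ab(1) nz[OF ab(3)] nz[OF cd(3)] by (simp add: field_simps)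
      moreover have "c * a \<in> Q" by (rule Qd(4)[OF cd(2) ab(2)])
      ultimately show False using mult[OF ab(3) cd(3)] by auto
    qed
    ultimately show "x \<in> max_ideal ?L" by (auto simp: max_ideal_def)
  qed
  show "local_on ?L"
    unfolding local_on_def
  proof (intro conjI ballI sub)
    fix x y assume "x \<in> max_ideal ?L" "y \<in> max_ideal ?L"
    then obtain a b c d where x: "x = a / b" "a \<in> Q" "b \<in> R - Q" and y: "y = c / d" "c \<in> Q" "d \<in> R - Q"
      unfolding max by blast
    have "x + y = (d * a + b * c) / (b * d)"
      using nz[OF x(3)] nz[OF y(3)] x(1) y(1) by (simp add: field_simps)
    moreover have "d * a + b * c \<in> Q" using x y by (auto intro!: Qd(3,4))
    ultimately show "x + y \<in> max_ideal ?L" unfolding max using mult[OF x(3) y(3)] by blast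
  qed
qed

lemma max_ideal_prime:
  assumes "local_on S" shows "primeideal (max_ideal S) (ring_on S)"
proof (rule primeideal_ring_onI)
  have S: "subring_on S" using assms by (rule local_onD)
  note Sd = subring_onD[OF S]
  show "1 \<in> S" "\<And>x y. x \<in> S \<Longrightarrow> y \<in> S \<Longrightarrow> x - y \<in> S \<and> x * y \<in> S" using Sd by auto
  show "max_ideal S \<subseteq> S" "0 \<in> max_ideal S" "1 \<notin> max_ideal S"
    using S by (auto simp: max_ideal_subset max_ideal_zero max_ideal_one)
  show "\<And>x y. x \<in> max_ideal S \<Longrightarrow> y \<in> max_ideal S \<Longrightarrow> x + y \<in> max_ideal S" using assms by (rule max_ideal_add)
  show "\<And>x y. x \<in> S \<Longrightarrow> y \<in> max_ideal S \<Longrightarrow> x * y \<in> max_ideal S" using max_ideal_mult(2)[OF S] by blast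
  fix x y assume xy: "x \<in> S" "y \<in> S" "x * y \<in> max_ideal S"
  show "x \<in> max_ideal S \<or> y \<in> max_ideal S"
  proof (rule ccontr)
    assume "\<not> ?thesis"
    hence "x \<noteq> 0" "inverse x \<in> S" "y \<noteq> 0" "inverse y \<in> S" using xy by (auto simp: max_ideal_iff)
    hence "x * y \<noteq> 0" "inverse (x * y) \<in> S" using Sd(6) by auto
    thus False using xy(3) by (auto simp: max_ideal_def)
  qed
qed

lemma localization_self:
  assumes "local_on S" shows "localization S (max_ideal S) = S"
proof
  show "S \<subseteq> localization S (max_ideal S)"
    by (rule localization_local(2)[OF local_onD[OF assms] max_ideal_prime[OF assms]])
  show "localization S (max_ideal S) \<subseteq> S"
    using subring_onD(6)[OF local_onD[OF assms]]
    by (auto simp: localization_def max_ideal_iff divide_inverse)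
qed

lemma chain_quotient: "y \<noteq> 0 \<Longrightarrow> (x / y) * (y / z) = x / (z :: 'k::field)"
  by simp

section \<open>The Zariski topology on a model\<close>

lemma openin_zariski_basic: "openin (zariski V) {S \<in> V. f \<in> S}"
  unfolding zariski_def by (rule topology_generated_by_Basis) auto

lemma openin_zariski_subset: "openin (zariski V) U \<Longrightarrow> U \<subseteq> V"
  using openin_subset[of "zariski V" U] by (auto simp: zariski_def topology_generated_by_topspace)

lemma topspace_zariski: "(\<And>S. S \<in> V \<Longrightarrow> subring_on S) \<Longrightarrow> topspace (zariski V) = V"
  by (auto simp: zariski_def topology_generated_by_topspace dest: subring_onD(1))

lemma openin_zariski_finite:
  assumes "\<And>S. S \<in> V \<Longrightarrow> subring_on S" "finite A"
  shows "openin (zariski V) {S \<in> V. A \<subseteq> S}"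
  using assms(2)
proof (induction A)
  case empty
  thus ?case using openin_topspace[of "zariski V"] topspace_zariski[OF assms(1)] by simp
next
  case (insert f A)
  have "{S \<in> V. insert f A \<subseteq> S} = {S \<in> V. f \<in> S} \<inter> {S \<in> V. A \<subseteq> S}" by auto
  thus ?case using insert openin_zariski_basic by (auto intro: openin_Int)
qed

text \<open>A subbasic open set asks for an element to lie in the local ring, and enlarging the ring
  preserves this. Thus a larger local ring is a generization.\<close>

lemma openin_zariski_generization:
  assumes "openin (zariski V) U" "S \<in> U" "S \<subseteq> S'" "S' \<in> V"
  shows "S' \<in> U"
proof -
  have "generate_topology_on {{S \<in> V. f \<in> S} | f. True} U"
    using assms(1) by (simp add: zariski_def openin_topology_generated_by_iff)
  thus ?thesis using assms(2)
  proof (induction rule: generate_topology_on.induct)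
    case (UN K)
    thus ?case by blast
  qed (use assms(3,4) in auto)
qed

lemma closure_of_specialization:
  assumes "S' \<in> zariski V closure_of W" "S \<subseteq> S'" "S \<in> V" "\<And>S. S \<in> V \<Longrightarrow> subring_on S"
  shows "S \<in> zariski V closure_of W"
proof -
  have "S' \<in> V" using assms(1) topspace_zariski[OF assms(4)] by (auto simp: in_closure_of)
  thus ?thesis using assms openin_zariski_generization[of V _ S S'] topspace_zariski[OF assms(4)]
    by (auto simp: in_closure_of)
qed

text \<open>The tool for carrying conditions to a closure: finitely many elements of
  \<open>S\<close> are shared by some point of \<open>W\<close>, so a finitely witnessed failure at
  \<open>S\<close> would already occur in \<open>W\<close>.\<close>

lemma zariski_closure_witness:
  assumes V: "\<And>S. S \<in> V \<Longrightarrow> subring_on S" and S: "S \<in> zariski V closure_of W" and A: "finite A" "A \<subseteq> S"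
  obtains S' where "S' \<in> W" "A \<subseteq> S'"
proof -
  have "S \<in> V" using S topspace_zariski[OF V] by (simp add: in_closure_of)
  hence 1: "S \<in> {S \<in> V. A \<subseteq> S}" using A(2) by simp
  have 2: "openin (zariski V) {S \<in> V. A \<subseteq> S}" using V A(1) by (rule openin_zariski_finite)
  have "\<exists>S'\<in>W. S' \<in> {S \<in> V. A \<subseteq> S}"
    using S[unfolded in_closure_of] 1 2 by (elim conjE allE[of _ "{S \<in> V. A \<subseteq> S}"]) auto
  thus ?thesis using that by auto
qed

lemma ideal_stalk_off_centre:
  assumes "openin (zariski V) U" "S \<in> U" "U \<inter> Z = {}" "\<And>S. S \<in> V \<Longrightarrow> subring_on S"
  shows "ideal_stalk V Z S = S"
proof -
  have "f \<in> ideal_stalk V Z S" if f: "f \<in> S" for f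
  proof -
    let ?U = "U \<inter> {S \<in> V. f \<in> S}"
    have "openin (zariski V) ?U" using assms(1) openin_zariski_basic by (rule openin_Int)
    moreover have "S \<in> ?U" using assms(1,2) openin_zariski_subset f by auto
    ultimately show ?thesis using f assms(3) unfolding ideal_stalk_def by blast
  qed
  thus ?thesis by (auto simp: ideal_stalk_def)
qed

lemma blowupE:
  assumes "S' \<in> blowup V Z" "\<And>S. S \<in> V \<Longrightarrow> subring_on S"
  obtains S R Q x where "S \<in> V" "x \<in> ideal_stalk V Z S" "x \<noteq> 0"
    "R = generated (S \<union> {y / x | y. y \<in> ideal_stalk V Z S})" "S' = localization R Q"
    "primeideal Q (ring_on R)" "subring_on R" "R \<subseteq> S'" "local_on S'" "S \<subseteq> S'"
    "\<And>y. y \<in> ideal_stalk V Z S \<Longrightarrow> y / x \<in> S'"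
proof -
  obtain S R Q x where *: "S \<in> V" "x \<in> ideal_stalk V Z S" "x \<noteq> 0"
    "R = generated (S \<union> {y / x | y. y \<in> ideal_stalk V Z S})" "S' = localization R Q"
    "primeideal Q (ring_on R)"
    using assms(1) by (auto simp: blowup_def)
  have R: "subring_on R" unfolding *(4) by (rule subring_on_generated)
  have RS: "R \<subseteq> S'" "local_on S'" using localization_local[OF R *(6)] *(5) by auto
  have "S \<union> {y / x | y. y \<in> ideal_stalk V Z S} \<subseteq> R" unfolding *(4) by (auto intro: generated_incl)
  thus ?thesis using that[OF * R RS] RS(1) by blast
qed

text \<open>Where the stalk is the unit ideal, \<open>x = 1\<close> gives \<open>R = S\<close>, and
  localizing at the maximal ideal returns \<open>S\<close>.\<close>

lemma blowup_off_centre: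
  assumes "S \<in> V" "local_on S" "ideal_stalk V Z S = S"
  shows "S \<in> blowup V Z"
proof -
  have S: "subring_on S" using assms(2) by (rule local_onD)
  have "generated (S \<union> {y / 1 | y. y \<in> ideal_stalk V Z S}) = S"
    using generated_minimal[OF S, of S] by (auto simp: assms(3) intro: generated_incl)
  moreover have "1 \<in> ideal_stalk V Z S - {0}" using S assms(3) by (auto dest: subring_onD(1))
  ultimately show ?thesis
    unfolding blowup_def mem_Collect_eq
    by (intro exI[of _ S] exI[of _ "max_ideal S"] conjI bexI[OF _ assms(1)] bexI[of _ 1])
      (simp_all only: max_ideal_prime[OF assms(2)] localization_self[OF assms(2)])
qed

section \<open>Polynomials and the points of projective space\<close>

lemma poly_mapping_sum_single: "p = (\<Sum>m\<in>Poly_Mapping.keys p. Poly_Mapping.single m (Poly_Mapping.lookup p m))"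
  by (rule poly_mapping_eqI)
    (simp add: lookup_sum lookup_single when_def in_keys_iff)

lemma mult_sum_single:
  "p * q = (\<Sum>m\<in>Poly_Mapping.keys p. \<Sum>m'\<in>Poly_Mapping.keys q.
     Poly_Mapping.single (m + m') (Poly_Mapping.lookup p m * Poly_Mapping.lookup q m'))"
  for p q :: "'e::linorder mpoly"
  by (subst poly_mapping_sum_single[of p], subst poly_mapping_sum_single[of q])
    (simp add: sum_product mult_single)

definition monom_value :: "('e \<Rightarrow> rat) \<Rightarrow> ('e \<Rightarrow>\<^sub>0 nat) \<Rightarrow> rat" where
  "monom_value t m = (\<Prod>e\<in>Poly_Mapping.keys m. t e ^ Poly_Mapping.lookup m e)"

lemma monom_value_superset:
  assumes "finite A" "Poly_Mapping.keys m \<subseteq> A"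
  shows "monom_value t m = (\<Prod>e\<in>A. t e ^ Poly_Mapping.lookup m e)"
  unfolding monom_value_def using assms
  by (intro prod.mono_neutral_left) (auto simp: in_keys_iff)

lemma monom_value_add: "monom_value t (m + m') = monom_value t m * monom_value t m'"
proof -
  let ?A = "Poly_Mapping.keys m \<union> Poly_Mapping.keys m'"
  have "Poly_Mapping.keys (m + m') \<subseteq> ?A" by (rule keys_add)
  thus ?thesis
    by (subst (1 2 3) monom_value_superset[of ?A])
      (auto simp: lookup_add power_add prod.distrib)
qed

lemma lookup_scale_poly: "Poly_Mapping.lookup (scale_poly t p) m = Poly_Mapping.lookup p m * monom_value t m"
  unfolding scale_poly_def monom_value_def[symmetric]
  by (simp add: lookup_sum lookup_single when_def in_keys_iff)

lemma scale_poly_add: "scale_poly t (p + q) = scale_poly t p + scale_poly t q"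
  by (rule poly_mapping_eqI) (simp add: lookup_scale_poly lookup_add algebra_simps)

lemma scale_poly_diff: "scale_poly t (p - q) = scale_poly t p - scale_poly t q"
  by (rule poly_mapping_eqI) (simp add: lookup_scale_poly lookup_minus algebra_simps)

lemma scale_poly_zero [simp]: "scale_poly t 0 = 0"
  by (simp add: scale_poly_def)

lemma scale_poly_sum: "scale_poly t (sum f A) = (\<Sum>i\<in>A. scale_poly t (f i))"
  by (induction A rule: infinite_finite_induct) (auto simp: scale_poly_add)

lemma scale_poly_single:
  "scale_poly t (Poly_Mapping.single m c) = Poly_Mapping.single m (c * monom_value t m)"
  by (rule poly_mapping_eqI) (simp add: lookup_scale_poly lookup_single when_def)

lemma scale_poly_mult: "scale_poly t (p * q) = scale_poly t p * scale_poly t q"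
proof -
  let ?s = "\<lambda>p. \<Sum>m\<in>Poly_Mapping.keys p. Poly_Mapping.single m (Poly_Mapping.lookup p m * monom_value t m)"
  have s: "scale_poly t p = ?s p" for p by (simp add: scale_poly_def monom_value_def)
  have "scale_poly t (p * q) = (\<Sum>m\<in>Poly_Mapping.keys p. \<Sum>m'\<in>Poly_Mapping.keys q.
     Poly_Mapping.single (m + m') (Poly_Mapping.lookup p m * Poly_Mapping.lookup q m' * monom_value t (m + m')))"
    by (subst mult_sum_single) (simp add: scale_poly_sum scale_poly_single)
  also have "\<dots> = ?s p * ?s q"
    by (simp add: sum_product mult_single monom_value_add mult_ac)
  finally show ?thesis by (simp only: s)
qed

lemma scale_poly_scale: "scale_poly t (scale_poly u p) = scale_poly (\<lambda>e. t e * u e) p"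
  by (rule poly_mapping_eqI)
    (simp add: lookup_scale_poly monom_value_def power_mult_distrib prod.distrib)

lemma scale_poly_id: "(\<And>e. t e = 1) \<Longrightarrow> scale_poly t p = p"
  by (rule poly_mapping_eqI) (simp add: lookup_scale_poly monom_value_def)

lemma coord_nonzero [simp]: "coord e \<noteq> 0"
  unfolding coord_def by (metis lookup_single_eq lookup_zero zero_neq_one)

lemma scale_poly_coord: "scale_poly t (coord e) = Poly_Mapping.single 0 (t e) * coord e"
  by (simp add: coord_def scale_poly_single monom_value_def mult_single)

subsection \<open>Homogeneous polynomials\<close>

lemma mdeg_superset:
  assumes "finite A" "Poly_Mapping.keys m \<subseteq> A"
  shows "mdeg m = (\<Sum>e\<in>A. Poly_Mapping.lookup m e)"
  unfolding mdeg_def using assms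
  by (intro sum.mono_neutral_left) (auto simp: in_keys_iff)

lemma mdeg_add: "mdeg (m + m') = mdeg m + mdeg m'"
proof -
  let ?A = "Poly_Mapping.keys m \<union> Poly_Mapping.keys m'"
  have "Poly_Mapping.keys (m + m') \<subseteq> ?A" by (rule keys_add)
  thus ?thesis
    by (subst (1 2 3) mdeg_superset[of ?A]) (auto simp: lookup_add sum.distrib)
qed

lemma keys_minus_mpoly: "Poly_Mapping.keys (p - q) \<subseteq> Poly_Mapping.keys p \<union> Poly_Mapping.keys q"
  for p q :: "'e::linorder mpoly"
  by (auto simp: in_keys_iff lookup_minus)

lemma polys_ring: "1 \<in> polys E" "p \<in> polys E \<Longrightarrow> q \<in> polys E \<Longrightarrow> p - q \<in> polys E \<and> p * q \<in> polys E"
proof -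
  show "1 \<in> polys E" by (simp add: polys_def)
  assume p: "p \<in> polys E" and q: "q \<in> polys E"
  have "p - q \<in> polys E" using p q keys_minus_mpoly[of p q] by (auto simp: polys_def dest!: subsetD)
  moreover have "p * q \<in> polys E"
    unfolding polys_def
  proof (intro CollectI ballI)
    fix m assume "m \<in> Poly_Mapping.keys (p * q)"
    then obtain a b where "m = a + b" "a \<in> Poly_Mapping.keys p" "b \<in> Poly_Mapping.keys q"
      using keys_mult[of p q] by blast
    thus "Poly_Mapping.keys m \<subseteq> E" using p q keys_add[of a b] by (fastforce simp: polys_def)
  qed
  ultimately show "p - q \<in> polys E \<and> p * q \<in> polys E" ..
qed

lemma polys_zero: "0 \<in> polys E" by (simp add: polys_def)

lemma polys_mult: "p \<in> polys E \<Longrightarrow> q \<in> polys E \<Longrightarrow> p * q \<in> polys E"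
  using polys_ring(2) by blast

lemma polys_diff: "p \<in> polys E \<Longrightarrow> q \<in> polys E \<Longrightarrow> p - q \<in> polys E"
  using polys_ring(2) by blast

lemma polys_add: "p \<in> polys E \<Longrightarrow> q \<in> polys E \<Longrightarrow> p + q \<in> polys E"
  using polys_diff[of p E "0 - q"] polys_diff[of 0 E q] polys_zero by auto

lemma coord_polys: "e \<in> E \<Longrightarrow> coord e \<in> polys E"
  by (simp add: polys_def coord_def)

lemma homogeneous_mult:
  "homogeneous d p \<Longrightarrow> homogeneous d' q \<Longrightarrow> homogeneous (d + d') (p * q)"
  using keys_mult[of p q] by (fastforce simp: homogeneous_def mdeg_add)

lemma homogeneous_diff: "homogeneous d p \<Longrightarrow> homogeneous d q \<Longrightarrow> homogeneous d (p - q)"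
  using keys_minus_mpoly[of p q] by (auto simp: homogeneous_def)

lemma homogeneous_add: "homogeneous d p \<Longrightarrow> homogeneous d q \<Longrightarrow> homogeneous d (p + q)"
  using keys_add[of p q] by (auto simp: homogeneous_def)

lemma homogeneous_const: "homogeneous 0 (Poly_Mapping.single 0 c)"
  by (auto simp: homogeneous_def mdeg_def split: if_splits)

lemma homogeneous_one: "homogeneous 0 1"
  using homogeneous_const[of 1] by simp

lemma homogeneous_coord: "homogeneous 1 (coord e)"
  by (simp add: homogeneous_def coord_def mdeg_def)

lemma homogeneous_zero: "homogeneous d 0"
  by (simp add: homogeneous_def)

lemma homogeneous_sum: "(\<And>i. i \<in> A \<Longrightarrow> homogeneous d (f i)) \<Longrightarrow> homogeneous d (sum f A)"
  by (induction A rule: infinite_finite_induct) (auto intro: homogeneous_add homogeneous_zero)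

lemma homogeneous_prod_coord: "homogeneous (card A) (\<Prod>e\<in>A. coord e)"
  by (induction A rule: infinite_finite_induct)
    (use homogeneous_mult[OF homogeneous_coord] in \<open>auto intro: homogeneous_one\<close>)

subsection \<open>Elements of the function field\<close>

lemma to_fract_simps:
  "Fract (p * q) 1 = Fract p 1 * Fract q 1" "Fract (p + q) 1 = Fract p 1 + Fract q 1"
  "Fract (p - q) 1 = Fract p 1 - Fract q 1" "Fract 0 1 = 0" "Fract 1 1 = (1 :: 'a::idom fract)"
  for p q :: "'a::idom"
  by (simp_all add: Zero_fract_def One_fract_def)

lemma Fract_eq_divide: "Fract p q = Fract p 1 / Fract q 1"
  by simp

lemma to_fract_eq_iff: "Fract p 1 = Fract q 1 \<longleftrightarrow> p = q"
  by (simp add: eq_fract)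

lemma to_fract_eq_0_iff: "Fract p 1 = 0 \<longleftrightarrow> p = 0"
  using to_fract_eq_iff[of p 0] by (simp add: to_fract_simps)

lemma to_fract_prod: "Fract (prod f A) 1 = (\<Prod>i\<in>A. Fract (f i) 1)"
  by (induction A rule: infinite_finite_induct) (simp_all add: to_fract_simps del: mult_fract)

lemma to_fract_sum: "Fract (sum f A) 1 = (\<Sum>i\<in>A. Fract (f i) 1)"
  by (induction A rule: infinite_finite_induct) (simp_all add: to_fract_simps del: add_fract)

definition cvar :: "'e::linorder \<Rightarrow> 'e ratfun" where
  "cvar e = Fract (coord e) 1"

definition constants :: "'e::linorder ratfun set" where
  "constants = range (\<lambda>c. Fract (Poly_Mapping.single 0 c) 1)"

lemma cvar_nonzero [simp]: "cvar e \<noteq> 0"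
  by (simp add: cvar_def to_fract_eq_0_iff)

lemma single_eq_prod_coord:
  assumes "finite E" "Poly_Mapping.keys m \<subseteq> E"
  shows "Poly_Mapping.single m c = Poly_Mapping.single 0 c * (\<Prod>e\<in>E. coord e ^ Poly_Mapping.lookup m e)"
proof -
  have pow: "coord e ^ n = Poly_Mapping.single (Poly_Mapping.single e n) 1" for e :: 'a and n
    by (induction n) (simp_all add: coord_def mult_single single_add[symmetric])
  have prod: "(\<Prod>e\<in>A. Poly_Mapping.single (f e) 1) = Poly_Mapping.single (sum f A) (1::rat)"
    for A and f :: "'a \<Rightarrow> 'a \<Rightarrow>\<^sub>0 nat"
    by (induction A rule: infinite_finite_induct) (simp_all add: mult_single)
  have "(\<Sum>e\<in>E. Poly_Mapping.single e (Poly_Mapping.lookup m e)) = m"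
    using assms by (intro poly_mapping_eqI) (auto simp: lookup_sum lookup_single when_def in_keys_iff)
  thus ?thesis by (simp add: pow prod mult_single)
qed

text \<open>Dehomogenization: a monomial of degree \<open>d\<close> divided by the
  \<open>d\<close>-th power of one coordinate is a product of ratios.\<close>

lemma homogeneous_quotient_generated:
  assumes "finite E" "e \<in> E" "f \<in> polys E" "homogeneous d f"
  shows "Fract f 1 / cvar e ^ d \<in> generated (constants \<union> {cvar b / cvar e | b. b \<in> E})"
    (is "_ \<in> ?G")
proof -
  note G = subring_on_generated[of "constants \<union> {cvar b / cvar e | b. b \<in> E}"]
  have "Fract f 1 / cvar e ^ d =
    (\<Sum>m\<in>Poly_Mapping.keys f. Fract (Poly_Mapping.single m (Poly_Mapping.lookup f m)) 1 / cvar e ^ d)"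
    by (subst poly_mapping_sum_single[of f]) (simp only: to_fract_sum sum_divide_distrib)
  also have "\<dots> \<in> ?G"
  proof (rule subring_on_sum[OF G])
    fix m assume m: "m \<in> Poly_Mapping.keys f"
    hence mE: "Poly_Mapping.keys m \<subseteq> E" using assms(3) by (auto simp: polys_def)
    have d: "d = (\<Sum>b\<in>E. Poly_Mapping.lookup m b)"
      using m assms(4) mdeg_superset[OF assms(1) mE] by (simp add: homogeneous_def)
    have pow: "Fract (p ^ n) 1 = Fract p 1 ^ n" for p :: "'a mpoly" and n
      by (induction n) (simp_all add: to_fract_simps del: mult_fract)
    have "Fract (Poly_Mapping.single m (Poly_Mapping.lookup f m)) 1 / cvar e ^ d =
      Fract (Poly_Mapping.single 0 (Poly_Mapping.lookup f m)) 1 *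
        (\<Prod>b\<in>E. (cvar b / cvar e) ^ Poly_Mapping.lookup m b)"
      unfolding single_eq_prod_coord[OF assms(1) mE] d
      by (simp add: to_fract_simps(1) to_fract_prod pow power_divide prod_dividef power_sum cvar_def
          del: mult_fract divide_fract)
    also have "\<dots> \<in> ?G"
      by (intro subring_onD(6)[OF G] subring_on_prod[OF G] subring_on_power[OF G] generated_incl)
        (auto simp: constants_def)
    finally show "Fract (Poly_Mapping.single m (Poly_Mapping.lookup f m)) 1 / cvar e ^ d \<in> ?G" .
  qed
  finally show ?thesis .
qed

subsection \<open>The local rings of projective space\<close>

lemma proj_prime:
  assumes "P \<in> proj_primes E"
  shows "P \<subseteq> polys E" "0 \<in> P" "1 \<notin> P" "x \<in> P \<Longrightarrow> y \<in> P \<Longrightarrow> x + y \<in> P"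
    "x \<in> polys E \<Longrightarrow> y \<in> P \<Longrightarrow> x * y \<in> P"
    "x \<in> polys E \<Longrightarrow> y \<in> polys E \<Longrightarrow> x * y \<in> P \<Longrightarrow> x \<in> P \<or> y \<in> P"
    "\<exists>e\<in>E. coord e \<notin> P"
proof -
  have P: "primeideal P (ring_on (polys E))" "\<not> coord ` E \<subseteq> P"
    using assms by (simp_all add: proj_primes_def)
  note Q = primeideal_ring_onD[OF P(1)]
  show "P \<subseteq> polys E" "0 \<in> P" "1 \<notin> P" by (rule Q(1), rule Q(2), rule Q(6)[OF polys_ring(1)])
  show "x \<in> P \<Longrightarrow> y \<in> P \<Longrightarrow> x + y \<in> P" by (rule Q(3))
  show "x \<in> polys E \<Longrightarrow> y \<in> P \<Longrightarrow> x * y \<in> P" by (rule Q(4))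
  show "x \<in> polys E \<Longrightarrow> y \<in> polys E \<Longrightarrow> x * y \<in> P \<Longrightarrow> x \<in> P \<or> y \<in> P" by (rule Q(5))
  show "\<exists>e\<in>E. coord e \<notin> P" using P(2) by blast
qed

lemma proj_local_ringI:
  "f \<in> polys E \<Longrightarrow> g \<in> polys E \<Longrightarrow> g \<notin> P \<Longrightarrow> homogeneous d f \<Longrightarrow> homogeneous d g \<Longrightarrow>
   Fract f g \<in> proj_local_ring E P"
  unfolding proj_local_ring_def by blast

lemma proj_max_ideal:
  assumes P: "P \<in> proj_primes E"
  shows "max_ideal (proj_local_ring E P) =
    {Fract f g | f g. f \<in> P \<and> g \<in> polys E \<and> g \<notin> P \<and> (\<exists>d. homogeneous d f \<and> homogeneous d g)}"
    (is "_ = ?M")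
proof (intro equalityI subsetI)
  note Pd = proj_prime[OF P]
  fix x assume "x \<in> max_ideal (proj_local_ring E P)"
  then obtain f g d where fg: "x = Fract f g" "f \<in> polys E" "g \<in> polys E" "g \<notin> P"
    "homogeneous d f" "homogeneous d g" "x = 0 \<or> inverse x \<notin> proj_local_ring E P"
    by (auto simp: max_ideal_def proj_local_ring_def)
  have "f \<in> P"
  proof (cases "x = 0")
    case True
    moreover have "g \<noteq> 0" using fg(4) Pd(2) by blast
    ultimately have "f = 0" using fg(1) by (simp add: Zero_fract_def eq_fract)
    thus ?thesis using Pd(2) by simp
  next
    case False
    thus ?thesis using fg proj_local_ringI[of g E f P d] by auto
  qed
  thus "x \<in> ?M" using fg by blast
next
  note Pd = proj_prime[OF P]
  fix x assume "x \<in> ?M"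
  then obtain f g d where fg: "x = Fract f g" "f \<in> P" "g \<in> polys E" "g \<notin> P"
    "homogeneous d f" "homogeneous d g" by blast
  have "x \<in> proj_local_ring E P" using fg Pd(1) by (auto intro: proj_local_ringI)
  moreover have "inverse x \<notin> proj_local_ring E P" if "x \<noteq> 0"
  proof
    assume "inverse x \<in> proj_local_ring E P"
    then obtain f' g' where f': "inverse x = Fract f' g'" "f' \<in> polys E" "g' \<in> polys E" "g' \<notin> P"
      by (auto simp: proj_local_ring_def)
    have nz: "f \<noteq> 0" "g \<noteq> 0" "g' \<noteq> 0"
      using that fg(1,4) f'(4) Pd(2) by (auto simp: fract_collapse)
    have "g * g' = f' * f" using f'(1) nz unfolding fg(1) by (simp add: eq_fract mult.commute)
    hence "g * g' \<in> P" using Pd(5)[OF f'(2) fg(2)] by simp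
    thus False using Pd(6)[OF fg(3) f'(3)] fg(4) f'(4) by blast
  qed
  ultimately show "x \<in> max_ideal (proj_local_ring E P)" by (auto simp: max_ideal_def)
qed

lemma proj_local_ring_local:
  assumes P: "P \<in> proj_primes E"
  shows "local_on (proj_local_ring E P)"
proof -
  note Pd = proj_prime[OF P]
  have sum: "Fract f g + Fract f' g' = Fract (g' * f + g * f') (g * g')"
    "Fract f g - Fract f' g' = Fract (g' * f - g * f') (g * g')" if "g \<notin> P" "g' \<notin> P" for f g f' g'
  proof -
    have "g \<noteq> 0" "g' \<noteq> 0" using that Pd(2) by blast+
    thus "Fract f g + Fract f' g' = Fract (g' * f + g * f') (g * g')"
      "Fract f g - Fract f' g' = Fract (g' * f - g * f') (g * g')"
      by (simp_all add: mult.commute)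
  qed
  have nP: "g * g' \<notin> P" "g * g' \<in> polys E" if "g \<notin> P" "g' \<notin> P" "g \<in> polys E" "g' \<in> polys E" for g g'
    using Pd(6) that polys_mult by blast+
  have "subring_on (proj_local_ring E P)"
    unfolding subring_on_def
  proof (intro conjI ballI)
    show "1 \<in> proj_local_ring E P"
      unfolding One_fract_def
      by (rule proj_local_ringI[OF polys_ring(1) polys_ring(1) Pd(3) homogeneous_one homogeneous_one])
    fix x y assume "x \<in> proj_local_ring E P" "y \<in> proj_local_ring E P"
    then obtain f g d f' g' d' where *: "x = Fract f g" "f \<in> polys E" "g \<in> polys E" "g \<notin> P"
      "homogeneous d f" "homogeneous d g" "y = Fract f' g'" "f' \<in> polys E" "g' \<in> polys E" "g' \<notin> P"
      "homogeneous d' f'" "homogeneous d' g'" by (auto simp: proj_local_ring_def)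
    have "homogeneous (d + d') (g' * f - g * f')"
      using homogeneous_mult[OF *(5,12)] homogeneous_mult[OF *(6,11)]
      by (auto intro: homogeneous_diff simp: mult.commute)
    thus "x - y \<in> proj_local_ring E P"
      unfolding *(1,7) sum(2)[OF *(4,10)]
      by (intro proj_local_ringI[where d = "d + d'"] homogeneous_mult nP polys_diff polys_mult *)
    show "x * y \<in> proj_local_ring E P"
      unfolding *(1,7) mult_fract
      by (intro proj_local_ringI[where d = "d + d'"] homogeneous_mult nP polys_mult *)
  qed
  moreover have "x + y \<in> max_ideal (proj_local_ring E P)"
    if "x \<in> max_ideal (proj_local_ring E P)" "y \<in> max_ideal (proj_local_ring E P)" for x y
  proof -
    from that obtain f g d f' g' d' where *: "x = Fract f g" "f \<in> P" "g \<in> polys E" "g \<notin> P"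
      "homogeneous d f" "homogeneous d g" "y = Fract f' g'" "f' \<in> P" "g' \<in> polys E" "g' \<notin> P"
      "homogeneous d' f'" "homogeneous d' g'" unfolding proj_max_ideal[OF P] by blast
    have "homogeneous (d + d') (g' * f + g * f')"
      using homogeneous_mult[OF *(5,12)] homogeneous_mult[OF *(6,11)]
      by (auto intro: homogeneous_add simp: mult.commute)
    moreover have "homogeneous (d + d') (g * g')" by (intro homogeneous_mult *)
    moreover have "g' * f + g * f' \<in> P" by (intro Pd(4,5) *)
    ultimately show ?thesis
      unfolding *(1,7) sum(1)[OF *(4,10)] proj_max_ideal[OF P] using nP[OF *(4,10,3,9)] by blast
  qed
  ultimately show ?thesis by (simp add: local_on_def)
qed

lemma constants_proj_local_ring:
  assumes "P \<in> proj_primes E" shows "constants \<subseteq> proj_local_ring E P"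
proof
  fix x :: "'a ratfun" assume "x \<in> constants"
  then obtain c where x: "x = Fract (Poly_Mapping.single 0 c) 1" by (auto simp: constants_def)
  have "Poly_Mapping.single 0 c \<in> polys E" by (auto simp: polys_def split: if_splits)
  thus "x \<in> proj_local_ring E P" unfolding x
    using proj_prime(3)[OF assms] polys_ring(1) homogeneous_const homogeneous_one
    by (intro proj_local_ringI)
qed

text \<open>Some coordinate \<open>b\<close> lies outside \<open>P\<close>. If \<open>e\<close>
  divides it in the local ring, clearing denominators shows that \<open>coord e\<close> cannot lie
  in \<open>P\<close>. Thus the standard affine charts are recognized by the characters in the local
  ring.\<close>

lemma proj_coord_quotient:
  assumes P: "P \<in> proj_primes E" and e: "e \<in> E"
  shows "(\<forall>b\<in>E. cvar b / cvar e \<in> proj_local_ring E P) \<longleftrightarrow> coord e \<notin> P"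
proof
  note Pd = proj_prime[OF P]
  assume h: "\<forall>b\<in>E. cvar b / cvar e \<in> proj_local_ring E P"
  obtain b where b: "b \<in> E" "coord b \<notin> P" using Pd(7) by blast
  with h have "Fract (coord b) (coord e) \<in> proj_local_ring E P" by (auto simp: cvar_def)
  then obtain f g where fg: "Fract (coord b) (coord e) = Fract f g" "f \<in> polys E" "g \<in> polys E" "g \<notin> P"
    by (auto simp: proj_local_ring_def)
  moreover have "g \<noteq> 0" using fg(4) Pd(2) by blast
  ultimately have "coord b * g = f * coord e" by (simp add: eq_fract)
  moreover have "coord b * g \<notin> P" using Pd(6)[OF coord_polys[OF b(1)] fg(3)] b fg(4) by blast
  ultimately show "coord e \<notin> P" using Pd(5)[OF fg(2), of "coord e"] by auto
next
  assume "coord e \<notin> P"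
  thus "\<forall>b\<in>E. cvar b / cvar e \<in> proj_local_ring E P"
    using e by (auto simp: cvar_def intro!: proj_local_ringI coord_polys homogeneous_coord)
qed

text \<open>\<open>kill F\<close> sets the coordinates of \<open>F\<close> to zero.\<close>

definition kill :: "'e set \<Rightarrow> 'e::linorder mpoly \<Rightarrow> 'e mpoly" where
  "kill F = scale_poly (\<lambda>e. if e \<in> F then 0 else 1)"

text \<open>For \<open>F\<close> inside \<open>E\<close> this is the ideal generated by the
  coordinates of \<open>F\<close>. Written as the kernel of an endomorphism, it is prime because
  polynomials form a domain.\<close>

definition generic_prime :: "'e set \<Rightarrow> 'e::linorder set \<Rightarrow> 'e mpoly set" where
  "generic_prime E F = {p \<in> polys E. kill F p = 0}"

lemma monom_value_kill:
  "monom_value (\<lambda>e. if e \<in> F then 0 else 1) m = (if Poly_Mapping.keys m \<inter> F = {} then 1 else 0)"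
proof (cases "Poly_Mapping.keys m \<inter> F = {}")
  case True
  thus ?thesis by (auto simp: monom_value_def intro!: prod.neutral)
next
  case False
  thus ?thesis by (auto simp: monom_value_def in_keys_iff)
qed

lemma lookup_kill: "Poly_Mapping.lookup (kill F p) m =
    (if Poly_Mapping.keys m \<inter> F = {} then Poly_Mapping.lookup p m else 0)"
  by (simp add: kill_def lookup_scale_poly monom_value_kill)

lemma kill_mult: "kill F (p * q) = kill F p * kill F q"
  by (simp add: kill_def scale_poly_mult)

lemma kill_add: "kill F (p + q) = kill F p + kill F q"
  by (simp add: kill_def scale_poly_add)

lemma kill_coord: "kill F (coord e) = (if e \<in> F then 0 else coord e)"
  by (simp add: kill_def scale_poly_coord)

lemma generic_prime_proj:
  assumes "F \<subset> E"
  shows "generic_prime E F \<in> proj_primes E"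
proof -
  have "primeideal (generic_prime E F) (ring_on (polys E))"
  proof (rule primeideal_ring_onI)
    show "1 \<notin> generic_prime E F"
      using lookup_kill[of F 1 0] by (auto simp: generic_prime_def)
    show "0 \<in> generic_prime E F" by (simp add: generic_prime_def kill_def polys_zero)
  qed (auto simp: generic_prime_def kill_mult kill_add polys_ring polys_mult polys_add)
  moreover have "hom_component d p \<in> generic_prime E F" if p: "p \<in> generic_prime E F" for p d
  proof -
    have l: "Poly_Mapping.lookup (hom_component d p) m = (if mdeg m = d then Poly_Mapping.lookup p m else 0)" for m
    proof -
      have "Poly_Mapping.lookup (hom_component d p) m =
        (\<Sum>m' | m' \<in> Poly_Mapping.keys p \<and> mdeg m' = d. if m' = m then Poly_Mapping.lookup p m else 0)"
        unfolding hom_component_def lookup_sum lookup_single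
        by (intro sum.cong refl) (auto simp: when_def)
      thus ?thesis by (simp add: in_keys_iff)
    qed
    have z: "Poly_Mapping.keys m \<inter> F = {} \<Longrightarrow> Poly_Mapping.lookup p m = 0" for m
      using p lookup_kill[of F p m] by (simp add: generic_prime_def)
    have "kill F (hom_component d p) = 0"
      by (rule poly_mapping_eqI) (simp add: lookup_kill l z)
    moreover have "hom_component d p \<in> polys E"
      using p by (auto simp: generic_prime_def polys_def in_keys_iff l split: if_splits)
    ultimately show ?thesis by (simp add: generic_prime_def)
  qed
  \<comment> \<open>An edge outside the proper subset \<open>F\<close> keeps the irrelevant ideal
    away.\<close>
  moreover have "\<not> coord ` E \<subseteq> generic_prime E F"
    using assms by (auto simp: generic_prime_def kill_coord)
  ultimately show ?thesis by (auto simp: proj_primes_def)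
qed

lemma coord_generic_prime: "e \<in> E \<Longrightarrow> coord e \<in> generic_prime E F \<longleftrightarrow> e \<in> F"
  by (simp add: generic_prime_def kill_coord coord_polys)

section \<open>The tower of blow-ups\<close>

text \<open>
  \<open>cvar e\<close> generates the fractional ideal of \<open>S\<close> spanned by the coordinates of
  \<open>F\<close>.
\<close>

definition ismin :: "'e::linorder ratfun set \<Rightarrow> 'e set \<Rightarrow> 'e \<Rightarrow> bool" where
  "ismin S F e \<longleftrightarrow> e \<in> F \<and> (\<forall>b\<in>F. cvar b / cvar e \<in> S)"

lemma ismin_mono: "ismin S F e \<Longrightarrow> S \<subseteq> S' \<Longrightarrow> ismin S' F e"
  by (auto simp: ismin_def)

lemma ismin_transfer:
  assumes "subring_on S" "ismin S F e" "e' \<in> F" "cvar e / cvar e' \<in> S"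
  shows "ismin S F e'"
  unfolding ismin_def
proof (intro conjI ballI assms(3))
  fix b assume "b \<in> F"
  hence "cvar b / cvar e \<in> S" using assms(2) by (simp add: ismin_def)
  from subring_onD(6)[OF assms(1) this assms(4)]
  show "cvar b / cvar e' \<in> S" by simp
qed

lemma finite_total_preorder_greatest:
  assumes "finite A" "A \<noteq> {}" "\<And>x y. x \<in> A \<Longrightarrow> y \<in> A \<Longrightarrow> r x y \<or> r y x"
    "\<And>x y z. x \<in> A \<Longrightarrow> y \<in> A \<Longrightarrow> z \<in> A \<Longrightarrow> r x y \<Longrightarrow> r y z \<Longrightarrow> r x z"
  shows "\<exists>m\<in>A. \<forall>x\<in>A. r m x"
  using assms
proof (induction rule: finite_ne_induct)
  case (singleton x)
  show ?case using singleton.prems(1)[of x x] by simp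
next
  case (insert x A)
  have "\<exists>m\<in>A. \<forall>x\<in>A. r m x"
  proof (rule insert.IH)
    fix y z assume "y \<in> A" "z \<in> A"
    thus "r y z \<or> r z y" using insert.prems(1) by blast
  next
    fix y z w assume "y \<in> A" "z \<in> A" "w \<in> A" "r y z" "r z w"
    thus "r y w" using insert.prems(2)[of y z w] by blast
  qed
  then obtain m where m: "m \<in> A" "\<forall>y\<in>A. r m y" by blast
  show ?case
  proof (cases "r m x")
    case True
    thus ?thesis using m by auto
  next
    case False
    hence xm: "r x m" using insert.prems(1)[of x m] m by simp
    have "r x y" if "y \<in> insert x A" for y
    proof (cases "y = x")
      case True
      thus ?thesis using insert.prems(1)[of x x] by simp
    next
      case False
      thus ?thesis using insert.prems(2)[of x m y] m(1) bspec[OF m(2), of y] xm that by simp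
    qed
    thus ?thesis by blast
  qed
qed

locale core_graph =
  fixes E :: "'e::linorder set" and ends :: "'e \<Rightarrow> 'v \<times> 'v"
  assumes finite_E: "finite E" and core_E: "core ends E"
begin

text \<open>
  \<open>lin F\<close> is the linear space $L_F$, with generic point \<open>eta F\<close>.  The set
  \<open>treated k\<close> contains the core graphs whose linear spaces are blown up before stage
  \<open>k\<close>; \<open>E\<close> is added because $L_E$ is empty from the start.
\<close>

definition "proper F \<longleftrightarrow> F \<noteq> {} \<and> F \<subset> E \<and> core ends F"
definition "lin F = proj_zeros E (coord ` F)"
definition "treated k = insert E {F. proper F \<and> lin F \<notin> remaining ends E k}"
definition "stage k = {F. proper F \<and> lin F \<in> minimal_sets (remaining ends E k)}"
definition "space_at k = fst (tower ends E k)"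
definition "strict_at k = snd (tower ends E k)"
definition "centre k = (\<Union>F\<in>stage k. strict_at k (lin F))"
definition "eta F = proj_local_ring E (generic_prime E F)"

lemma treated_finite: "F \<in> treated k \<Longrightarrow> finite F" "F \<in> treated k \<Longrightarrow> F \<subseteq> E" "F \<in> treated k \<Longrightarrow> core ends F"
  using finite_E core_E finite_subset[of F E] by (auto simp: treated_def proper_def)

lemma proper_finite: "proper F \<Longrightarrow> finite F"
  using finite_E finite_subset[of F E] by (auto simp: proper_def)

lemma finite_stage: "finite (stage k)"
  by (rule finite_subset[of _ "Pow E"]) (use finite_E in \<open>auto simp: stage_def proper_def\<close>)

lemma E_treated: "E \<in> treated k" by (simp add: treated_def)

lemma eta_local: "F \<subset> E \<Longrightarrow> local_on (eta F)"
  unfolding eta_def by (intro proj_local_ring_local generic_prime_proj)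

lemma eta_quotient: "F \<subset> E \<Longrightarrow> e \<in> E \<Longrightarrow> (\<forall>b\<in>E. cvar b / cvar e \<in> eta F) \<longleftrightarrow> e \<notin> F"
  unfolding eta_def by (simp add: proj_coord_quotient generic_prime_proj coord_generic_prime)

lemma eta_in_lin: "F \<subset> E \<Longrightarrow> F' \<subseteq> F \<Longrightarrow> eta F \<in> lin F'"
  unfolding eta_def lin_def proj_zeros_def
  by (intro imageI) (auto simp: generic_prime_proj coord_generic_prime subset_iff)

text \<open>Some coordinate does not vanish at \<open>S\<close>, and a vanishing one cannot divide
  it.\<close>

lemma lin_caseB: "S \<in> lin F \<Longrightarrow> e \<in> F \<Longrightarrow> F \<subseteq> E \<Longrightarrow> \<not> ismin S E e"
  unfolding lin_def proj_zeros_def ismin_def using proj_coord_quotient[of _ E e] by blast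

text \<open>Inclusions are reversed, as is tested at the generic point. Hence minimal linear spaces
  belong to maximal core subgraphs.\<close>

lemma lin_subset_iff:
  assumes "F \<subset> E" "F' \<subseteq> E"
  shows "lin F \<subseteq> lin F' \<longleftrightarrow> F' \<subseteq> F"
proof
  assume "F' \<subseteq> F" thus "lin F \<subseteq> lin F'" by (auto simp: lin_def proj_zeros_def)
next
  assume "lin F \<subseteq> lin F'"
  hence "eta F \<in> lin F'" using eta_in_lin[OF assms(1) order_refl] by auto
  thus "F' \<subseteq> F" using lin_caseB[of "eta F" F'] eta_quotient[OF assms(1)] assms(2)
    by (auto simp: ismin_def)
qed

section \<open>The order in which the core subgraphs are treated\<close>

lemma remaining_subset: "remaining ends E k \<subseteq> lin ` {F. proper F}"
  by (induction k) (auto simp: core_subspaces_def lin_def proper_def)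

lemma minimal_remaining: "minimal_sets (remaining ends E k) = lin ` stage k"
  using remaining_subset[of k] by (auto simp: stage_def minimal_sets_def)

lemma treated_0: "treated 0 = {E}"
  by (auto simp: treated_def core_subspaces_def lin_def proper_def)

lemma treated_Suc: "treated (Suc k) = treated k \<union> stage k"
  by (auto simp: treated_def stage_def)

lemma stage_proper: "F \<in> stage k \<Longrightarrow> proper F" "F \<in> stage k \<Longrightarrow> F \<notin> treated k"
  by (auto simp: stage_def treated_def minimal_sets_def proper_def)

text \<open>Otherwise \<open>lin F'\<close> would be a remaining space strictly inside
  \<open>lin F\<close>, against minimality.\<close>

lemma stage_bigger:
  assumes "F \<in> stage k" "F \<subset> F'" "F' \<subseteq> E" "core ends F'"
  shows "F' \<in> treated k"
proof (rule ccontr)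
  assume "F' \<notin> treated k"
  moreover from this have "proper F'" using assms E_treated[of k] by (auto simp: proper_def stage_def)
  ultimately have "lin F' \<in> remaining ends E k" by (simp add: treated_def)
  moreover have "lin F' \<subset> lin F"
    using lin_subset_iff[of F' F] lin_subset_iff[of F F'] assms \<open>proper F'\<close> by (simp add: proper_def) blast
  ultimately show False using assms(1) by (auto simp: stage_def minimal_sets_def)
qed

lemma stage_incomparable: "F \<in> stage k \<Longrightarrow> F' \<in> stage k \<Longrightarrow> F \<noteq> F' \<Longrightarrow> \<not> F \<subseteq> F'"
  using stage_bigger[of F k F'] stage_proper[of F' k] by (auto simp: proper_def)

text \<open>Larger core graphs have smaller linear spaces, which are blown up no later.\<close>

lemma treated_upward: "F \<in> treated k \<Longrightarrow> F \<subseteq> F' \<Longrightarrow> F' \<subseteq> E \<Longrightarrow> core ends F' \<Longrightarrow> F' \<in> treated k"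
proof (induction k)
  case 0
  hence "F' = E" by (auto simp: treated_0)
  thus ?case by (simp add: E_treated)
next
  case (Suc k)
  from Suc.prems(1) consider "F \<in> treated k" | "F \<in> stage k" "F = F'" | "F \<in> stage k" "F \<subset> F'"
    using Suc.prems(2) by (auto simp: treated_Suc)
  thus ?case
  proof cases
    case 1
    thus ?thesis using Suc.IH Suc.prems by (simp add: treated_Suc)
  next
    case 3
    thus ?thesis using stage_bigger[of F k F'] Suc.prems by (simp add: treated_Suc)
  qed (simp add: treated_Suc)
qed

lemma treated_Un: "F \<in> treated k \<Longrightarrow> F' \<subseteq> E \<Longrightarrow> core ends F' \<Longrightarrow> F \<union> F' \<in> treated k"
  using treated_finite[of F k] finite_subset[OF _ finite_E, of F'] core_Un[of F F' ends]
  by (intro treated_upward[of F k "F \<union> F'"]) simp_all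

lemma treated_not_subset: "proper F \<Longrightarrow> F \<notin> treated k \<Longrightarrow> F' \<in> treated k \<Longrightarrow> \<not> F' \<subseteq> F"
  using treated_upward[of F' k F] unfolding proper_def by blast

text \<open>The union of two core graphs of one stage is core and strictly larger than both. That it
  has been treated already is what will separate the two centres.\<close>

lemma stage_Un:
  assumes "F \<in> stage k" "F' \<in> stage k" "F \<noteq> F'"
  shows "F \<union> F' \<in> treated k" "F \<subset> F \<union> F'" "F' \<subset> F \<union> F'"
proof -
  show 1: "F \<subset> F \<union> F'" "F' \<subset> F \<union> F'"
    using stage_incomparable[OF assms] stage_incomparable[OF assms(2,1)] assms(3) by auto
  have "proper F" "proper F'" using assms stage_proper(1) by blast+
  hence "core ends (F \<union> F')" "F \<union> F' \<subseteq> E"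
    using proper_finite[of F] proper_finite[of F'] core_Un[of F F' ends] by (auto simp: proper_def)
  thus "F \<union> F' \<in> treated k" using stage_bigger[OF assms(1) 1(1)] by blast
qed

lemma space_at_0: "space_at 0 = proj_space E" and strict_at_0: "strict_at 0 W = W"
  by (simp_all add: space_at_def strict_at_def)

lemma space_at_Suc: "space_at (Suc k) = blowup (space_at k) (centre k)"
  and strict_at_Suc: "strict_at (Suc k) W = strict_transform (space_at k) (centre k) (strict_at k W)"
  by (simp_all add: space_at_def strict_at_def centre_def minimal_remaining Let_def case_prod_beta image_image)

text \<open>
  The condition \<open>unsep k S F\<close> characterises the points \<open>S\<close> of the strict transform
  of \<open>lin F\<close> for \<open>F\<close> in \<open>stage k\<close>.  As it only asks which characters belong to
  \<open>S\<close>, it is invariant under the torus, and its negation is an open condition.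
\<close>

definition unsep :: "nat \<Rightarrow> 'e ratfun set \<Rightarrow> 'e set \<Rightarrow> bool" where
  "unsep k S F \<longleftrightarrow> (\<forall>F'\<in>treated k. F \<subset> F' \<longrightarrow> (\<forall>e\<in>F. \<not> ismin S F' e))"

text \<open>
  \<open>chart k S\<close> is the coordinate ring of the toric chart around \<open>S\<close>; in a \<open>good\<close>
  point, \<open>S\<close> is a localization of it and the coordinates of every treated \<open>F\<close> generate
  a principal fractional ideal.
\<close>

definition chart_gens :: "nat \<Rightarrow> 'e ratfun set \<Rightarrow> 'e ratfun set" where
  "chart_gens k S = {cvar b / cvar e | b e F. F \<in> treated k \<and> ismin S F e \<and> b \<in> F}"

definition chart :: "nat \<Rightarrow> 'e ratfun set \<Rightarrow> 'e ratfun set" where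
  "chart k S = generated (constants \<union> chart_gens k S)"

definition fracs :: "nat \<Rightarrow> 'e ratfun set \<Rightarrow> 'e ratfun set" where
  "fracs k S = {p / q | p q. p \<in> chart k S \<and> q \<in> chart k S \<and> q \<noteq> 0 \<and> inverse q \<in> S}"

definition good :: "nat \<Rightarrow> 'e ratfun set \<Rightarrow> bool" where
  "good k S \<longleftrightarrow> local_on S \<and> constants \<subseteq> S \<and> (\<forall>F\<in>treated k. \<exists>e. ismin S F e) \<and> S \<subseteq> fracs k S"

section \<open>Charts and minimal edges at a good point\<close>

lemma chart_subset: "subring_on S \<Longrightarrow> constants \<subseteq> S \<Longrightarrow> chart k S \<subseteq> S"
  unfolding chart_def by (rule generated_minimal) (auto simp: chart_gens_def ismin_def)

lemma subring_on_chart: "subring_on (chart k S)"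
  unfolding chart_def by (rule subring_on_generated)

lemma chart_mono:
  assumes "S \<subseteq> S'" "treated k \<subseteq> treated k'"
  shows "chart k S \<subseteq> chart k' S'"
  unfolding chart_def chart_gens_def using assms ismin_mono[OF _ assms(1)]
  by (intro generated_mono) blast

lemma fracs_mono: "S \<subseteq> S' \<Longrightarrow> treated k \<subseteq> treated k' \<Longrightarrow> fracs k S \<subseteq> fracs k' S'"
  unfolding fracs_def using chart_mono[of S S' k k'] by blast

lemma chart_fracs:
  assumes "subring_on S" shows "chart k S \<subseteq> fracs k S"
proof
  fix x assume "x \<in> chart k S"
  moreover have "1 \<in> chart k S" "1 \<in> S" using subring_onD(1)[OF subring_on_chart] subring_onD(1)[OF assms] by auto
  ultimately show "x \<in> fracs k S" unfolding fracs_def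
    by (intro CollectI exI[of _ x] exI[of _ 1]) auto
qed

lemma subring_on_fracs:
  assumes S: "subring_on S" shows "subring_on (fracs k S)"
  unfolding subring_on_def
proof (intro conjI ballI)
  note C = subring_onD[OF subring_on_chart[of k S]]
  show "1 \<in> fracs k S" using chart_fracs[OF S] C(1) by blast
  fix x y assume "x \<in> fracs k S" "y \<in> fracs k S"
  then obtain p q p' q' where *: "x = p / q" "p \<in> chart k S" "q \<in> chart k S" "q \<noteq> 0" "inverse q \<in> S"
    "y = p' / q'" "p' \<in> chart k S" "q' \<in> chart k S" "q' \<noteq> 0" "inverse q' \<in> S"
    unfolding fracs_def by blast
  have qq: "q * q' \<in> chart k S" "q * q' \<noteq> 0" "inverse (q * q') \<in> S"
    using * C(6) subring_onD(6)[OF S] by auto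
  have "x - y = (p * q' - p' * q) / (q * q')" "x * y = (p * p') / (q * q')"
    using *(1,4,6,9) by (simp_all add: diff_frac_eq)
  moreover have "p * q' - p' * q \<in> chart k S" "p * p' \<in> chart k S"
    using * by (auto intro!: C(5,6))
  ultimately show "x - y \<in> fracs k S" "x * y \<in> fracs k S"
    unfolding fracs_def using qq by blast+
qed

text \<open>Allows a further localization of \<open>S\<close> to be absorbed: inverses that exist in
  \<open>S\<close> of elements of \<open>fracs k S\<close> cause no new fractions.\<close>

lemma fracs_inverse:
  assumes "subring_on S" "constants \<subseteq> S" "x \<in> fracs k S" "inverse x \<in> S"
  shows "inverse x \<in> fracs k S"
proof (cases "x = 0")
  case True thus ?thesis using assms(3) by simp
next
  case False
  from assms(3) obtain p q where *: "x = p / q" "p \<in> chart k S" "q \<in> chart k S" "q \<noteq> 0" "inverse q \<in> S"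
    unfolding fracs_def by blast
  have "inverse x = q / p" "p \<noteq> 0" using *(1,4) False by auto
  moreover have "inverse p \<in> S"
    using subring_onD(6)[OF assms(1) assms(4) *(5)] *(1,4) by (simp add: field_simps)
  ultimately show ?thesis unfolding fracs_def using *(2,3) by blast
qed

lemma goodD:
  assumes "good k S"
  shows "local_on S" "subring_on S" "constants \<subseteq> S" "F \<in> treated k \<Longrightarrow> \<exists>e. ismin S F e" "S \<subseteq> fracs k S"
  using assms by (auto simp: good_def local_onD)

lemma ismin_in: "ismin S F e \<Longrightarrow> e \<in> F" "ismin S F e \<Longrightarrow> b \<in> F \<Longrightarrow> cvar b / cvar e \<in> S"
  by (simp_all add: ismin_def)

text \<open>
  The union of two treated sets is treated, and its minimal element lies in one of the two.
\<close>

lemma mins_comparable: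
  assumes "good k S" "F \<in> treated k" "F' \<in> treated k" "ismin S F e" "ismin S F' e'"
  shows "cvar e / cvar e' \<in> S \<or> cvar e' / cvar e \<in> S"
proof -
  have "F \<union> F' \<in> treated k" using assms(2,3) treated_finite by (intro treated_Un)
  then obtain e0 where e0: "ismin S (F \<union> F') e0" using goodD(4)[OF assms(1)] by blast
  hence q: "cvar e / cvar e0 \<in> S" "cvar e' / cvar e0 \<in> S"
    using ismin_in[OF assms(4)] ismin_in[OF assms(5)] by (auto intro: ismin_in(2))
  have "e0 \<in> F \<or> e0 \<in> F'" using ismin_in(1)[OF e0] by blast
  thus ?thesis
  proof
    assume "e0 \<in> F"
    hence "cvar e0 / cvar e \<in> S" by (rule ismin_in(2)[OF assms(4)])
    from subring_onD(6)[OF goodD(2)[OF assms(1)] q(2) this]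
    show ?thesis by (simp add: chain_quotient)
  next
    assume "e0 \<in> F'"
    hence "cvar e0 / cvar e' \<in> S" by (rule ismin_in(2)[OF assms(5)])
    from subring_onD(6)[OF goodD(2)[OF assms(1)] q(1) this]
    show ?thesis by (simp add: chain_quotient)
  qed
qed

text \<open>The maximality of \<open>y\<close> makes every ratio \<open>cvar b / cvar e\<close> with
  \<open>e\<close> minimal in a treated set above \<open>F\<close> a multiple of
  \<open>cvar b / cvar y\<close>, with cofactor \<open>cvar y / cvar e\<close> in
  \<open>S\<close>.\<close>

definition top_min :: "nat \<Rightarrow> 'e ratfun set \<Rightarrow> 'e set \<Rightarrow> 'e set \<Rightarrow> 'e \<Rightarrow> bool" where
  "top_min k S F G y \<longleftrightarrow> G \<in> treated k \<and> F \<subset> G \<and> ismin S G y \<and>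
     (\<forall>F'\<in>treated k. F \<subset> F' \<longrightarrow> (\<forall>e. ismin S F' e \<longrightarrow> cvar y / cvar e \<in> S))"

lemma top_min_exists:
  assumes g: "good k S" and F: "F \<subset> E"
  shows "\<exists>G y. top_min k S F G y"
proof -
  let ?A = "{(G, y). G \<in> treated k \<and> F \<subset> G \<and> ismin S G y}"
  let ?r = "\<lambda>x x'. cvar (snd x) / cvar (snd x') \<in> S"
  have "\<exists>m\<in>?A. \<forall>x\<in>?A. ?r m x"
  proof (rule finite_total_preorder_greatest)
    have "?A \<subseteq> Pow E \<times> E" using treated_finite(2) ismin_in(1) by blast
    thus "finite ?A" by (rule finite_subset) (simp add: finite_E)
    obtain e where "ismin S E e" using goodD(4)[OF g E_treated] by blast
    thus "?A \<noteq> {}" using F E_treated by blast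
  next
    fix x x' assume "x \<in> ?A" "x' \<in> ?A"
    thus "?r x x' \<or> ?r x' x" using mins_comparable[OF g, of "fst x" "fst x'" "snd x" "snd x'"] by auto
  next
    fix x x' x'' assume "?r x x'" "?r x' x''"
    from subring_onD(6)[OF goodD(2)[OF g] this] show "?r x x''" by (simp only: chain_quotient[OF cvar_nonzero])
  qed
  then obtain m where m: "m \<in> ?A" "\<forall>x\<in>?A. ?r m x" by blast
  obtain G y where Gy: "m = (G, y)" by (cases m)
  have "top_min k S F G y" unfolding top_min_def
  proof (intro conjI ballI impI allI)
    fix F' e assume "F' \<in> treated k" "F \<subset> F'" "ismin S F' e"
    hence "(F', e) \<in> ?A" by simp
    thus "cvar y / cvar e \<in> S" using m(2) Gy by force
  qed (use m(1) Gy in auto)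
  thus ?thesis by blast
qed

text \<open>
  \<open>local_ideal S F y\<close> is the ideal of the strict transform of \<open>lin F\<close>; the
  coordinates of \<open>F\<close> have to be divided by the equation \<open>cvar y\<close> of the exceptional
  divisors over it.
\<close>

definition local_ideal :: "'e ratfun set \<Rightarrow> 'e set \<Rightarrow> 'e \<Rightarrow> 'e ratfun set" where
  "local_ideal S F y = {\<Sum>e\<in>F. s e * (cvar e / cvar y) | s. \<forall>e. s e \<in> S}"

lemma local_ideal_add:
  assumes "subring_on S" "a \<in> local_ideal S F y" "b \<in> local_ideal S F y" shows "a + b \<in> local_ideal S F y"
proof -
  obtain s t where *: "a = (\<Sum>e\<in>F. s e * (cvar e / cvar y))" "b = (\<Sum>e\<in>F. t e * (cvar e / cvar y))"
    "\<forall>e. s e \<in> S" "\<forall>e. t e \<in> S" using assms(2,3) unfolding local_ideal_def by blast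
  have "a + b = (\<Sum>e\<in>F. (s e + t e) * (cvar e / cvar y))"
    unfolding *(1,2) sum.distrib[symmetric] by (simp only: distrib_right)
  moreover have "\<forall>e. s e + t e \<in> S" using *(3,4) subring_onD(4)[OF assms(1)] by blast
  ultimately show ?thesis unfolding local_ideal_def by (intro CollectI exI[of _ "\<lambda>e. s e + t e"] conjI)
qed

lemma local_ideal_mult:
  assumes "subring_on S" "a \<in> local_ideal S F y" "c \<in> S" shows "c * a \<in> local_ideal S F y"
proof -
  obtain s where *: "a = (\<Sum>e\<in>F. s e * (cvar e / cvar y))"  "\<forall>e. s e \<in> S"
    using assms(2) unfolding local_ideal_def by blast
  have "c * a = (\<Sum>e\<in>F. (c * s e) * (cvar e / cvar y))"
    unfolding *(1) sum_distrib_left by (simp only: mult.assoc)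
  moreover have "\<forall>e. c * s e \<in> S" using *(2) assms(3) subring_onD(6)[OF assms(1)] by blast
  ultimately show ?thesis unfolding local_ideal_def by (intro CollectI exI[of _ "\<lambda>e. c * s e"] conjI)
qed

lemma local_ideal_gen:
  assumes "subring_on S" "e \<in> F" "finite F" "s \<in> S" shows "s * (cvar e / cvar y) \<in> local_ideal S F y"
proof -
  have "s * (cvar e / cvar y) = (\<Sum>e'\<in>F. (if e' = e then s else 0) * (cvar e' / cvar y))"
    using sum.delta[OF assms(3), of e "\<lambda>e'. s * (cvar e' / cvar y)"] assms(2)
    by (simp only: if_distrib[of "\<lambda>x. x * _"] mult_zero_left if_True)
  moreover have "\<forall>e'. (if e' = e then s else 0) \<in> S" using assms(1,4) subring_onD(2) by auto
  ultimately show ?thesis unfolding local_ideal_def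
    by (intro CollectI exI[of _ "\<lambda>e'. if e' = e then s else 0"] conjI)
qed

lemma local_ideal_zero: "subring_on S \<Longrightarrow> 0 \<in> local_ideal S F y"
  unfolding local_ideal_def using subring_onD(2) by (auto intro!: exI[of _ "\<lambda>_. 0"])

text \<open>Pass from \<open>F'\<close> to the treated set formed with \<open>F\<close>. By
  \<open>unsep\<close> its minimal edge is outside \<open>F\<close>, hence in \<open>F'\<close>, so
  \<open>e'\<close> is minimal in the union as well. Denominators in the chart are thus invertible
  at \<open>eta F\<close>.\<close>

lemma unsep_denominator:
  assumes g: "good k S" and F: "F \<in> stage k" and u: "unsep k S F"
    and F': "F' \<in> treated k" and e': "ismin S F' e'"
  shows "e' \<notin> F" "\<exists>F0\<in>treated k. F \<subset> F0 \<and> ismin S F0 e'"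
proof -
  note S = goodD(2)[OF g]
  have pF: "proper F" "F \<notin> treated k" using stage_proper[OF F] by auto
  have F0: "F' \<union> F \<in> treated k" using pF(1) F' by (intro treated_Un) (auto simp: proper_def)
  have sub: "F \<subset> F' \<union> F" using treated_not_subset[OF pF F'] by blast
  obtain e0 where e0: "ismin S (F' \<union> F) e0" using goodD(4)[OF g F0] by blast
  hence "e0 \<notin> F" using u F0 sub by (auto simp: unsep_def)
  hence "e0 \<in> F'" using ismin_in(1)[OF e0] by blast
  have "ismin S (F' \<union> F) e'"
    using ismin_transfer[OF S e0] ismin_in[OF e'] \<open>e0 \<in> F'\<close> by blast
  thus "\<exists>F0\<in>treated k. F \<subset> F0 \<and> ismin S F0 e'" using F0 sub by blast
  thus "e' \<notin> F" using u by (auto simp: unsep_def)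
qed

text \<open>If this ratio were a unit, \<open>e\<close> would be minimal in \<open>G\<close> along
  with \<open>y\<close>, which \<open>unsep\<close> excludes.\<close>

lemma unsep_max_ideal:
  assumes g: "good k S" and u: "unsep k S F" and y: "G \<in> treated k" "F \<subset> G" "ismin S G y" and e: "e \<in> F"
  shows "cvar e / cvar y \<in> max_ideal S"
proof (rule ccontr)
  assume h: "\<not> ?thesis"
  have "cvar e / cvar y \<in> S" using e y by (auto simp: ismin_def)
  with h have "cvar y / cvar e \<in> S" by (auto simp: max_ideal_iff)
  hence "ismin S G e" using ismin_transfer[OF goodD(2)[OF g] y(3)] e y(2) by blast
  thus False using u y(1,2) e by (auto simp: unsep_def)
qed

lemma local_ideal_max:
  assumes "local_on S" "\<And>e. e \<in> F \<Longrightarrow> cvar e / cvar y \<in> max_ideal S"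
  shows "local_ideal S F y \<subseteq> max_ideal S"
  unfolding local_ideal_def using max_ideal_mult(2)[OF local_onD[OF assms(1)] assms(2)]
  by (auto intro!: max_ideal_sum[OF assms(1)] simp del: times_divide_eq_right)

text \<open>The rational functions in the coordinates outside \<open>F\<close>:
  \<open>kill F\<close> fixes a polynomial exactly if none of its monomials involves
  \<open>F\<close>.\<close>

definition off_part :: "'e set \<Rightarrow> 'e ratfun set" where
  "off_part F = {Fract p q | p q. q \<noteq> 0 \<and> kill F p = p \<and> kill F q = q}"

lemma off_part_ring: "subring_on (off_part F)"
  unfolding subring_on_def
proof (intro conjI ballI)
  have "kill F 1 = 1" by (rule poly_mapping_eqI) (auto simp: lookup_kill lookup_one when_def)
  thus "1 \<in> off_part F" unfolding off_part_def One_fract_def by (intro CollectI exI[of _ 1]) simp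
  fix x y assume "x \<in> off_part F" "y \<in> off_part F"
  then obtain p q p' q' where *: "x = Fract p q" "q \<noteq> 0" "kill F p = p" "kill F q = q"
    "y = Fract p' q'" "q' \<noteq> 0" "kill F p' = p'" "kill F q' = q'" unfolding off_part_def by blast
  have d: "kill F (r - s) = kill F r - kill F s" for r s by (simp add: kill_def scale_poly_diff)
  have "x - y = Fract (p * q' - p' * q) (q * q')" "x * y = Fract (p * p') (q * q')"
    using * by simp_all
  moreover have "kill F (p * q' - p' * q) = p * q' - p' * q" "kill F (p * p') = p * p'" "kill F (q * q') = q * q'"
    using * by (simp_all only: d kill_mult)
  moreover have "q * q' \<noteq> 0" using * by simp
  ultimately show "x - y \<in> off_part F" "x * y \<in> off_part F" unfolding off_part_def by blast+
qed

lemma off_part_quotient: "b \<notin> F \<Longrightarrow> e \<notin> F \<Longrightarrow> cvar b / cvar e \<in> off_part F"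
  unfolding off_part_def cvar_def
  by (intro CollectI exI[of _ "coord b"] exI[of _ "coord e"]) (simp add: kill_coord)

lemma off_part_constants: "constants \<subseteq> off_part F"
proof -
  have "kill F (Poly_Mapping.single 0 c) = Poly_Mapping.single 0 c" for c
    by (rule poly_mapping_eqI) (auto simp: lookup_kill lookup_single when_def)
  moreover from this[of 1] have "kill F 1 = 1" by simp
  ultimately have "Fract (Poly_Mapping.single 0 c) 1 \<in> off_part F" for c
    unfolding off_part_def by (intro CollectI exI[of _ "Poly_Mapping.single 0 c"] exI[of _ 1]) simp
  thus ?thesis unfolding constants_def by blast
qed

text \<open>Equate the two ways of writing \<open>x\<close> as a fraction, clear denominators and
  apply \<open>kill F\<close>: the side of \<open>f\<close> vanishes, while \<open>p\<close> is
  unchanged and the factor from \<open>g\<close> stays nonzero.\<close>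

lemma off_part_max_eta:
  assumes F: "F \<subset> E" and x: "x \<in> off_part F" "x \<in> max_ideal (eta F)" shows "x = 0"
proof -
  obtain p q where pq: "x = Fract p q" "q \<noteq> 0" "kill F p = p" "kill F q = q"
    using x(1) unfolding off_part_def by blast
  obtain f g where fg: "x = Fract f g" "f \<in> generic_prime E F" "g \<in> polys E" "g \<notin> generic_prime E F"
    using x(2) unfolding eta_def proj_max_ideal[OF generic_prime_proj[OF F]] by blast
  have k: "kill F f = 0" "kill F g \<noteq> 0" using fg by (auto simp: generic_prime_def)
  hence "g \<noteq> 0" by (auto simp: kill_def)
  hence "p * g = f * q" using pq(1,2) fg(1) by (simp add: eq_fract)
  hence "kill F p * kill F g = kill F f * kill F q" by (metis kill_mult)
  hence "p = 0" using k pq(3) by simp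
  thus ?thesis using pq by (simp add: fract_collapse)
qed

lemma max_eta_quotient:
  assumes F: "F \<subset> E" and be: "b \<in> F" "e \<in> E" "e \<notin> F" shows "cvar b / cvar e \<in> max_ideal (eta F)"
proof -
  have b: "b \<in> E" using F be by auto
  have P: "coord b \<in> generic_prime E F" "coord e \<notin> generic_prime E F"
    using coord_generic_prime b be by blast+
  have "cvar b / cvar e = Fract (coord b) (coord e)" by (simp add: cvar_def)
  moreover have "coord e \<in> polys E" using be by (simp add: coord_polys)
  ultimately show ?thesis
    unfolding eta_def proj_max_ideal[OF generic_prime_proj[OF F]]
    using P homogeneous_coord by blast
qed

text \<open>
  Modulo \<open>local_ideal S F y\<close>, every element of the chart is a Laurent polynomial in the
  coordinates outside \<open>F\<close>, which are units at the generic point \<open>eta F\<close>.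
\<close>

lemma key:
  assumes g: "good k S" and F: "F \<in> stage k" and u: "unsep k S F" and y: "top_min k S F G y"
  shows "S \<subseteq> eta F" "S \<inter> max_ideal (eta F) \<subseteq> local_ideal S F y"
    "local_ideal S F y \<subseteq> max_ideal S"
proof -
  note S = goodD(2)[OF g] and Sd = subring_onD[OF goodD(2)[OF g]]
  have pF: "proper F" using stage_proper[OF F] by auto
  hence FE: "F \<subset> E" "finite F" by (auto simp: proper_def proper_finite)
  note L = eta_local[OF FE(1)]
  note Ls = local_onD[OF L]
  note Ld = subring_onD[OF Ls]
  let ?J = "local_ideal S F y" and ?M = "max_ideal (eta F)"
  have yG: "G \<in> treated k" "F \<subset> G" "ismin S G y" using y by (auto simp: top_min_def)
  show JS: "?J \<subseteq> max_ideal S"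
    using unsep_max_ideal[OF g u yG] by (intro local_ideal_max goodD(1)[OF g])
  have gen_eta: "cvar b / cvar e \<in> eta F" and gen_dec: "b \<in> F \<Longrightarrow> cvar b / cvar e \<in> ?J \<inter> ?M"
    "b \<notin> F \<Longrightarrow> cvar b / cvar e \<in> off_part F"
    if F': "F' \<in> treated k" "ismin S F' e" "b \<in> F'" for b e F'
  proof -
    note n = unsep_denominator[OF g F u F'(1,2)]
    have eE: "e \<in> E" "b \<in> E" using treated_finite(2)[OF F'(1)] ismin_in(1)[OF F'(2)] F'(3) by auto
    show "cvar b / cvar e \<in> eta F" using eta_quotient[OF FE(1) eE(1)] n(1) eE(2) by blast
    show "b \<notin> F \<Longrightarrow> cvar b / cvar e \<in> off_part F" using n(1) by (simp add: off_part_quotient)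
    assume b: "b \<in> F"
    \<comment> \<open>This is where the maximality of \<open>y\<close> enters:
      \<open>cvar b / cvar e\<close> becomes a multiple of the generator
      \<open>cvar b / cvar y\<close>.\<close>
    have "cvar y / cvar e \<in> S" using n(2) y by (auto simp: top_min_def)
    from local_ideal_gen[OF S b FE(2) this, of y]
    have "cvar b / cvar e \<in> ?J" by simp
    thus "cvar b / cvar e \<in> ?J \<inter> ?M" using max_eta_quotient[OF FE(1) b eE(1) n(1)] by blast
  qed
  have coE: "constants \<subseteq> eta F" unfolding eta_def
    by (intro constants_proj_local_ring generic_prime_proj FE)
  have chart_eta: "chart k S \<subseteq> eta F"
    unfolding chart_def using coE gen_eta by (intro generated_minimal Ls) (auto simp: chart_gens_def)
  have chart_S: "chart k S \<subseteq> S" by (rule chart_subset[OF S goodD(3)[OF g]])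
  \<comment> \<open>\<open>?D\<close> consists of the elements that split into a part free of
    \<open>F\<close> and a part in the ideal. The remainder is kept in \<open>?M\<close> too, so
    that the \<open>F\<close>-free part can later be compared at \<open>eta F\<close>.\<close>
  let ?D = "{a \<in> S \<inter> eta F. \<exists>a0 j. a = a0 + j \<and> a0 \<in> off_part F \<inter> S \<inter> eta F \<and> j \<in> ?J \<inter> ?M}"
  have D: "subring_on ?D"
    unfolding subring_on_def
  proof (intro conjI ballI)
    show "1 \<in> ?D"
      using subring_onD(1)[OF off_part_ring[of F]] Sd(1) Ld(1) local_ideal_zero[OF S, of F y] max_ideal_zero[OF Ls]
      by (intro CollectI conjI exI[of _ 1] exI[of _ 0]) auto
    fix a b assume "a \<in> ?D" "b \<in> ?D"
    then obtain a0 j b0 i where *: "a = a0 + j" "a0 \<in> off_part F" "a0 \<in> S" "a0 \<in> eta F" "j \<in> ?J" "j \<in> ?M"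
      "b = b0 + i" "b0 \<in> off_part F" "b0 \<in> S" "b0 \<in> eta F" "i \<in> ?J" "i \<in> ?M"
      "a \<in> S" "a \<in> eta F" "b \<in> S" "b \<in> eta F" by blast
    have m1: "- 1 \<in> S" "- 1 \<in> eta F" using Sd(1,3) Ld(1,3) by auto
    have "a - b = (a0 - b0) + (j + - 1 * i)" using * by simp
    moreover have "j + - 1 * i \<in> ?J"
      by (intro local_ideal_add[OF S] local_ideal_mult[OF S] * m1)
    moreover have "j + - 1 * i \<in> ?M" by (intro max_ideal_add[OF L] max_ideal_mult(2)[OF Ls] * m1)
    moreover have "a0 - b0 \<in> off_part F \<inter> S \<inter> eta F"
      using * Sd(5) Ld(5) subring_onD(5)[OF off_part_ring] by blast
    moreover have "a - b \<in> S \<inter> eta F" using * Sd(5) Ld(5) by blast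
    ultimately show "a - b \<in> ?D" by blast
    have "a * b = (a0 * b0) + (a0 * i + b * j)" using * by (simp add: algebra_simps)
    moreover have "a0 * i + b * j \<in> ?J"
      by (intro local_ideal_add[OF S] local_ideal_mult[OF S] *)
    moreover have "a0 * i + b * j \<in> ?M" by (intro max_ideal_add[OF L] max_ideal_mult(2)[OF Ls] *)
    moreover have "a0 * b0 \<in> off_part F \<inter> S \<inter> eta F"
      using * Sd(6) Ld(6) subring_onD(6)[OF off_part_ring] by blast
    moreover have "a * b \<in> S \<inter> eta F" using * Sd(6) Ld(6) by blast
    ultimately show "a * b \<in> ?D" by blast
  qed
  have "constants \<union> chart_gens k S \<subseteq> ?D"
  proof
    fix a assume a: "a \<in> constants \<union> chart_gens k S"
    hence aS: "a \<in> S \<inter> eta F"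
      using chart_S chart_eta generated_incl[OF a] unfolding chart_def by blast
    from a consider "a \<in> off_part F" | "a \<in> ?J \<inter> ?M"
      using off_part_constants[of F] gen_dec unfolding chart_gens_def by blast
    thus "a \<in> ?D"
    proof cases
      case 1
      thus ?thesis using aS local_ideal_zero[OF S, of F y] max_ideal_zero[OF Ls]
        by (intro CollectI conjI exI[of _ a] exI[of _ 0]) auto
    next
      case 2
      thus ?thesis using aS Sd(2) Ld(2) subring_onD(2)[OF off_part_ring[of F]]
        by (intro CollectI conjI exI[of _ 0] exI[of _ a]) auto
    qed
  qed
  hence dec: "chart k S \<subseteq> ?D" unfolding chart_def by (rule generated_minimal[OF D])
  \<comment> \<open>If \<open>a\<close> vanishes at \<open>eta F\<close>, so does its
    \<open>F\<close>-free part, which is then zero; only the part in \<open>?J\<close>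
    remains.\<close>
  have chart_max: "a \<in> ?J" if a: "a \<in> chart k S" "a \<in> ?M" for a
  proof -
    obtain a0 j where *: "a = a0 + j" "a0 \<in> off_part F" "j \<in> ?J" "j \<in> ?M" using dec a(1) by blast
    have "a0 = a + - j" using * by simp
    hence "a0 \<in> ?M" using max_ideal_add[OF L a(2) max_ideal_minus[OF Ls *(4)]] by simp
    hence "a0 = 0" using off_part_max_eta[OF FE(1) *(2)] by blast
    thus ?thesis using * by simp
  qed
  \<comment> \<open>A denominator vanishing at \<open>eta F\<close> would lie in \<open>?J\<close>,
    hence be a nonunit of \<open>S\<close>.\<close>
  have unit: "inverse q \<in> eta F" if q: "q \<in> chart k S" "q \<noteq> 0" "inverse q \<in> S" for q
  proof -
    have "q \<notin> max_ideal S" using q chart_S max_ideal_iff[of q S] by blast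
    hence "q \<notin> ?M" using chart_max[OF q(1)] JS by blast
    thus ?thesis using q(1) chart_eta max_ideal_iff[of q "eta F"] by blast
  qed
  show SE: "S \<subseteq> eta F"
  proof
    fix x assume "x \<in> S"
    then obtain p q where pq: "x = p / q" "p \<in> chart k S" "q \<in> chart k S" "q \<noteq> 0" "inverse q \<in> S"
      using goodD(5)[OF g] unfolding fracs_def by blast
    thus "x \<in> eta F" using unit chart_eta Ld(6) by (auto simp: divide_inverse)
  qed
  show "S \<inter> ?M \<subseteq> ?J"
  proof
    fix x assume x: "x \<in> S \<inter> ?M"
    then obtain p q where pq: "x = p / q" "p \<in> chart k S" "q \<in> chart k S" "q \<noteq> 0" "inverse q \<in> S"
      using goodD(5)[OF g] unfolding fracs_def by blast
    have "q \<in> eta F" using pq(3) chart_eta by blast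
    hence "q * x \<in> ?M" using max_ideal_mult(2)[OF Ls] x by blast
    hence "p \<in> ?J" using chart_max[OF pq(2)] pq(1,4) by simp
    from local_ideal_mult[OF S this pq(5)] show "x \<in> ?J" using pq(1) by (simp add: divide_inverse mult.commute)
  qed
qed

text \<open>The clauses on \<open>strict_at\<close> pin it down for the next centre: its points
  satisfy \<open>unsep\<close>; at a stage where \<open>F\<close> is blown up, \<open>key\<close>
  turns \<open>unsep\<close> into \<open>S \<subseteq> eta F\<close>; and the last clause leads from
  there back to the strict transform.\<close>

definition tower_inv :: "nat \<Rightarrow> bool" where
  "tower_inv k \<longleftrightarrow> (\<forall>S\<in>space_at k. good k S) \<and>
     (\<forall>F. proper F \<longrightarrow> F \<notin> treated k \<longrightarrow> strict_at k (lin F) \<subseteq> {S \<in> space_at k. unsep k S F} \<and>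
        eta F \<in> strict_at k (lin F) \<and> (\<forall>S\<in>space_at k. S \<subseteq> eta F \<longrightarrow> S \<in> strict_at k (lin F)))"

lemma tower_invD:
  assumes "tower_inv k"
  shows "S \<in> space_at k \<Longrightarrow> good k S" "S \<in> space_at k \<Longrightarrow> subring_on S"
    "proper F \<Longrightarrow> F \<notin> treated k \<Longrightarrow> S \<in> strict_at k (lin F) \<Longrightarrow> S \<in> space_at k"
    "proper F \<Longrightarrow> F \<notin> treated k \<Longrightarrow> S \<in> strict_at k (lin F) \<Longrightarrow> unsep k S F"
    "proper F \<Longrightarrow> F \<notin> treated k \<Longrightarrow> eta F \<in> strict_at k (lin F)"
    "proper F \<Longrightarrow> F \<notin> treated k \<Longrightarrow> S \<in> space_at k \<Longrightarrow> S \<subseteq> eta F \<Longrightarrow> S \<in> strict_at k (lin F)"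
  using assms goodD(2)[of k S] unfolding tower_inv_def by blast+

lemma centre_eq:
  assumes "tower_inv k"
  shows "centre k = {S \<in> space_at k. \<exists>F\<in>stage k. unsep k S F}"
proof
  show "centre k \<subseteq> {S \<in> space_at k. \<exists>F\<in>stage k. unsep k S F}"
    unfolding centre_def using tower_invD(3,4)[OF assms] stage_proper by blast
  show "{S \<in> space_at k. \<exists>F\<in>stage k. unsep k S F} \<subseteq> centre k"
  proof
    fix S assume "S \<in> {S \<in> space_at k. \<exists>F\<in>stage k. unsep k S F}"
    then obtain F where F: "S \<in> space_at k" "F \<in> stage k" "unsep k S F" by blast
    note pF = stage_proper[OF F(2)]
    note g = tower_invD(1)[OF assms F(1)]
    obtain G y where "top_min k S F G y" using top_min_exists[OF g, of F] pF by (auto simp: proper_def)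
    hence "S \<subseteq> eta F" using key(1)[OF g F(2,3)] by blast
    hence "S \<in> strict_at k (lin F)" using tower_invD(6)[OF assms pF F(1)] by blast
    thus "S \<in> centre k" using F(2) by (auto simp: centre_def)
  qed
qed

text \<open>One minimal edge in one treated set refutes \<open>unsep\<close>, and its minimality is
  a matter of finitely many ratios.\<close>

lemma not_unsep_witness:
  assumes "\<not> unsep k S F"
  shows "\<exists>A. finite A \<and> A \<subseteq> S \<and> (\<forall>S'. A \<subseteq> S' \<longrightarrow> \<not> unsep k S' F)"
proof -
  obtain F' e where *: "F' \<in> treated k" "F \<subset> F'" "e \<in> F" "ismin S F' e"
    using assms by (auto simp: unsep_def)
  show ?thesis
  proof (intro exI[of _ "(\<lambda>b. cvar b / cvar e) ` F'"] conjI allI impI)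
    show "finite ((\<lambda>b. cvar b / cvar e) ` F')" using treated_finite(1)[OF *(1)] by blast
    show "(\<lambda>b. cvar b / cvar e) ` F' \<subseteq> S" using ismin_in(2)[OF *(4)] by blast
    fix S' assume "(\<lambda>b. cvar b / cvar e) ` F' \<subseteq> S'"
    hence "ismin S' F' e" using ismin_in(1)[OF *(4)] by (auto simp: ismin_def)
    thus "\<not> unsep k S' F" using * by (auto simp: unsep_def)
  qed
qed

lemma not_unsep_witnesses:
  assumes "finite \<F>" "\<And>F. F \<in> \<F> \<Longrightarrow> \<not> unsep k S F"
  obtains A where "finite A" "A \<subseteq> S" "\<forall>S' F. A \<subseteq> S' \<longrightarrow> F \<in> \<F> \<longrightarrow> \<not> unsep k S' F"
proof -
  have "\<forall>F\<in>\<F>. \<exists>A. finite A \<and> A \<subseteq> S \<and> (\<forall>S'. A \<subseteq> S' \<longrightarrow> \<not> unsep k S' F)"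
    by (intro ballI not_unsep_witness assms(2))
  then obtain A where A: "\<forall>F\<in>\<F>. finite (A F) \<and> A F \<subseteq> S \<and> (\<forall>S'. A F \<subseteq> S' \<longrightarrow> \<not> unsep k S' F)"
    by (rule bchoice[THEN exE])
  show thesis
  proof (rule that[of "\<Union>F\<in>\<F>. A F"])
    show "finite (\<Union>F\<in>\<F>. A F)" using A assms(1) by simp
    show "(\<Union>F\<in>\<F>. A F) \<subseteq> S" using A by (simp add: UN_subset_iff)
    show "\<forall>S' F. (\<Union>F\<in>\<F>. A F) \<subseteq> S' \<longrightarrow> F \<in> \<F> \<longrightarrow> \<not> unsep k S' F"
      using A by (simp add: UN_subset_iff)
  qed
qed

lemma stalk_off:
  assumes inv: "tower_inv k" and S: "S \<in> space_at k" and "\<And>F. F \<in> stage k \<Longrightarrow> \<not> unsep k S F"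
  shows "ideal_stalk (space_at k) (centre k) S = S"
proof -
  obtain A where A: "finite A" "A \<subseteq> S" "\<forall>S' F. A \<subseteq> S' \<longrightarrow> F \<in> stage k \<longrightarrow> \<not> unsep k S' F"
    by (rule not_unsep_witnesses[OF finite_stage assms(3)])
  show ?thesis
  proof (rule ideal_stalk_off_centre)
    show "openin (zariski (space_at k)) {S \<in> space_at k. A \<subseteq> S}"
      using tower_invD(2)[OF inv] A(1) by (rule openin_zariski_finite)
    show "S \<in> {S \<in> space_at k. A \<subseteq> S}" using S A by blast
    show "{S \<in> space_at k. A \<subseteq> S} \<inter> centre k = {}" using A(3) centre_eq[OF inv] by blast
  qed (rule tower_invD(2)[OF inv])
qed

text \<open>The minimal edge of the treated union lies in one of the two graphs and refutes
  \<open>unsep\<close> for that one: the centres of one stage are disjoint.\<close>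

lemma unsep_unique:
  assumes "good k S" "F \<in> stage k" "F' \<in> stage k" "F \<noteq> F'" "unsep k S F"
  shows "\<not> unsep k S F'"
proof
  assume u: "unsep k S F'"
  note U = stage_Un[OF assms(2-4)]
  obtain e where e: "ismin S (F \<union> F') e" using goodD(4)[OF assms(1) U(1)] by blast
  thus False using ismin_in(1)[OF e] u assms(5) U by (auto simp: unsep_def)
qed

text \<open>A germ vanishing on the centre vanishes at \<open>eta F\<close>, where
  \<open>key\<close> identifies it. Conversely, the generators stay in the maximal ideal at all
  points of the centre in a suitable neighbourhood.\<close>

lemma stalk_on:
  assumes inv: "tower_inv k" and S: "S \<in> space_at k" and F: "F \<in> stage k" and u: "unsep k S F"
    and y: "top_min k S F G y"
  shows "ideal_stalk (space_at k) (centre k) S = local_ideal S F y"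
proof
  note g = tower_invD(1)[OF inv S]
  note pF = stage_proper[OF F]
  note K = key[OF g F u y]
  show "ideal_stalk (space_at k) (centre k) S \<subseteq> local_ideal S F y"
  proof
    fix f assume "f \<in> ideal_stalk (space_at k) (centre k) S"
    then obtain U where f: "f \<in> S" "openin (zariski (space_at k)) U" "S \<in> U"
      "\<forall>S'\<in>U \<inter> centre k. f \<in> max_ideal S'" unfolding ideal_stalk_def by blast
    have e: "eta F \<in> strict_at k (lin F)" using tower_invD(5)[OF inv pF] .
    hence "eta F \<in> space_at k" using tower_invD(3)[OF inv pF] by blast
    hence "eta F \<in> U" using openin_zariski_generization[OF f(2,3) K(1)] by blast
    moreover have "eta F \<in> centre k" using e F by (auto simp: centre_def)
    ultimately show "f \<in> local_ideal S F y" using f(1,4) K(2) by blast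
  qed
  show "local_ideal S F y \<subseteq> ideal_stalk (space_at k) (centre k) S"
  proof
    fix f assume f: "f \<in> local_ideal S F y"
    then obtain s where s: "f = (\<Sum>e\<in>F. s e * (cvar e / cvar y))" "\<forall>e. s e \<in> S"
      unfolding local_ideal_def by blast
    have fin: "finite F" using pF(1) by (rule proper_finite)
    have yG: "G \<in> treated k" "F \<subset> G" "ismin S G y" using y by (auto simp: top_min_def)
    have others: "\<And>F'. F' \<in> stage k - {F} \<Longrightarrow> \<not> unsep k S F'" using unsep_unique[OF g F] u by blast
    obtain A where A: "finite A" "A \<subseteq> S" "\<forall>S' F'. A \<subseteq> S' \<longrightarrow> F' \<in> stage k - {F} \<longrightarrow> \<not> unsep k S' F'"
      by (rule not_unsep_witnesses[OF finite_Diff[OF finite_stage] others])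
    \<comment> \<open>The three groups keep the other centres of this stage away, keep
      \<open>y\<close> minimal in \<open>G\<close>, and keep the coefficients of \<open>f\<close>
      regular.\<close>
    let ?A = "A \<union> (\<lambda>b. cvar b / cvar y) ` G \<union> s ` F"
    let ?U = "{S' \<in> space_at k. ?A \<subseteq> S'}"
    have finA: "finite ?A" using A(1) fin treated_finite(1)[OF yG(1)] by (intro finite_UnI finite_imageI)
    have u1: "openin (zariski (space_at k)) ?U"
      using tower_invD(2)[OF inv] finA by (rule openin_zariski_finite)
    have u2: "S \<in> ?U" using S A(2) s(2) ismin_in(2)[OF yG(3)] by auto
    have u3: "f \<in> S'" if "S' \<in> ?U" for S'
    proof -
      have S': "subring_on S'" using that tower_invD(2)[OF inv] by blast
      have "s e * (cvar e / cvar y) \<in> S'" if "e \<in> F" for e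
        using that \<open>S' \<in> ?U\<close> yG(2) by (intro subring_onD(6)[OF S']) auto
      thus ?thesis unfolding s(1) by (rule subring_on_sum[OF S'])
    qed
    have u4: "f \<in> max_ideal S'" if S': "S' \<in> ?U \<inter> centre k" for S'
    proof -
      have S1: "S' \<in> space_at k" "?A \<subseteq> S'" using S' by blast+
      note g' = tower_invD(1)[OF inv S1(1)]
      obtain F' where F': "F' \<in> stage k" "unsep k S' F'" using S' centre_eq[OF inv] by blast
      moreover have "A \<subseteq> S'" using S1(2) by blast
      ultimately have u': "unsep k S' F" using A(3)[rule_format, of S' F'] by blast
      have "ismin S' G y" using S1(2) ismin_in(1)[OF yG(3)] by (auto simp: ismin_def)
      note m = unsep_max_ideal[OF g' u' yG(1,2) this]
      show ?thesis unfolding s(1)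
      proof (rule max_ideal_sum[OF goodD(1)[OF g']])
        fix e assume e: "e \<in> F"
        hence "s e \<in> S'" using S1(2) by blast
        thus "s e * (cvar e / cvar y) \<in> max_ideal S'"
          using max_ideal_mult(2)[OF goodD(2)[OF g'] m[OF e]] by blast
      qed
    qed
    show "f \<in> ideal_stalk (space_at k) (centre k) S"
      unfolding ideal_stalk_def mem_Collect_eq
      by (intro conjI exI[of _ ?U] ballI u1 u2 u3 u4 u3[OF u2])
  qed
qed

section \<open>The effect of one blow-up\<close>

lemma not_unsep_ismin:
  assumes "F \<in> stage k" "\<not> unsep k S F" shows "\<exists>e. ismin S F e"
  using assms unfolding unsep_def ismin_def by blast

text \<open>Away from the centre a minimal edge of each new set comes from a larger treated set. On
  the centre, blowing up makes one of the generators of the ideal divide all the others, and its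
  edge is minimal in the new set.\<close>

lemma step_good:
  assumes inv: "tower_inv k" and S': "S' \<in> space_at (Suc k)"
  shows "good (Suc k) S'"
proof (rule blowupE[OF S'[unfolded space_at_Suc] tower_invD(2)[OF inv]])
  fix S R Q x assume *: "S \<in> space_at k" "x \<in> ideal_stalk (space_at k) (centre k) S" "x \<noteq> 0"
    "R = generated (S \<union> {y / x | y. y \<in> ideal_stalk (space_at k) (centre k) S})" "S' = localization R Q"
    "primeideal Q (ring_on R)" "subring_on R" "R \<subseteq> S'" "local_on S'" "S \<subseteq> S'"
    "\<And>y. y \<in> ideal_stalk (space_at k) (centre k) S \<Longrightarrow> y / x \<in> S'"
  note g = tower_invD(1)[OF inv *(1)]
  note S = goodD(2)[OF g]
  have sub': "subring_on S'" using *(9) by (rule local_onD)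
  have co: "constants \<subseteq> S'" using goodD(3)[OF g] *(10) by blast
  \<comment> \<open>Since \<open>?L\<close> contains the inverses that exist in \<open>S'\<close>,
    it is enough to place the generators of \<open>R\<close> in it.\<close>
  let ?L = "fracs (Suc k) S'"
  note L = subring_on_fracs[OF sub', of "Suc k"]
  have "fracs k S \<subseteq> ?L" using *(10) by (rule fracs_mono) (simp add: treated_Suc)
  hence SL: "S \<subseteq> ?L" using goodD(5)[OF g] by blast
  have inv_L: "inverse z \<in> ?L" if "z \<in> ?L" "inverse z \<in> S'" for z
    using fracs_inverse[OF sub' co that] .
  have *: "(\<forall>F\<in>stage k. \<exists>e. ismin S' F e) \<and> (\<forall>z\<in>ideal_stalk (space_at k) (centre k) S. z / x \<in> ?L)"
  proof (cases "\<exists>F\<in>stage k. unsep k S F")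
    case False
    hence st: "ideal_stalk (space_at k) (centre k) S = S" using stalk_off[OF inv *(1)] by blast
    have xS: "x \<in> S" "inverse x \<in> S'" using *(2) *(11)[of 1] subring_onD(1)[OF S] unfolding st
      by (auto simp: inverse_eq_divide)
    hence "inverse x \<in> ?L" using inv_L SL by blast
    hence "\<forall>z\<in>S. z / x \<in> ?L" using SL subring_onD(6)[OF L] by (auto simp: divide_inverse)
    moreover have "\<forall>F\<in>stage k. \<exists>e. ismin S' F e" using False not_unsep_ismin ismin_mono[OF _ *(10)] by metis
    ultimately show ?thesis unfolding st by blast
  next
    case True
    then obtain F where F: "F \<in> stage k" "unsep k S F" by blast
    have pF: "F \<subset> E" "finite F" using stage_proper(1)[OF F(1)] proper_finite by (auto simp: proper_def)
    obtain G y where y: "top_min k S F G y" using top_min_exists[OF g pF(1)] by blast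
    note st = stalk_on[OF inv *(1) F y]
    obtain s where s: "x = (\<Sum>e\<in>F. s e * (cvar e / cvar y))" "\<forall>e. s e \<in> S"
      using *(2) unfolding st local_ideal_def by blast
    have gen: "cvar e / cvar y \<in> local_ideal S F y" if "e \<in> F" for e
      using local_ideal_gen[OF S that pF(2) subring_onD(1)[OF S], of y] by simp
    \<comment> \<open>The generators of the ideal divided by its new local equation
      \<open>x\<close>.\<close>
    define w where "w e = (cvar e / cvar y) / x" for e
    have w: "w e \<in> S'" if "e \<in> F" for e
      unfolding w_def using *(11)[of "cvar e / cvar y"] gen[OF that] unfolding st by blast
    have "1 = x / x" using *(3) by simp
    also have "\<dots> = (\<Sum>e\<in>F. s e * w e)"
      unfolding w_def by (subst s(1)) (simp only: sum_divide_distrib times_divide_eq_right)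
    finally have one: "1 = (\<Sum>e\<in>F. s e * w e)" .
    \<comment> \<open>In a local ring not all summands of 1 are nonunits; the edge of a unit summand
      will be the minimal one.\<close>
    have "\<exists>e\<in>F. s e * w e \<notin> max_ideal S'"
      using max_ideal_sum[OF *(9), of F "\<lambda>e. s e * w e"] one max_ideal_one[OF sub'] by metis
    then obtain e where e: "e \<in> F" "s e * w e \<notin> max_ideal S'" by blast
    have "w e \<notin> max_ideal S'" using max_ideal_mult(2)[OF sub', of "w e" "s e"] e(2) s(2) *(10) by blast
    hence we: "w e \<noteq> 0" "inverse (w e) \<in> S'" using max_ideal_iff[OF w[OF e(1)]] by blast+
    have quot: "w b * inverse (w e) = cvar b / cvar e" for b
      unfolding w_def using *(3) by (simp add: divide_simps)
    have min: "ismin S' F e"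
      unfolding ismin_def
    proof (intro conjI ballI e(1))
      fix b assume "b \<in> F"
      from subring_onD(6)[OF sub' w[OF this] we(2)] show "cvar b / cvar e \<in> S'" unfolding quot .
    qed
    have mins: "\<forall>F'\<in>stage k. \<exists>e. ismin S' F' e"
    proof
      fix F' assume F': "F' \<in> stage k"
      show "\<exists>e. ismin S' F' e"
      proof (cases "F' = F")
        case True thus ?thesis using min by blast
      next
        case False
        hence "\<not> unsep k S F'" using unsep_unique[OF g F(1) F'] F(2) by blast
        thus ?thesis using not_unsep_ismin[OF F'] ismin_mono[OF _ *(10)] by metis
      qed
    qed
    have quotL: "cvar b / cvar e \<in> ?L" if "b \<in> F" for b
    proof -
      have "cvar b / cvar e \<in> chart_gens (Suc k) S'"
        unfolding chart_gens_def using that F(1) min by (auto simp: treated_Suc)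
      hence "cvar b / cvar e \<in> chart (Suc k) S'" unfolding chart_def by (intro generated_incl) blast
      thus ?thesis using chart_fracs[OF sub'] by blast
    qed
    have comb: "(\<Sum>b\<in>F. t b * (cvar b / cvar e)) \<in> ?L" if "\<forall>b. t b \<in> S" for t
      using that SL quotL by (intro subring_on_sum[OF L] subring_onD(6)[OF L]) auto
    \<comment> \<open>Trades the denominator \<open>x\<close> for the minimal edge \<open>e\<close>:
      only ratios in the new chart and the factor \<open>w e\<close> remain. With
      \<open>t = s\<close> the left side is 1, which expresses \<open>inverse (w e)\<close> in the
      chart.\<close>
    have fact: "(\<Sum>b\<in>F. t b * (cvar b / cvar y)) / x = (\<Sum>b\<in>F. t b * (cvar b / cvar e)) * w e" for t
      unfolding quot[symmetric] sum_divide_distrib sum_distrib_right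
      using we(1) by (intro sum.cong refl) (simp add: w_def)
    have "inverse (w e) = (\<Sum>b\<in>F. s b * (cvar b / cvar e))"
      using fact[of s] s(1) *(3) we(1) by (simp add: field_simps del: times_divide_eq_right)
    hence iwL: "inverse (w e) \<in> ?L" using comb[OF s(2)] by metis
    hence "w e \<in> ?L" using inv_L[OF iwL] w[OF e(1)] by simp
    hence "\<forall>z\<in>local_ideal S F y. z / x \<in> ?L"
      unfolding local_ideal_def using fact comb subring_onD(6)[OF L] by auto
    thus ?thesis using mins unfolding st by blast
  qed
  note ** = this
  have "R \<subseteq> ?L" unfolding \<open>R = generated _\<close>
    using SL ** by (intro generated_minimal L) auto
  have "S' \<subseteq> ?L"
  proof
    fix z assume "z \<in> S'"
    then obtain a b where ab: "z = a / b" "a \<in> R" "b \<in> R - Q" using \<open>S' = localization R Q\<close>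
      by (auto simp: localization_def)
    have "inverse b \<in> S'" using localization_local(3)[OF \<open>subring_on R\<close> \<open>primeideal Q (ring_on R)\<close> ab(3)]
      \<open>S' = localization R Q\<close> by blast
    hence "inverse b \<in> ?L" using inv_L[of b] ab(3) \<open>R \<subseteq> ?L\<close> by blast
    thus "z \<in> ?L" using subring_onD(6)[OF L, of a "inverse b"] ab \<open>R \<subseteq> ?L\<close> by (auto simp: divide_inverse)
  qed
  moreover have "\<exists>e. ismin S' F e" if "F \<in> treated k" for F
    using goodD(4)[OF g that] ismin_mono[OF _ \<open>S \<subseteq> S'\<close>] by blast
  ultimately show "good (Suc k) S'" unfolding good_def using \<open>local_on S'\<close> co ** by (auto simp: treated_Suc)
qed

lemma step_space: "tower_inv k \<Longrightarrow> S \<in> space_at (Suc k) \<Longrightarrow> subring_on S"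
  using step_good goodD(2) by blast

lemma closed_unsep:
  assumes "\<And>S. S \<in> V \<Longrightarrow> subring_on S" "\<And>S. S \<in> W \<Longrightarrow> unsep k S F" "S \<in> zariski V closure_of W"
  shows "S \<in> V" "unsep k S F"
proof -
  show SV: "S \<in> V" using assms(3) topspace_zariski[OF assms(1)] by (auto simp: in_closure_of)
  show "unsep k S F"
  proof (rule ccontr)
    assume "\<not> unsep k S F"
    then obtain A where A: "finite A" "A \<subseteq> S" "\<forall>S'. A \<subseteq> S' \<longrightarrow> \<not> unsep k S' F"
      using not_unsep_witness by metis
    obtain S' where "S' \<in> W" "A \<subseteq> S'"
      by (rule zariski_closure_witness[OF assms(1,3) A(1,2)])
    thus False using A(3) assms(2) by blast
  qed
qed

text \<open>For a newly treated set, being off the centre means that \<open>unsep\<close> fails,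
  which supplies a larger treated set whose minimal edge lies in \<open>F\<close>.\<close>

lemma off_centre_min:
  assumes inv: "tower_inv k" and S: "S \<in> space_at k" "S \<notin> centre k" and F: "F \<in> treated (Suc k)"
  obtains F' e where "F' \<in> treated k" "F \<subseteq> F'" "e \<in> F" "ismin S F' e"
proof (cases "F \<in> treated k")
  case True
  thus ?thesis using goodD(4)[OF tower_invD(1)[OF inv S(1)] True] that[of F] ismin_in(1) by blast
next
  case False
  hence "F \<in> stage k" using F by (simp add: treated_Suc)
  hence "\<not> unsep k S F" using S centre_eq[OF inv] by blast
  thus ?thesis using that unfolding unsep_def by blast
qed

text \<open>Below, some edge \<open>e'\<close> of \<open>F\<close> is minimal in a larger treated
  set. Its ratio with \<open>e\<close> is regular in \<open>S\<close> and a unit in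
  \<open>S'\<close>, so by domination a unit in \<open>S\<close>, and \<open>e\<close> is minimal
  below too.\<close>

lemma dominating_min:
  assumes inv: "tower_inv k" and S: "S \<in> space_at k" "S \<notin> centre k" and dom: "dominates S' S"
    and F: "F \<in> treated (Suc k)" and e: "ismin S' F e"
  obtains F' where "F' \<in> treated k" "F \<subseteq> F'" "ismin S F' e"
proof -
  obtain F' e' where e': "F' \<in> treated k" "F \<subseteq> F'" "e' \<in> F" "ismin S F' e'"
    using off_centre_min[OF inv S F] by blast
  have q: "cvar e / cvar e' \<in> S" "cvar e' / cvar e \<in> S'"
    using e'(2,3) ismin_in(1)[OF e] ismin_in(2)[OF e'(4)] ismin_in(2)[OF e] by blast+
  have "cvar e' / cvar e \<in> S"
    using dominates_unit[OF dom q(1)] q(2) by simp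
  hence "ismin S F' e"
    using ismin_transfer[OF tower_invD(2)[OF inv S(1)] e'(4)] e'(2) ismin_in(1)[OF e] by blast
  thus ?thesis using that e' by blast
qed

lemma step_unsep:
  assumes inv: "tower_inv k" and F: "proper F" "F \<notin> treated (Suc k)"
    and S': "S' \<in> strict_at (Suc k) (lin F)"
  shows "S' \<in> space_at (Suc k)" "unsep (Suc k) S' F"
proof -
  have F': "F \<notin> treated k" using F(2) by (simp add: treated_Suc)
  let ?W = "{S' \<in> space_at (Suc k). \<exists>S\<in>strict_at k (lin F) - centre k. dominates S' S}"
  have cl: "S' \<in> zariski (space_at (Suc k)) closure_of ?W"
    using S' by (simp add: strict_at_Suc strict_transform_def space_at_Suc)
  have "unsep (Suc k) S' F" if "S' \<in> ?W" for S'
    unfolding unsep_def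
  proof (intro ballI impI notI)
    fix G e assume G: "G \<in> treated (Suc k)" "F \<subset> G" and e: "e \<in> F" "ismin S' G e"
    from that obtain S where S: "S \<in> strict_at k (lin F)" "S \<notin> centre k" "dominates S' S" by blast
    obtain G' where "G' \<in> treated k" "G \<subseteq> G'" "ismin S G' e"
      using dominating_min[OF inv tower_invD(3)[OF inv F(1) F' S(1)] S(2,3) G(1) e(2)] by blast
    thus False using tower_invD(4)[OF inv F(1) F' S(1)] G(2) e(1) unfolding unsep_def by blast
  qed
  from closed_unsep[OF step_space[OF inv] this cl]
  show "S' \<in> space_at (Suc k)" "unsep (Suc k) S' F" by blast+
qed

text \<open>\<open>F'\<close> is not contained in \<open>F\<close>, and the coordinate of an edge of
  \<open>F'\<close> outside \<open>F\<close> does not vanish at \<open>eta F\<close>; that edge is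
  minimal in all of \<open>E\<close>.\<close>

lemma eta_not_centre:
  assumes inv: "tower_inv k" and F: "proper F" "F \<notin> treated (Suc k)"
  shows "eta F \<notin> centre k" "F' \<in> stage k \<Longrightarrow> \<not> unsep k (eta F) F'"
proof -
  show n: "\<not> unsep k (eta F) F'" if F': "F' \<in> stage k" for F'
  proof -
    have FE: "F \<subset> E" "F' \<subset> E" using F(1) stage_proper(1)[OF F'] by (auto simp: proper_def)
    have "F' \<in> treated (Suc k)" using F' by (simp add: treated_Suc)
    from treated_not_subset[OF F this] obtain e where e: "e \<in> F'" "e \<notin> F" by blast
    hence eE: "e \<in> E" using FE(2) by blast
    hence "ismin (eta F) E e" using eta_quotient[OF FE(1) eE] e(2) by (simp add: ismin_def)
    thus ?thesis unfolding unsep_def using E_treated FE(2) e(1) by blast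
  qed
  thus "eta F \<notin> centre k" using centre_eq[OF inv] by blast
qed

text \<open>Blowing up changes nothing at \<open>eta F\<close>, since this point is off the
  centre.\<close>

lemma step_eta:
  assumes inv: "tower_inv k" and F: "proper F" "F \<notin> treated (Suc k)"
  shows "eta F \<in> strict_at (Suc k) (lin F)"
proof -
  have F': "F \<notin> treated k" using F(2) by (simp add: treated_Suc)
  have e: "eta F \<in> strict_at k (lin F)" by (rule tower_invD(5)[OF inv F(1) F'])
  hence V: "eta F \<in> space_at k" by (rule tower_invD(3)[OF inv F(1) F'])
  have "ideal_stalk (space_at k) (centre k) (eta F) = eta F"
    by (rule stalk_off[OF inv V]) (rule eta_not_centre(2)[OF inv F])
  hence "eta F \<in> space_at (Suc k)" unfolding space_at_Suc
    using F(1) by (intro blowup_off_centre V eta_local) (auto simp: proper_def)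
  moreover have "dominates (eta F) (eta F)" by (rule dominates_refl)
  ultimately have "eta F \<in> {S' \<in> space_at (Suc k). \<exists>S\<in>strict_at k (lin F) - centre k. dominates S' S}"
    using e eta_not_centre(1)[OF inv F] by blast
  moreover have "{S' \<in> space_at (Suc k). \<exists>S\<in>strict_at k (lin F) - centre k. dominates S' S}
    \<subseteq> topspace (zariski (space_at (Suc k)))"
    using topspace_zariski[OF step_space[OF inv]] by blast
  ultimately show ?thesis
    unfolding strict_at_Suc strict_transform_def space_at_Suc[symmetric] using closure_of_subset by blast
qed

lemma tower_inv_Suc:
  assumes inv: "tower_inv k" shows "tower_inv (Suc k)"
  unfolding tower_inv_def
proof (intro conjI ballI allI impI)
  show "good (Suc k) S" if "S \<in> space_at (Suc k)" for S by (rule step_good[OF inv that])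
  fix F assume F: "proper F" "F \<notin> treated (Suc k)"
  show "strict_at (Suc k) (lin F) \<subseteq> {S \<in> space_at (Suc k). unsep (Suc k) S F}"
    using step_unsep[OF inv F] by blast
  show e: "eta F \<in> strict_at (Suc k) (lin F)" by (rule step_eta[OF inv F])
  fix S assume "S \<in> space_at (Suc k)" "S \<subseteq> eta F"
  thus "S \<in> strict_at (Suc k) (lin F)"
    using e closure_of_specialization[OF _ _ _ step_space[OF inv]]
    unfolding strict_at_Suc strict_transform_def space_at_Suc[symmetric] by blast
qed

text \<open>Initially only \<open>E\<close> is treated, and a nonvanishing coordinate is minimal in
  it. Dividing numerator and denominator by its power gives fractions over the affine chart.\<close>

lemma good_0:
  assumes P: "P \<in> proj_primes E"
  shows "good 0 (proj_local_ring E P)" (is "good 0 ?S")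
proof -
  note Pd = proj_prime[OF P]
  obtain e where e: "e \<in> E" "coord e \<notin> P" using Pd(7) by blast
  have min: "ismin ?S E e" using proj_coord_quotient[OF P e(1)] e by (simp add: ismin_def)
  have "generated (constants \<union> {cvar b / cvar e | b. b \<in> E}) \<subseteq> chart 0 ?S"
    unfolding chart_def by (rule generated_mono) (use min in \<open>auto simp: chart_gens_def treated_0\<close>)
  hence C: "Fract f 1 / cvar e ^ d \<in> chart 0 ?S" if "f \<in> polys E" "homogeneous d f" for f d
    using homogeneous_quotient_generated[OF finite_E e(1) that] by blast
  have pow: "cvar e ^ d = Fract (coord e ^ d) 1" for d
    by (induction d) (simp_all add: cvar_def One_fract_def)
  have hpow: "homogeneous d (coord e ^ d)" "coord e ^ d \<in> polys E" for d
  proof (induction d)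
    case 0
    { case 1 show ?case by (simp add: homogeneous_one) }
    { case 2 show ?case by (simp add: polys_ring(1)) }
  next
    case (Suc d)
    { case 1 show ?case using homogeneous_mult[OF homogeneous_coord Suc(1), of e] by simp }
    { case 2 show ?case using polys_mult[OF coord_polys[OF e(1)] Suc(2)] by simp }
  qed
  have "?S \<subseteq> fracs 0 ?S"
  proof
    fix x assume "x \<in> ?S"
    then obtain f g d where fg: "x = Fract f g" "f \<in> polys E" "g \<in> polys E" "g \<notin> P"
      "homogeneous d f" "homogeneous d g" by (auto simp: proj_local_ring_def)
    let ?p = "Fract f 1 / cvar e ^ d" and ?q = "Fract g 1 / cvar e ^ d"
    have g0: "g \<noteq> 0" using fg(4) Pd(2) by blast
    hence q0: "?q \<noteq> 0" by (simp add: to_fract_eq_0_iff)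
    have "x = ?p / ?q" unfolding fg(1) Fract_eq_divide[of f g] using q0 by (simp del: divide_fract)
    moreover have "inverse ?q \<in> ?S"
      using proj_local_ringI[OF hpow(2) fg(3,4) hpow(1) fg(6)] by (simp add: pow)
    ultimately show "x \<in> fracs 0 ?S" unfolding fracs_def using C fg(2,3,5,6) q0 by blast
  qed
  thus ?thesis
    unfolding good_def using proj_local_ring_local[OF P] constants_proj_local_ring[OF P] min
    by (auto simp: treated_0)
qed

lemma tower_inv_0: "tower_inv 0"
  unfolding tower_inv_def space_at_0 strict_at_0
proof (intro conjI ballI allI impI)
  show "good 0 S" if "S \<in> proj_space E" for S using that good_0 by (auto simp: proj_space_def)
  fix F assume F: "proper F" "F \<notin> treated 0"
  hence FE: "F \<subset> E" by (simp add: proper_def)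
  show "lin F \<subseteq> {S \<in> proj_space E. unsep 0 S F}"
    using lin_caseB[of _ F] FE by (auto simp: unsep_def treated_0) (auto simp: lin_def proj_zeros_def proj_space_def)
  show "eta F \<in> lin F" by (rule eta_in_lin[OF FE order_refl])
  fix S assume S: "S \<in> proj_space E" "S \<subseteq> eta F"
  then obtain P where P: "S = proj_local_ring E P" "P \<in> proj_primes E" by (auto simp: proj_space_def)
  have "coord e \<in> P" if "e \<in> F" for e
  proof (rule ccontr)
    assume h: "coord e \<notin> P"
    have eE: "e \<in> E" using that FE by blast
    have "\<forall>b\<in>E. cvar b / cvar e \<in> eta F" using proj_coord_quotient[OF P(2) eE] h P(1) S(2) by blast
    thus False using eta_quotient[OF FE eE] that by blast
  qed
  thus "S \<in> lin F" using P by (auto simp: lin_def proj_zeros_def)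
qed

theorem tower_inv: "tower_inv k"
  by (induction k) (auto intro: tower_inv_0 tower_inv_Suc)

end

section \<open>The strict transform of the graph hypersurface\<close>

context core_graph
begin

text \<open>
  In a \<open>frame\<close>, every monomial of the graph polynomial is divisible by \<open>frame_monom\<close>,
  and \<open>local_eq\<close> vanishes on the strict transform of the graph hypersurface.
\<close>

definition matched :: "('e set \<times> 'e) list \<Rightarrow> bool" where
  "matched Gs \<longleftrightarrow> (\<forall>T. spanning_tree ends E T \<longrightarrow>
     (\<exists>bs. set bs = E - T \<and> distinct bs \<and> list_all2 (\<lambda>b (G, e). b \<in> G) bs Gs))"

definition frame :: "nat \<Rightarrow> 'e ratfun set \<Rightarrow> ('e set \<times> 'e) list \<Rightarrow> bool" where
  "frame k S Gs \<longleftrightarrow> (\<forall>(G, e)\<in>set Gs. G \<in> treated k \<and> ismin S G e) \<and> matched Gs"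

definition frame_monom :: "('e set \<times> 'e) list \<Rightarrow> 'e ratfun" where
  "frame_monom Gs = prod_list (map (cvar \<circ> snd) Gs)"

definition local_eq :: "('e set \<times> 'e) list \<Rightarrow> 'e ratfun" where
  "local_eq Gs = Fract (graph_poly ends E) 1 / frame_monom Gs"

lemma frame_monom_nonzero: "frame_monom Gs \<noteq> 0"
  by (induction Gs) (auto simp: frame_monom_def)

text \<open>The quotient splits along the matching into ratios \<open>cvar b / cvar e\<close> with
  \<open>e\<close> minimal in a set containing \<open>b\<close>.\<close>

lemma frame_quotient:
  assumes "subring_on S" "list_all2 (\<lambda>b (G, e). b \<in> G) bs Gs" "\<forall>(G, e)\<in>set Gs. ismin S G e"
  shows "prod_list (map cvar bs) / frame_monom Gs \<in> S"
  using assms(2,3)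
proof (induction rule: list_all2_induct)
  case Nil
  show ?case using subring_onD(1)[OF assms(1)] by (simp add: frame_monom_def)
next
  case (Cons b bs Ge Gs)
  obtain G e where Ge: "Ge = (G, e)" by (cases Ge)
  have "cvar b / cvar e \<in> S" using Cons ismin_in(2)[of S G e b] by (auto simp: Ge)
  moreover have "prod_list (map cvar bs) / frame_monom Gs \<in> S" using Cons by auto
  ultimately have "(cvar b / cvar e) * (prod_list (map cvar bs) / frame_monom Gs) \<in> S"
    by (rule subring_onD(6)[OF assms(1)])
  thus ?case by (simp add: frame_monom_def Ge)
qed

lemma finite_trees: "finite {T. spanning_tree ends E T}"
  by (rule finite_subset[of _ "Pow E"]) (use finite_E in \<open>auto simp: spanning_tree_def\<close>)

lemma local_eq_sum:
  "local_eq Gs = (\<Sum>T | spanning_tree ends E T. (\<Prod>e\<in>E - T. cvar e) / frame_monom Gs)"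
  unfolding local_eq_def graph_poly_def
  by (simp only: to_fract_sum to_fract_prod sum_divide_distrib cvar_def)

lemma tree_term:
  assumes "subring_on S" "matched Gs" "\<forall>(G, e)\<in>set Gs. ismin S G e" "spanning_tree ends E T"
  shows "(\<Prod>e\<in>E - T. cvar e) / frame_monom Gs \<in> S"
proof -
  obtain bs where bs: "set bs = E - T" "distinct bs" "list_all2 (\<lambda>b (G, e). b \<in> G) bs Gs"
    using assms(2,4) unfolding matched_def by blast
  have "(\<Prod>e\<in>E - T. cvar e) = prod_list (map cvar bs)"
    using prod.distinct_set_conv_list[OF bs(2), of cvar] bs(1) by simp
  thus ?thesis using frame_quotient[OF assms(1) bs(3) assms(3)] by simp
qed

lemma local_eq_mem:
  assumes "subring_on S" "matched Gs" "\<forall>(G, e)\<in>set Gs. ismin S G e"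
  shows "local_eq Gs \<in> S"
  unfolding local_eq_sum using tree_term[OF assms] by (intro subring_on_sum[OF assms(1)]) simp

lemma frameD: "frame k S Gs \<Longrightarrow> matched Gs" "frame k S Gs \<Longrightarrow> \<forall>(G, e)\<in>set Gs. ismin S G e"
  "frame k S Gs \<Longrightarrow> (G, e) \<in> set Gs \<Longrightarrow> G \<in> treated k \<and> ismin S G e"
  by (auto simp: frame_def)

lemma matched_length: "matched Gs \<Longrightarrow> spanning_tree ends E T \<Longrightarrow> length Gs = h1 ends E"
  unfolding matched_def using card_spanning_tree_complement[OF finite_E] distinct_card list_all2_lengthD by metis

lemma graph_poly_homogeneous: "homogeneous (h1 ends E) (graph_poly ends E)"
proof -
  have *: "homogeneous (h1 ends E) (\<Prod>e\<in>E - T. coord e)" if "spanning_tree ends E T" for T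
    using homogeneous_prod_coord[of "E - T"] card_spanning_tree_complement[OF finite_E that] by simp
  show ?thesis unfolding graph_poly_def by (rule homogeneous_sum, rule *) simp
qed

text \<open>At the start all sets of a frame are \<open>E\<close>, so the chosen coordinates do not
  vanish at the point. The frame monomial has the degree of the graph polynomial and is an
  admissible denominator.\<close>

lemma hypersurface_0:
  assumes S: "S \<in> graph_hypersurface ends E" and fr: "frame 0 S Gs"
  shows "local_eq Gs \<in> max_ideal S"
proof (cases "\<exists>T. spanning_tree ends E T")
  \<comment> \<open>Without a spanning tree, \<open>matched\<close> says nothing about the length of
    \<open>Gs\<close>, but then the graph polynomial is zero.\<close>
  case False
  obtain P where P: "S = proj_local_ring E P" "P \<in> proj_primes E"
    using S by (auto simp: graph_hypersurface_def proj_zeros_def)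
  have none: "{T. spanning_tree ends E T} = {}" using False by blast
  have "local_eq Gs = 0" unfolding local_eq_sum none by simp
  thus ?thesis using max_ideal_zero[OF local_onD[OF proj_local_ring_local[OF P(2)]]] P(1) by simp
next
  case True
  obtain P where P: "S = proj_local_ring E P" "P \<in> proj_primes E" "graph_poly ends E \<in> P"
    using S by (auto simp: graph_hypersurface_def proj_zeros_def)
  note Pd = proj_prime[OF P(2)]
  have len: "length Gs = h1 ends E" using True matched_length frameD(1)[OF fr] by blast
  let ?m = "prod_list (map (coord \<circ> snd) Gs)"
  have e: "e \<in> E \<and> coord e \<notin> P" if "(G, e) \<in> set Gs" for G e
  proof -
    have "ismin S E e" using frameD(3)[OF fr that] by (auto simp: treated_0)
    thus ?thesis using proj_coord_quotient[OF P(2), of e] P(1) by (auto simp: ismin_def)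
  qed
  have "\<forall>x\<in>set (map (coord \<circ> snd) Gs). x \<in> polys E \<and> x \<notin> P"
  proof
    fix x assume "x \<in> set (map (coord \<circ> snd) Gs)"
    then obtain G e' where "(G, e') \<in> set Gs" "x = coord e'" by auto
    thus "x \<in> polys E \<and> x \<notin> P" using e[of G e'] by (simp add: coord_polys)
  qed
  hence "?m \<in> polys E \<and> ?m \<notin> P"
  proof (induction "map (coord \<circ> snd) Gs" arbitrary: Gs)
    case Nil
    thus ?case using Pd(3) polys_ring(1) by simp
  next
    case (Cons x xs)
    then obtain Ge Gs' where Gs': "Gs = Ge # Gs'" "x = coord (snd Ge)" "xs = map (coord \<circ> snd) Gs'" by auto
    have xs: "prod_list xs \<in> polys E \<and> prod_list xs \<notin> P"
      unfolding Gs'(3) using Cons.prems Gs' by (intro Cons.hyps(1)) auto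
    have x: "x \<in> polys E" "x \<notin> P" using Cons.prems Gs' by auto
    have "x * prod_list xs \<in> polys E" "x * prod_list xs \<notin> P"
      using x xs polys_mult Pd(6) by blast+
    thus ?case using Gs' by simp
  qed
  moreover have "homogeneous (length Gs) ?m"
  proof (induction Gs)
    case (Cons Ge Gs)
    show ?case using homogeneous_mult[OF homogeneous_coord Cons] by simp
  qed (simp add: homogeneous_one)
  moreover have "frame_monom Gs = Fract ?m 1"
    unfolding frame_monom_def by (induction Gs) (simp_all add: cvar_def One_fract_def)
  hence "local_eq Gs = Fract (graph_poly ends E) ?m" by (simp add: local_eq_def)
  ultimately show ?thesis
    unfolding P(1) proj_max_ideal[OF P(2)] using P(3) graph_poly_homogeneous len
    by (intro CollectI exI[of _ "graph_poly ends E"] exI[of _ ?m] conjI exI[of _ "h1 ends E"]) simp_all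
qed

text \<open>
  Off the centre, the minimal element of a newly treated set can be chosen to be minimal in a larger
  set that had been treated before.  A frame of the new point thus yields one of the old point, whose
  local equation differs by a factor.
\<close>

lemma hypersurface_step:
  assumes S: "S \<in> space_at k" "S \<notin> centre k" and S': "S' \<in> space_at (Suc k)" and dom: "dominates S' S"
    and IH: "\<And>Gs. frame k S Gs \<Longrightarrow> local_eq Gs \<in> max_ideal S" and fr: "frame (Suc k) S' Gs"
  shows "local_eq Gs \<in> max_ideal S'"
proof -
  note inv = tower_inv[of k]
  note g = tower_invD(1)[OF tower_inv S']
  note sub = goodD(2)[OF g]
  have "\<forall>Ge\<in>set Gs. \<exists>Ge'. fst Ge' \<in> treated k \<and> fst Ge \<subseteq> fst Ge' \<and> ismin S (fst Ge') (snd Ge') \<and> snd Ge' \<in> fst Ge"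
  proof
    fix Ge assume "Ge \<in> set Gs"
    hence "fst Ge \<in> treated (Suc k)" using frameD(3)[OF fr, of "fst Ge" "snd Ge"] by simp
    from off_centre_min[OF inv S this]
    obtain F' e where "F' \<in> treated k" "fst Ge \<subseteq> F'" "e \<in> fst Ge" "ismin S F' e" .
    thus "\<exists>Ge'. fst Ge' \<in> treated k \<and> fst Ge \<subseteq> fst Ge' \<and> ismin S (fst Ge') (snd Ge') \<and> snd Ge' \<in> fst Ge"
      by (intro exI[of _ "(F', e)"]) simp
  qed
  then obtain f where f: "\<forall>Ge\<in>set Gs. fst (f Ge) \<in> treated k \<and> fst Ge \<subseteq> fst (f Ge) \<and>
     ismin S (fst (f Ge)) (snd (f Ge)) \<and> snd (f Ge) \<in> fst Ge"
    by (rule bchoice[THEN exE])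
  \<comment> \<open>Replacing the entries one by one may make chosen edges coincide. A frame asks
    only for the matching, which survives because the sets grow.\<close>
  have "frame k S (map f Gs)"
    unfolding frame_def
  proof
    show "\<forall>(G, e)\<in>set (map f Gs). G \<in> treated k \<and> ismin S G e"
    proof
      fix x assume "x \<in> set (map f Gs)"
      then obtain Ge where "x = f Ge" "Ge \<in> set Gs" by auto
      thus "case x of (G, e) \<Rightarrow> G \<in> treated k \<and> ismin S G e" using f by (simp add: case_prod_beta)
    qed
    show "matched (map f Gs)"
      unfolding matched_def
    proof (intro allI impI)
      fix T assume "spanning_tree ends E T"
      then obtain bs where bs: "set bs = E - T" "distinct bs" "list_all2 (\<lambda>b (G, e). b \<in> G) bs Gs"
        using frameD(1)[OF fr] unfolding matched_def by blast
      have "list_all2 (\<lambda>b (G, e). b \<in> G) bs (map f Gs)"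
      proof (rule list_all2_all_nthI)
        show "length bs = length (map f Gs)" using list_all2_lengthD[OF bs(3)] by simp
        fix i assume i: "i < length bs"
        hence "Gs ! i \<in> set Gs" "bs ! i \<in> fst (Gs ! i)"
          using bs(3) by (auto simp: list_all2_conv_all_nth case_prod_beta)
        thus "case map f Gs ! i of (G, e) \<Rightarrow> bs ! i \<in> G"
          using f i list_all2_lengthD[OF bs(3)] by (auto simp: case_prod_beta)
      qed
      thus "\<exists>bs. set bs = E - T \<and> distinct bs \<and> list_all2 (\<lambda>b (G, e). b \<in> G) bs (map f Gs)"
        using bs(1,2) by blast
    qed
  qed
  hence "local_eq (map f Gs) \<in> max_ideal S'"
    using IH dom by (auto simp: dominates_def)
  moreover have "frame_monom (map f Gs) / frame_monom Gs \<in> S'"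
  proof -
    \<comment> \<open>The replacement edge lies in the original set, so the edges of the frame below
      are themselves matched with the frame above.\<close>
    have "list_all2 (\<lambda>b (G, e). b \<in> G) (map (snd \<circ> f) Gs) Gs"
      using f by (auto simp: list_all2_conv_all_nth case_prod_beta)
    from frame_quotient[OF sub this frameD(2)[OF fr]]
    show ?thesis by (simp add: frame_monom_def comp_assoc)
  qed
  ultimately have "local_eq (map f Gs) * (frame_monom (map f Gs) / frame_monom Gs) \<in> max_ideal S'"
    by (rule max_ideal_mult(1)[OF sub])
  also have "local_eq (map f Gs) * (frame_monom (map f Gs) / frame_monom Gs) = local_eq Gs"
    unfolding local_eq_def by (rule chain_quotient[OF frame_monom_nonzero])
  finally show ?thesis .
qed

text \<open>If \<open>local_eq Gs\<close> were a unit at \<open>S\<close>, its inverse and the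
  finitely many ratios that define the frame would be regular at some point of
  \<open>W\<close>.\<close>

lemma closed_hypersurface:
  assumes V: "\<And>S. S \<in> V \<Longrightarrow> subring_on S" and W: "\<And>S. S \<in> W \<Longrightarrow> frame k S Gs \<Longrightarrow> local_eq Gs \<in> max_ideal S"
    and S: "S \<in> zariski V closure_of W" and fr: "frame k S Gs"
  shows "local_eq Gs \<in> max_ideal S"
proof (rule ccontr)
  assume h: "local_eq Gs \<notin> max_ideal S"
  have SV: "S \<in> V" using S topspace_zariski[OF V] by (auto simp: in_closure_of)
  have "local_eq Gs \<in> S" using local_eq_mem[OF V[OF SV]] frameD[OF fr] by blast
  hence q: "local_eq Gs \<noteq> 0" "inverse (local_eq Gs) \<in> S" using h max_ideal_iff by blast+
  let ?A = "insert (inverse (local_eq Gs)) (\<Union>(G, e)\<in>set Gs. (\<lambda>b. cvar b / cvar e) ` G)"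
  have fin: "finite ?A"
  proof (intro finite.insertI finite_UN_I ballI)
    fix Ge assume "Ge \<in> set Gs"
    hence "finite (fst Ge)" using frameD(3)[OF fr, of "fst Ge" "snd Ge"] treated_finite(1)[of "fst Ge" k] by simp
    thus "finite (case Ge of (G, e) \<Rightarrow> (\<lambda>b. cvar b / cvar e) ` G)" by (simp add: case_prod_beta)
  qed simp
  have sub: "?A \<subseteq> S" using q(2) frameD(3)[OF fr] ismin_in(2) by fastforce
  obtain S' where S': "S' \<in> W" "?A \<subseteq> S'"
    by (rule zariski_closure_witness[OF V S fin sub])
  have "frame k S' Gs"
    unfolding frame_def
  proof
    show "matched Gs" by (rule frameD(1)[OF fr])
    show "\<forall>(G, e)\<in>set Gs. G \<in> treated k \<and> ismin S' G e"
      using S'(2) frameD(3)[OF fr] ismin_in(1) by (fastforce simp: ismin_def)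
  qed
  hence "local_eq Gs \<in> max_ideal S'" by (rule W[OF S'(1)])
  thus False using q(1) S'(2) by (auto simp: max_ideal_def)
qed

theorem hypersurface:
  "S \<in> strict_at k (graph_hypersurface ends E) \<Longrightarrow>
    S \<in> space_at k \<and> (\<forall>Gs. frame k S Gs \<longrightarrow> local_eq Gs \<in> max_ideal S)"
proof (induction k arbitrary: S)
  case 0
  hence S: "S \<in> graph_hypersurface ends E" by (simp add: strict_at_0)
  hence "S \<in> proj_space E" by (auto simp: graph_hypersurface_def proj_zeros_def proj_space_def)
  thus ?case using hypersurface_0[OF S] by (simp add: space_at_0)
next
  case (Suc k)
  let ?X = "strict_at k (graph_hypersurface ends E)"
  let ?W = "{S' \<in> space_at (Suc k). \<exists>S\<in>?X - centre k. dominates S' S}"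
  have cl: "S \<in> zariski (space_at (Suc k)) closure_of ?W"
    using Suc.prems by (simp add: strict_at_Suc strict_transform_def space_at_Suc)
  have V: "S \<in> space_at (Suc k) \<Longrightarrow> subring_on S" for S by (rule tower_invD(2)[OF tower_inv])
  have "S \<in> topspace (zariski (space_at (Suc k)))" using cl by (simp add: in_closure_of)
  hence "S \<in> space_at (Suc k)" using topspace_zariski[OF V] by simp
  moreover have "local_eq Gs \<in> max_ideal S" if fr: "frame (Suc k) S Gs" for Gs
  proof (rule closed_hypersurface[OF V _ cl fr])
    fix S' assume S': "S' \<in> ?W" "frame (Suc k) S' Gs"
    then obtain S0 where S0: "S0 \<in> ?X" "S0 \<notin> centre k" "dominates S' S0" "S' \<in> space_at (Suc k)" by blast
    note IH = Suc.IH[OF S0(1)]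
    show "local_eq Gs \<in> max_ideal S'"
      by (rule hypersurface_step[OF conjunct1[OF IH] S0(2,4,3) conjunct2[OF IH, rule_format] S'(2)])
  qed
  ultimately show ?case by blast
qed

end

section \<open>Invariance under the torus\<close>

locale field_automorphism =
  fixes \<sigma> \<tau> :: "'k::field \<Rightarrow> 'k"
  assumes add: "\<sigma> (x + y) = \<sigma> x + \<sigma> y" and mult: "\<sigma> (x * y) = \<sigma> x * \<sigma> y"
    and left_inverse: "\<tau> (\<sigma> x) = x" and right_inverse: "\<sigma> (\<tau> x) = x"
begin

lemma zero: "\<sigma> 0 = 0"
proof -
  have "\<sigma> 0 + \<sigma> 0 = \<sigma> 0 + 0" using add[of 0 0] by simp
  thus ?thesis by (simp only: add_left_cancel)
qed

lemma one: "\<sigma> 1 = 1"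
  using mult[of 1 1] zero left_inverse[of 1] left_inverse[of 0] by auto

lemma eq_iff: "\<sigma> x = \<sigma> y \<longleftrightarrow> x = y" by (metis left_inverse)

lemma inverse: "\<sigma> (inverse x) = inverse (\<sigma> x)"
proof (cases "x = 0")
  case False
  hence "\<sigma> x * \<sigma> (inverse x) = 1" using mult[of x "inverse x"] one by simp
  thus ?thesis by (simp add: inverse_unique)
qed (simp add: zero)

lemma minus: "\<sigma> (- x) = - \<sigma> x"
  using add[of x "- x"] zero by (simp add: eq_neg_iff_add_eq_0 add.commute)

lemma diff: "\<sigma> (x - y) = \<sigma> x - \<sigma> y"
  using add[of x "- y"] minus[of y] by simp

lemma divide: "\<sigma> (x / y) = \<sigma> x / \<sigma> y"
  by (simp add: divide_inverse mult inverse)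

lemma mem_image: "x \<in> \<sigma> ` S \<longleftrightarrow> \<tau> x \<in> S"
  using left_inverse right_inverse by (metis image_iff)

lemma image_image_inverse: "\<sigma> ` \<tau> ` S = S" "\<tau> ` \<sigma> ` S = S"
  by (auto simp: image_image left_inverse right_inverse)

lemma inverse_automorphism: "field_automorphism \<tau> \<sigma>"
  by unfold_locales (metis left_inverse right_inverse add mult)+

lemma subring_on_image: "subring_on S \<Longrightarrow> subring_on (\<sigma> ` S)"
  unfolding subring_on_def
  by (auto simp flip: diff mult intro: rev_image_eqI[of 1] simp: one)

lemma max_ideal_image: "max_ideal (\<sigma> ` S) = \<sigma> ` max_ideal S"
  unfolding max_ideal_def using eq_iff[of _ 0] eq_iff
  by (auto simp: zero image_iff simp flip: inverse)

lemma generated_image_subset: "\<sigma> ` generated H \<subseteq> generated (\<sigma> ` H)"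
proof
  fix y assume "y \<in> \<sigma> ` generated H"
  then obtain x where x: "x \<in> generated H" "y = \<sigma> x" by blast
  note G = subring_onD[OF subring_on_generated[of "\<sigma> ` H"]]
  from x(1) have "\<sigma> x \<in> generated (\<sigma> ` H)"
    by (induction rule: generate_ring.induct) (auto simp: one minus add mult intro: G generated_incl)
  thus "y \<in> generated (\<sigma> ` H)" using x(2) by simp
qed

text \<open>The second inclusion is the first one for the inverse map; the locale carries
  \<open>\<tau>\<close> to make this possible.\<close>

lemma generated_image: "generated (\<sigma> ` H) = \<sigma> ` generated H"
proof
  show "\<sigma> ` generated H \<subseteq> generated (\<sigma> ` H)" by (rule generated_image_subset)
  have h: "\<tau> ` generated (\<sigma> ` H) \<subseteq> generated H"
    using field_automorphism.generated_image_subset[OF inverse_automorphism, of "\<sigma> ` H"]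
    by (simp only: image_image_inverse)
  show "generated (\<sigma> ` H) \<subseteq> \<sigma> ` generated H"
    using image_mono[OF h, of \<sigma>] by (simp only: image_image_inverse)
qed

lemma localization_image: "localization (\<sigma> ` R) (\<sigma> ` Q) = \<sigma> ` localization R Q"
proof -
  have d: "\<sigma> ` R - \<sigma> ` Q = \<sigma> ` (R - Q)" by (auto simp: eq_iff)
  show ?thesis
  proof (intro equalityI subsetI)
    fix x assume "x \<in> localization (\<sigma> ` R) (\<sigma> ` Q)"
    then obtain a b where "x = \<sigma> a / \<sigma> b" "a \<in> R" "b \<in> R - Q"
      unfolding localization_def d by blast
    thus "x \<in> \<sigma> ` localization R Q"
      unfolding localization_def divide[symmetric] by blast
  next
    fix x assume "x \<in> \<sigma> ` localization R Q"
    then obtain a b where "x = \<sigma> (a / b)" "a \<in> R" "b \<in> R - Q"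
      unfolding localization_def by blast
    thus "x \<in> localization (\<sigma> ` R) (\<sigma> ` Q)"
      unfolding localization_def d divide by blast
  qed
qed

lemma primeideal_image:
  assumes R: "subring_on R" and Q: "primeideal Q (ring_on R)"
  shows "primeideal (\<sigma> ` Q) (ring_on (\<sigma> ` R))"
proof (rule primeideal_ring_onI)
  note Qd = primeideal_ring_onD[OF Q] and Rd = subring_onD[OF subring_on_image[OF R]]
  show "1 \<in> \<sigma> ` R" by (rule Rd(1))
  show "x - y \<in> \<sigma> ` R \<and> x * y \<in> \<sigma> ` R" if "x \<in> \<sigma> ` R" "y \<in> \<sigma> ` R" for x y
    using Rd(5,6)[OF that] by blast
  show "\<sigma> ` Q \<subseteq> \<sigma> ` R" using Qd(1) by blast
  show "0 \<in> \<sigma> ` Q" using Qd(2) zero by (metis image_eqI)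
  show "x + y \<in> \<sigma> ` Q" if "x \<in> \<sigma> ` Q" "y \<in> \<sigma> ` Q" for x y
    using that Qd(3) by (auto simp flip: add)
  show "x * y \<in> \<sigma> ` Q" if "x \<in> \<sigma> ` R" "y \<in> \<sigma> ` Q" for x y
    using that Qd(4) by (auto simp flip: mult)
  show "1 \<notin> \<sigma> ` Q" using Qd(6) subring_onD(1)[OF R] one eq_iff by (metis image_iff)
  show "x \<in> \<sigma> ` Q \<or> y \<in> \<sigma> ` Q" if xy: "x \<in> \<sigma> ` R" "y \<in> \<sigma> ` R" "x * y \<in> \<sigma> ` Q" for x y
  proof -
    obtain a b where ab: "x = \<sigma> a" "y = \<sigma> b" "a \<in> R" "b \<in> R" using xy by blast
    have "a * b \<in> Q" using xy(3) unfolding ab(1,2) mult[symmetric] by (auto simp: eq_iff)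
    thus ?thesis using Qd(5)[OF ab(3,4)] ab(1,2) by blast
  qed
qed

end

locale model_automorphism = field_automorphism +
  fixes V :: "'a::field model"
  assumes V: "S \<in> V \<Longrightarrow> \<sigma> ` S \<in> V" "S \<in> V \<Longrightarrow> \<tau> ` S \<in> V"
begin

lemma inverse_model_automorphism: "model_automorphism \<tau> \<sigma> V"
  using inverse_automorphism V by (simp add: model_automorphism_def model_automorphism_axioms_def)

lemma openin_zariski_image:
  assumes "openin (zariski V) U" shows "openin (zariski V) ((`) \<sigma> ` U)"
proof -
  have "generate_topology_on {{S \<in> V. f \<in> S} | f. True} U"
    using assms by (simp add: zariski_def openin_topology_generated_by_iff)
  thus ?thesis
  proof (induction rule: generate_topology_on.induct)
    case Empty
    show ?case by simp
  next
    case (Int U W)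
    have "(`) \<sigma> ` (U \<inter> W) = (`) \<sigma> ` U \<inter> (`) \<sigma> ` W"
      by (rule image_Int) (metis image_image_inverse(2) injI)
    thus ?case using Int.IH by (simp add: openin_Int)
  next
    case (UN K)
    have "(`) \<sigma> ` \<Union> K = (\<Union>k\<in>K. (`) \<sigma> ` k)" by blast
    thus ?case using UN.IH by auto
  next
    case (Basis B)
    then obtain f where f: "B = {S \<in> V. f \<in> S}" by blast
    have "(`) \<sigma> ` B = {S \<in> V. \<sigma> f \<in> S}"
    proof
      show "(`) \<sigma> ` B \<subseteq> {S \<in> V. \<sigma> f \<in> S}" unfolding f using V(1) by auto
      show "{S \<in> V. \<sigma> f \<in> S} \<subseteq> (`) \<sigma> ` B"
      proof
        fix S assume S: "S \<in> {S \<in> V. \<sigma> f \<in> S}"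
        hence "\<tau> ` S \<in> B" unfolding f using V(2) left_inverse[of f] by (auto intro: rev_image_eqI)
        thus "S \<in> (`) \<sigma> ` B" using image_image_inverse(1)[of S] by (metis image_eqI)
      qed
    qed
    thus ?case using openin_zariski_basic by metis
  qed
qed

lemma ideal_stalk_image_subset:
  assumes Z: "\<And>S. S \<in> V \<Longrightarrow> \<sigma> ` S \<in> Z \<Longrightarrow> S \<in> Z"
  shows "\<sigma> ` ideal_stalk V Z S \<subseteq> ideal_stalk V Z (\<sigma> ` S)"
proof
  fix y assume "y \<in> \<sigma> ` ideal_stalk V Z S"
  then obtain f U where f: "y = \<sigma> f" "f \<in> S" "openin (zariski V) U" "S \<in> U"
    "\<forall>S'\<in>U. f \<in> S'" "\<forall>S'\<in>U \<inter> Z. f \<in> max_ideal S'" unfolding ideal_stalk_def by blast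
  have "\<forall>S'\<in>(`) \<sigma> ` U \<inter> Z. y \<in> max_ideal S'"
  proof
    fix S' assume "S' \<in> (`) \<sigma> ` U \<inter> Z"
    then obtain S0 where S0: "S' = \<sigma> ` S0" "S0 \<in> U" "\<sigma> ` S0 \<in> Z" by blast
    have "S0 \<in> V" using openin_zariski_subset[OF f(3)] S0(2) by blast
    hence "f \<in> max_ideal S0" using Z S0 f(6) by blast
    thus "y \<in> max_ideal S'" unfolding S0(1) max_ideal_image f(1) by blast
  qed
  moreover have "\<forall>S'\<in>(`) \<sigma> ` U. y \<in> S'" using f(1,5) by blast
  moreover have "y \<in> \<sigma> ` S" "\<sigma> ` S \<in> (`) \<sigma> ` U" using f by blast+
  ultimately show "y \<in> ideal_stalk V Z (\<sigma> ` S)"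
    unfolding ideal_stalk_def mem_Collect_eq using openin_zariski_image[OF f(3)] by blast
qed

lemma ideal_stalk_image:
  assumes Z: "\<And>S. S \<in> V \<Longrightarrow> \<sigma> ` S \<in> Z \<Longrightarrow> S \<in> Z" "\<And>S. S \<in> V \<Longrightarrow> \<tau> ` S \<in> Z \<Longrightarrow> S \<in> Z"
  shows "ideal_stalk V Z (\<sigma> ` S) = \<sigma> ` ideal_stalk V Z S"
proof
  show "\<sigma> ` ideal_stalk V Z S \<subseteq> ideal_stalk V Z (\<sigma> ` S)" by (rule ideal_stalk_image_subset[OF Z(1)])
  have "\<tau> ` ideal_stalk V Z (\<sigma> ` S) \<subseteq> ideal_stalk V Z (\<tau> ` \<sigma> ` S)"
    by (rule model_automorphism.ideal_stalk_image_subset[OF inverse_model_automorphism Z(2)])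
  hence h: "\<tau> ` ideal_stalk V Z (\<sigma> ` S) \<subseteq> ideal_stalk V Z S" by (simp only: image_image_inverse)
  show "ideal_stalk V Z (\<sigma> ` S) \<subseteq> \<sigma> ` ideal_stalk V Z S"
    using image_mono[OF h, of \<sigma>] by (simp only: image_image_inverse)
qed

text \<open>The data \<open>S\<close>, \<open>x\<close>, \<open>R\<close>, \<open>Q\<close> of a
  point of the blow-up are built by field operations and the topology, so the automorphism carries
  them to data for the image.\<close>

lemma blowup_image:
  assumes Z: "\<And>S. S \<in> V \<Longrightarrow> \<sigma> ` S \<in> Z \<Longrightarrow> S \<in> Z" "\<And>S. S \<in> V \<Longrightarrow> \<tau> ` S \<in> Z \<Longrightarrow> S \<in> Z"
    and V': "\<And>S. S \<in> V \<Longrightarrow> subring_on S" and S': "S' \<in> blowup V Z"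
  shows "\<sigma> ` S' \<in> blowup V Z"
proof (rule blowupE[OF S' V'])
  fix S R Q x
  assume *: "S \<in> V" "x \<in> ideal_stalk V Z S" "x \<noteq> 0"
    "R = generated (S \<union> {y / x | y. y \<in> ideal_stalk V Z S})" "S' = localization R Q"
    "primeideal Q (ring_on R)" "subring_on R"
  have st: "ideal_stalk V Z (\<sigma> ` S) = \<sigma> ` ideal_stalk V Z S" by (rule ideal_stalk_image[OF Z])
  have im: "\<sigma> ` (S \<union> {y / x | y. y \<in> ideal_stalk V Z S}) = \<sigma> ` S \<union> {y / \<sigma> x | y. y \<in> \<sigma> ` ideal_stalk V Z S}"
  proof -
    have "\<sigma> ` {y / x | y. y \<in> ideal_stalk V Z S} = {y / \<sigma> x | y. y \<in> \<sigma> ` ideal_stalk V Z S}"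
      unfolding setcompr_eq_image image_image divide by (simp add: setcompr_eq_image image_image)
    thus ?thesis by (simp only: image_Un)
  qed
  have R: "\<sigma> ` R = generated (\<sigma> ` S \<union> {y / \<sigma> x | y. y \<in> ideal_stalk V Z (\<sigma> ` S)})"
    unfolding st *(4) generated_image[symmetric] im ..
  have x: "\<sigma> x \<in> ideal_stalk V Z (\<sigma> ` S) - {0}" using *(2,3) eq_iff[of x 0] by (auto simp: st zero)
  show "\<sigma> ` S' \<in> blowup V Z"
    unfolding blowup_def mem_Collect_eq *(5) localization_image[symmetric]
    by (intro exI[of _ "\<sigma> ` R"] exI[of _ "\<sigma> ` Q"] conjI bexI[OF _ V(1)[OF *(1)]] bexI[OF _ x] refl R
        primeideal_image[OF *(7,6)])
qed

end

section \<open>The torus action on rational functions\<close>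

definition torus_map :: "('e::linorder \<Rightarrow> rat) \<Rightarrow> 'e ratfun \<Rightarrow> 'e ratfun" where
  "torus_map t x = (THE y. \<exists>f g. g \<noteq> 0 \<and> x = Fract f g \<and> y = Fract (scale_poly t f) (scale_poly t g))"

lemma scale_poly_inverse:
  assumes "\<forall>e. t e \<noteq> 0"
  shows "scale_poly (\<lambda>e. inverse (t e)) (scale_poly t p) = p" "scale_poly t (scale_poly (\<lambda>e. inverse (t e)) p) = p"
  using assms by (simp_all add: scale_poly_scale scale_poly_id)

lemma scale_poly_eq_0_iff: "\<forall>e. t e \<noteq> 0 \<Longrightarrow> scale_poly t p = 0 \<longleftrightarrow> p = 0"
  using scale_poly_inverse(1)[of t p] by auto

text \<open>Independence of the representative: scaling is multiplicative, so it respects cross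
  multiplication, and nonzero scalars keep denominators nonzero.\<close>

lemma torus_map_Fract:
  assumes t: "\<forall>e. t e \<noteq> 0" and g: "g \<noteq> 0"
  shows "torus_map t (Fract f g) = Fract (scale_poly t f) (scale_poly t g)"
  unfolding torus_map_def
proof (rule the_equality)
  show "\<exists>f' g'. g' \<noteq> 0 \<and> Fract f g = Fract f' g' \<and>
      Fract (scale_poly t f) (scale_poly t g) = Fract (scale_poly t f') (scale_poly t g')"
    using g by blast
  fix y assume "\<exists>f' g'. g' \<noteq> 0 \<and> Fract f g = Fract f' g' \<and> y = Fract (scale_poly t f') (scale_poly t g')"
  then obtain f' g' where *: "g' \<noteq> 0" "Fract f g = Fract f' g'" "y = Fract (scale_poly t f') (scale_poly t g')"
    by blast
  have "f * g' = f' * g" using *(1,2) g by (simp add: eq_fract)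
  hence "scale_poly t f * scale_poly t g' = scale_poly t f' * scale_poly t g"
    by (metis scale_poly_mult)
  thus "y = Fract (scale_poly t f) (scale_poly t g)"
    unfolding *(3) using g *(1) by (simp add: eq_fract scale_poly_eq_0_iff[OF t])
qed

lemma torus_act_eq:
  assumes t: "\<forall>e. t e \<noteq> 0"
  shows "torus_act t S = torus_map t ` S"
proof
  show "torus_act t S \<subseteq> torus_map t ` S"
  proof
    fix y assume "y \<in> torus_act t S"
    then obtain f g where "y = Fract (scale_poly t f) (scale_poly t g)" "g \<noteq> 0" "Fract f g \<in> S"
      unfolding torus_act_def by blast
    thus "y \<in> torus_map t ` S" using torus_map_Fract[OF t, of g f] by (metis image_eqI)
  qed
  show "torus_map t ` S \<subseteq> torus_act t S"
  proof
    fix y assume "y \<in> torus_map t ` S"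
    then obtain x where x: "x \<in> S" "y = torus_map t x" by blast
    obtain f g where "x = Fract f g" "g \<noteq> 0" by (cases x) auto
    moreover have "y = Fract (scale_poly t f) (scale_poly t g)"
      unfolding x(2) using calculation by (simp add: torus_map_Fract[OF t])
    ultimately show "y \<in> torus_act t S" unfolding torus_act_def using x(1) by blast
  qed
qed

lemma torus_map_inverse:
  assumes t: "\<forall>e. t e \<noteq> 0"
  shows "torus_map (\<lambda>e. inverse (t e)) (torus_map t x) = x"
proof -
  obtain f g where fg: "x = Fract f g" "g \<noteq> 0" by (cases x) auto
  have "\<forall>e. inverse (t e) \<noteq> 0" using t by simp
  thus ?thesis unfolding fg(1) using fg(2)
    by (simp add: torus_map_Fract[OF t] torus_map_Fract scale_poly_eq_0_iff[OF t] scale_poly_inverse[OF t])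
qed

lemma torus_map_automorphism:
  assumes t: "\<forall>e. t e \<noteq> 0"
  shows "field_automorphism (torus_map t) (torus_map (\<lambda>e. inverse (t e)))"
proof
  fix x y :: "'a ratfun"
  obtain f g where fg: "x = Fract f g" "g \<noteq> 0" by (cases x) auto
  obtain f' g' where fg': "y = Fract f' g'" "g' \<noteq> 0" by (cases y) auto
  show "torus_map t (x + y) = torus_map t x + torus_map t y"
    unfolding fg(1) fg'(1) using fg(2) fg'(2)
    by (simp add: torus_map_Fract[OF t] scale_poly_eq_0_iff[OF t] scale_poly_mult scale_poly_add)
  show "torus_map t (x * y) = torus_map t x * torus_map t y"
    unfolding fg(1) fg'(1) using fg(2) fg'(2)
    by (simp add: torus_map_Fract[OF t] scale_poly_mult)
  show "torus_map (\<lambda>e. inverse (t e)) (torus_map t x) = x" by (rule torus_map_inverse[OF t])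
  have t': "\<forall>e. inverse (t e) \<noteq> 0" using t by simp
  show "torus_map t (torus_map (\<lambda>e. inverse (t e)) x) = x"
    using torus_map_inverse[OF t', of x] by simp
qed

lemma torus_map_cvar:
  assumes t: "\<forall>e. t e \<noteq> 0"
  shows "torus_map t (cvar e) = Fract (Poly_Mapping.single 0 (t e)) 1 * cvar e"
proof -
  have "scale_poly t 1 = 1" by (rule poly_mapping_eqI) (simp add: lookup_scale_poly lookup_one when_def monom_value_def)
  thus ?thesis unfolding cvar_def by (simp add: torus_map_Fract[OF t] scale_poly_coord)
qed

lemma inverse_constant:
  assumes "c \<noteq> 0"
  shows "inverse (Fract (Poly_Mapping.single 0 c) 1) = (Fract (Poly_Mapping.single 0 (inverse c)) 1 :: 'e::linorder ratfun)"
proof -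
  have "Poly_Mapping.single 0 c * Poly_Mapping.single 0 (inverse c) = (1 :: 'e mpoly)"
    using assms by (simp add: mult_single)
  hence "Fract (Poly_Mapping.single 0 c) 1 * Fract (Poly_Mapping.single 0 (inverse c)) 1 = (1 :: 'e ratfun)"
    by (simp add: One_fract_def)
  thus ?thesis by (rule inverse_unique)
qed

text \<open>The eigenfunctions of the torus, among them all Laurent monomials.\<close>

definition semi_invariant :: "'e::linorder ratfun \<Rightarrow> bool" where
  "semi_invariant m \<longleftrightarrow> (\<forall>t. (\<forall>e. t e \<noteq> 0) \<longrightarrow>
     (\<exists>c. c \<noteq> 0 \<and> torus_map t m = Fract (Poly_Mapping.single 0 c) 1 * m))"

lemma semi_invariant_cvar: "semi_invariant (cvar e)"
  unfolding semi_invariant_def using torus_map_cvar by blast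

lemma semi_invariant_one: "semi_invariant 1"
  unfolding semi_invariant_def
proof (intro allI impI exI[of _ 1] conjI)
  fix t :: "'a \<Rightarrow> rat" assume "\<forall>e. t e \<noteq> 0"
  then interpret field_automorphism "torus_map t" "torus_map (\<lambda>e. inverse (t e))" by (rule torus_map_automorphism)
  show "torus_map t 1 = Fract (Poly_Mapping.single 0 1) 1 * 1" using one by (simp add: One_fract_def)
qed simp

lemma semi_invariant_mult:
  assumes "semi_invariant m" "semi_invariant m'" shows "semi_invariant (m * m')"
  unfolding semi_invariant_def
proof (intro allI impI)
  fix t :: "'a \<Rightarrow> rat" assume t: "\<forall>e. t e \<noteq> 0"
  then interpret field_automorphism "torus_map t" "torus_map (\<lambda>e. inverse (t e))" by (rule torus_map_automorphism)
  obtain c c' where c: "c \<noteq> 0" "torus_map t m = Fract (Poly_Mapping.single 0 c) 1 * m"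
    "c' \<noteq> 0" "torus_map t m' = Fract (Poly_Mapping.single 0 c') 1 * m'"
    using assms t unfolding semi_invariant_def by blast
  have h: "Fract (Poly_Mapping.single 0 c) 1 * Fract (Poly_Mapping.single 0 c') 1 =
      (Fract (Poly_Mapping.single 0 (c * c')) 1 :: 'a ratfun)"
    by (simp add: mult_single)
  have "torus_map t (m * m') = Fract (Poly_Mapping.single 0 (c * c')) 1 * (m * m')"
    unfolding mult c(2,4) h[symmetric] by (simp only: mult_ac)
  thus "\<exists>c. c \<noteq> 0 \<and> torus_map t (m * m') = Fract (Poly_Mapping.single 0 c) 1 * (m * m')"
    using c(1,3) by (intro exI[of _ "c * c'"]) simp
qed

lemma semi_invariant_inverse:
  assumes "semi_invariant m" shows "semi_invariant (inverse m)"
  unfolding semi_invariant_def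
proof (intro allI impI)
  fix t :: "'a \<Rightarrow> rat" assume t: "\<forall>e. t e \<noteq> 0"
  then interpret field_automorphism "torus_map t" "torus_map (\<lambda>e. inverse (t e))" by (rule torus_map_automorphism)
  obtain c where c: "c \<noteq> 0" "torus_map t m = Fract (Poly_Mapping.single 0 c) 1 * m"
    using assms t unfolding semi_invariant_def by blast
  have "torus_map t (inverse m) = Fract (Poly_Mapping.single 0 (inverse c)) 1 * inverse m"
    unfolding inverse c(2) inverse_mult_distrib inverse_constant[OF c(1)] ..
  thus "\<exists>c. c \<noteq> 0 \<and> torus_map t (inverse m) = Fract (Poly_Mapping.single 0 c) 1 * inverse m"
    using c(1) by (intro exI[of _ "inverse c"]) simp
qed

lemma semi_invariant_prod: "(\<And>i. i \<in> A \<Longrightarrow> semi_invariant (f i)) \<Longrightarrow> semi_invariant (prod f A)"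
  by (induction A rule: infinite_finite_induct) (auto intro: semi_invariant_mult semi_invariant_one)

lemma semi_invariant_power: "semi_invariant x \<Longrightarrow> semi_invariant (x ^ n)"
  by (induction n) (auto intro: semi_invariant_mult semi_invariant_one)

lemma semi_invariant_powi: "semi_invariant x \<Longrightarrow> semi_invariant (x powi n)"
  unfolding power_int_def using semi_invariant_power semi_invariant_inverse by auto

text \<open>The torus multiplies \<open>m\<close> by a nonzero constant, and such constants are
  units of \<open>S\<close>.\<close>

lemma semi_invariant_mem:
  assumes t: "\<forall>e. t e \<noteq> 0" and S: "subring_on S" "constants \<subseteq> S" and m: "semi_invariant m"
  shows "m \<in> torus_map t ` S \<longleftrightarrow> m \<in> S"
proof -
  interpret field_automorphism "torus_map t" "torus_map (\<lambda>e. inverse (t e))"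
    using t by (rule torus_map_automorphism)
  have u: "\<forall>e. inverse (t e) \<noteq> 0" using t by simp
  obtain c where c: "c \<noteq> 0" "torus_map (\<lambda>e. inverse (t e)) m = Fract (Poly_Mapping.single 0 c) 1 * m"
    using m[unfolded semi_invariant_def, THEN spec, THEN mp, OF u] by blast
  have C: "Fract (Poly_Mapping.single 0 d) 1 \<in> S" for d using S(2) by (auto simp: constants_def)
  have "Fract (Poly_Mapping.single 0 c) 1 * m \<in> S \<longleftrightarrow> m \<in> S"
  proof
    assume "Fract (Poly_Mapping.single 0 c) 1 * m \<in> S"
    from subring_onD(6)[OF S(1) C[of "inverse c"] this]
    have "inverse (Fract (Poly_Mapping.single 0 c) 1) * (Fract (Poly_Mapping.single 0 c) 1 * m) \<in> S"
      unfolding inverse_constant[OF c(1)] .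
    moreover have "Fract (Poly_Mapping.single 0 c) 1 \<noteq> (0 :: 'a ratfun)"
      using c(1) by (simp add: to_fract_eq_0_iff) (metis lookup_single_eq lookup_zero)
    ultimately show "m \<in> S" by (simp add: mult.assoc[symmetric] del: mult_fract inverse_fract)
  qed (rule subring_onD(6)[OF S(1) C])
  thus ?thesis unfolding mem_image c(2) .
qed

lemma keys_scale_poly: "\<forall>e. t e \<noteq> 0 \<Longrightarrow> Poly_Mapping.keys (scale_poly t p) = Poly_Mapping.keys p"
  by (auto simp: in_keys_iff lookup_scale_poly monom_value_def)

lemma scale_poly_polys: "\<forall>e. t e \<noteq> 0 \<Longrightarrow> scale_poly t p \<in> polys E \<longleftrightarrow> p \<in> polys E"
  by (simp add: polys_def keys_scale_poly)

lemma scale_poly_homogeneous: "\<forall>e. t e \<noteq> 0 \<Longrightarrow> homogeneous d (scale_poly t p) \<longleftrightarrow> homogeneous d p"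
  by (simp add: homogeneous_def keys_scale_poly)

lemma scale_poly_one: "scale_poly t 1 = 1"
  by (rule poly_mapping_eqI) (simp add: lookup_scale_poly lookup_one when_def monom_value_def)

lemma scale_poly_hom_component:
  assumes t: "\<forall>e. t e \<noteq> 0"
  shows "scale_poly t (hom_component d p) = hom_component d (scale_poly t p)"
  unfolding hom_component_def scale_poly_sum keys_scale_poly[OF t] scale_poly_single lookup_scale_poly ..

lemma proj_primes_scale:
  assumes t: "\<forall>e. t e \<noteq> 0" and P: "P \<in> proj_primes E"
  shows "{p \<in> polys E. scale_poly t p \<in> P} \<in> proj_primes E" (is "?P \<in> _")
proof -
  note Pd = proj_prime[OF P]
  have "primeideal ?P (ring_on (polys E))"
  proof (rule primeideal_ring_onI)
    show "1 \<in> polys E" by (rule polys_ring(1))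
    show "x - y \<in> polys E \<and> x * y \<in> polys E" if "x \<in> polys E" "y \<in> polys E" for x y
      using that by (rule polys_ring(2))
    show "?P \<subseteq> polys E" by blast
    show "0 \<in> ?P" using Pd(2) polys_zero by simp
    show "1 \<notin> ?P" using Pd(3) by (simp add: scale_poly_one)
    show "x + y \<in> ?P" if "x \<in> ?P" "y \<in> ?P" for x y
      using that Pd(4) polys_add[of x E y] by (simp add: scale_poly_add)
    show "x * y \<in> ?P" if "x \<in> polys E" "y \<in> ?P" for x y
      using that Pd(5) polys_mult[of x E y] scale_poly_polys[OF t] by (simp add: scale_poly_mult)
    show "x \<in> ?P \<or> y \<in> ?P" if "x \<in> polys E" "y \<in> polys E" "x * y \<in> ?P" for x y
      using that Pd(6)[of "scale_poly t x" "scale_poly t y"] scale_poly_polys[OF t] by (simp add: scale_poly_mult)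
  qed
  moreover have "hom_component d p \<in> ?P" if p: "p \<in> ?P" for p d
  proof -
    have "scale_poly t (hom_component d p) \<in> P"
      using p P unfolding scale_poly_hom_component[OF t] proj_primes_def by blast
    moreover from this have "hom_component d p \<in> polys E"
      using Pd(1) scale_poly_polys[OF t] by blast
    ultimately show ?thesis by simp
  qed
  moreover have "\<not> coord ` E \<subseteq> ?P"
  proof
    assume h: "coord ` E \<subseteq> ?P"
    obtain e where e: "e \<in> E" "coord e \<notin> P" using Pd(7) by blast
    hence "Poly_Mapping.single 0 (t e) * coord e \<in> P" using h by (auto simp: scale_poly_coord)
    moreover have "Poly_Mapping.single 0 (inverse (t e)) \<in> polys E" by (auto simp: polys_def split: if_splits)
    ultimately have "Poly_Mapping.single 0 (inverse (t e)) * (Poly_Mapping.single 0 (t e) * coord e) \<in> P"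
      using Pd(5) by blast
    moreover have "Poly_Mapping.single 0 (inverse (t e)) * (Poly_Mapping.single 0 (t e) * coord e) = coord e"
      using t by (simp add: mult.assoc[symmetric] mult_single)
    ultimately show False using e(2) by simp
  qed
  ultimately show ?thesis unfolding proj_primes_def by blast
qed

lemma proj_space_torus:
  assumes t: "\<forall>e. t e \<noteq> 0" and S: "S \<in> proj_space E"
  shows "torus_map t ` S \<in> proj_space E"
proof -
  let ?u = "\<lambda>e. inverse (t e)"
  have u: "\<forall>e. ?u e \<noteq> 0" using t by simp
  obtain P where P: "S = proj_local_ring E P" "P \<in> proj_primes E" using S by (auto simp: proj_space_def)
  \<comment> \<open>The image point is the preimage of \<open>P\<close> under the inverse
    scaling.\<close>
  let ?P = "{p \<in> polys E. scale_poly ?u p \<in> P}"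
  have g0: "g \<noteq> 0" if "g \<notin> P" for g using that proj_prime(2)[OF P(2)] by blast
  have "torus_map t ` S = proj_local_ring E ?P"
  proof (intro equalityI subsetI)
    fix x assume "x \<in> torus_map t ` S"
    then obtain f g d where *: "x = torus_map t (Fract f g)" "f \<in> polys E" "g \<in> polys E" "g \<notin> P"
      "homogeneous d f" "homogeneous d g" unfolding P(1) proj_local_ring_def by blast
    have "x = Fract (scale_poly t f) (scale_poly t g)" using * torus_map_Fract[OF t] g0 by simp
    thus "x \<in> proj_local_ring E ?P"
      using * by (auto intro!: proj_local_ringI
          simp: scale_poly_polys[OF t] scale_poly_homogeneous[OF t] scale_poly_inverse[OF t])
  next
    fix x assume "x \<in> proj_local_ring E ?P"
    then obtain f g d where *: "x = Fract f g" "f \<in> polys E" "g \<in> polys E" "g \<notin> ?P"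
      "homogeneous d f" "homogeneous d g" unfolding proj_local_ring_def by blast
    have g: "scale_poly ?u g \<notin> P" using *(3,4) by simp
    have "Fract (scale_poly ?u f) (scale_poly ?u g) \<in> S" unfolding P(1)
      using *(2,3,5,6) g scale_poly_polys[OF u] scale_poly_homogeneous[OF u]
      by (intro proj_local_ringI[where d = d]) simp_all
    moreover have "x = torus_map t (Fract (scale_poly ?u f) (scale_poly ?u g))"
      unfolding *(1) torus_map_Fract[OF t g0[OF g]] scale_poly_inverse(2)[OF t] ..
    ultimately show "x \<in> torus_map t ` S" by blast
  qed
  thus ?thesis using proj_primes_scale[OF u P(2)] unfolding proj_space_def by blast
qed

section \<open>Orbits in the iterated blow-up and positivity\<close>

context core_graph
begin

lemma ismin_torus:
  assumes "\<forall>e. t e \<noteq> 0" "subring_on S" "constants \<subseteq> S"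
  shows "ismin (torus_map t ` S) F e \<longleftrightarrow> ismin S F e"
proof -
  have "semi_invariant (cvar b / cvar e)" for b
    unfolding divide_inverse by (intro semi_invariant_mult semi_invariant_inverse semi_invariant_cvar)
  thus ?thesis unfolding ismin_def using semi_invariant_mem[OF assms] by blast
qed

text \<open>By \<open>centre_eq\<close> the centre is cut out by conditions on characters, so it is
  invariant and the action lifts to the blow-up.\<close>

lemma space_torus:
  assumes "\<forall>e. t e \<noteq> 0" "S \<in> space_at k"
  shows "torus_map t ` S \<in> space_at k"
  using assms
proof (induction k arbitrary: t S)
  case 0
  thus ?case by (simp add: space_at_0 proj_space_torus)
next
  case (Suc k)
  let ?u = "\<lambda>e. inverse (t e)"
  have u: "\<forall>e. ?u e \<noteq> 0" using Suc.prems(1) by simp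
  interpret field_automorphism "torus_map t" "torus_map ?u"
    using Suc.prems(1) by (rule torus_map_automorphism)
  interpret model_automorphism "torus_map t" "torus_map ?u" "space_at k"
  proof
    fix S assume "S \<in> space_at k"
    thus "torus_map t ` S \<in> space_at k" "torus_map ?u ` S \<in> space_at k"
      using Suc.IH[OF Suc.prems(1)] Suc.IH[OF u] by simp_all
  qed
  have Z: "S \<in> centre k" if "\<forall>e. t e \<noteq> 0" "S \<in> space_at k" "torus_map t ` S \<in> centre k" for t S
  proof -
    note g = tower_invD(1)[OF tower_inv that(2)]
    have "unsep k (torus_map t ` S) F \<longleftrightarrow> unsep k S F" for F
      unfolding unsep_def ismin_torus[OF that(1) goodD(2,3)[OF g]] ..
    thus ?thesis using that(2,3) centre_eq[OF tower_inv, of k] by blast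
  qed
  show ?case
    unfolding space_at_Suc
    by (rule blowup_image[OF Z[OF Suc.prems(1)] Z[OF u] tower_invD(2)[OF tower_inv]
          Suc.prems(2)[unfolded space_at_Suc]])
qed

text \<open>The locus where \<open>m\<close> is a unit is open and invariant, so it contains all of
  an orbit or none of it.\<close>

lemma unit_orbit:
  assumes S: "S \<in> torus_orbit (space_at k) S0" "S' \<in> torus_orbit (space_at k) S0"
    and m: "semi_invariant m" "m \<in> S" "inverse m \<in> S"
  shows "m \<in> S' \<and> inverse m \<in> S'"
proof -
  let ?U = "{S \<in> space_at k. m \<in> S} \<inter> {S \<in> space_at k. inverse m \<in> S}"
  have U: "openin (zariski (space_at k)) ?U" by (intro openin_Int openin_zariski_basic)
  have inv: "torus_invariant ?U"
    unfolding torus_invariant_def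
  proof (intro allI impI ballI)
    fix t :: "'e \<Rightarrow> rat" and S assume t: "\<forall>e. t e \<noteq> 0" and SU: "S \<in> ?U"
    hence SV: "S \<in> space_at k" by blast
    note g = tower_invD(1)[OF tower_inv SV]
    show "torus_act t S \<in> ?U"
      unfolding torus_act_eq[OF t]
      using SU space_torus[OF t SV] semi_invariant_mem[OF t goodD(2,3)[OF g]]
        m(1) semi_invariant_inverse[OF m(1)] by blast
  qed
  have "S \<in> space_at k" using S(1) by (simp add: torus_orbit_def)
  hence SU: "S \<in> ?U" using m by blast
  have "S0 \<in> ?U \<longleftrightarrow> S \<in> ?U" using S(1) U inv unfolding torus_orbit_def mem_Collect_eq by blast
  moreover have "S0 \<in> ?U \<longleftrightarrow> S' \<in> ?U" using S(2) U inv unfolding torus_orbit_def mem_Collect_eq by blast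
  ultimately show ?thesis using SU by blast
qed

lemma character_semi_invariant: "m \<in> characters E \<Longrightarrow> semi_invariant m"
  unfolding characters_def cvar_def[symmetric]
  by (auto intro!: semi_invariant_prod semi_invariant_powi semi_invariant_cvar)

text \<open>A nonempty finite family has minimal members, so every stage removes something; hence
  the least number defining \<open>num_stages\<close> exists.\<close>

lemma remaining_empty: "remaining ends E (num_stages ends E) = {}"
proof -
  have fin: "finite (remaining ends E k)" for k
    by (rule finite_subset[OF remaining_subset finite_imageI], rule finite_subset[of _ "Pow E"])
      (use finite_E in \<open>auto simp: proper_def\<close>)
  have "remaining ends E k = {} \<or> card (remaining ends E k) + k \<le> card (remaining ends E 0)" for k
  proof (induction k)
    case (Suc k)
    show ?case
    proof (cases "remaining ends E k = {}")
      case False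
      then obtain L where L: "L \<in> remaining ends E k" "\<forall>L'\<in>remaining ends E k. L' \<le> L \<longrightarrow> L = L'"
        using finite_has_minimal[OF fin] by blast
      hence "L \<in> minimal_sets (remaining ends E k)" unfolding minimal_sets_def by blast
      hence "remaining ends E (Suc k) \<subset> remaining ends E k" using L(1) by auto
      hence "card (remaining ends E (Suc k)) < card (remaining ends E k)" by (rule psubset_card_mono[OF fin])
      thus ?thesis using Suc False by auto
    qed auto
  qed auto
  from this[of "Suc (card (remaining ends E 0))"] have "\<exists>k. remaining ends E k = {}"
    by (intro exI[of _ "Suc (card (remaining ends E 0))"]) (simp del: remaining.simps)
  thus ?thesis unfolding num_stages_def by (rule LeastI_ex)
qed

lemma treated_final:
  assumes "core ends F" "F \<subseteq> E" "F \<noteq> {}"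
  shows "F \<in> treated (num_stages ends E)"
  using assms by (auto simp: treated_def proper_def remaining_empty)

text \<open>\<open>greedy_cobasis\<close> with \<open>ismin S\<close> as its notion of minimality:
  after the last stage every nonempty core subgraph has a minimal edge.\<close>

lemma frame_exists:
  assumes S: "S \<in> space_at (num_stages ends E)"
  obtains Gs T where "frame (num_stages ends E) S Gs" "spanning_tree ends E T"
    "frame_monom Gs = (\<Prod>e\<in>E - T. cvar e)"
proof -
  note g = tower_invD(1)[OF tower_inv S]
  have "\<exists>e\<in>G. ismin S G e" if "G \<subseteq> E" "core ends G" "G \<noteq> {}" for G
    using goodD(4)[OF g treated_final[OF that(2,1,3)]] ismin_in(1) by blast
  from greedy_cobasis[OF finite_E core_E this]
  obtain Gs where Gs: "length Gs = h1 ends E"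
    "\<forall>(G, e)\<in>set Gs. core ends G \<and> G \<subseteq> E \<and> e \<in> G \<and> ismin S G e"
    "distinct (map snd Gs)" "h1 ends (E - set (map snd Gs)) = 0"
    "\<forall>B\<subseteq>E. h1 ends (E - B) = 0 \<longrightarrow>
        (\<exists>bs. set bs \<subseteq> B \<and> distinct bs \<and> list_all2 (\<lambda>b (G, e). b \<in> G) bs Gs)"
    by blast
  let ?B = "set (map snd Gs)"
  have B: "?B \<subseteq> E" using Gs(2) by fastforce
  have "card ?B = h1 ends E" using distinct_card[OF Gs(3)] Gs(1) by simp
  from spanning_tree_complement[OF finite_E B this Gs(4)] have T: "spanning_tree ends E (E - ?B)" .
  have "matched Gs"
    unfolding matched_def
  proof (intro allI impI)
    fix T assume T: "spanning_tree ends E T"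
    hence "E - (E - T) = T" "h1 ends T = 0" by (auto simp: spanning_tree_def)
    then obtain bs where bs: "set bs \<subseteq> E - T" "distinct bs" "list_all2 (\<lambda>b (G, e). b \<in> G) bs Gs"
      using Gs(5)[rule_format, of "E - T"] by auto
    \<comment> \<open>The matching has \<open>h1 ends E\<close> edges, as many as the complement of
      a spanning tree, so it exhausts that complement.\<close>
    have "card (set bs) = card (E - T)"
      using distinct_card[OF bs(2)] list_all2_lengthD[OF bs(3)] Gs(1)
        card_spanning_tree_complement[OF finite_E T] by simp
    hence "set bs = E - T" using bs(1) finite_E by (intro card_subset_eq) auto
    thus "\<exists>bs. set bs = E - T \<and> distinct bs \<and> list_all2 (\<lambda>b (G, e). b \<in> G) bs Gs" using bs by blast
  qed
  moreover have "\<forall>(G, e)\<in>set Gs. G \<in> treated (num_stages ends E) \<and> ismin S G e"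
  proof (clarify)
    fix G e assume "(G, e) \<in> set Gs"
    hence "core ends G" "G \<subseteq> E" "e \<in> G" "ismin S G e" using Gs(2) by auto
    thus "G \<in> treated (num_stages ends E) \<and> ismin S G e" using treated_final[of G] by blast
  qed
  ultimately have "frame (num_stages ends E) S Gs" by (simp add: frame_def)
  moreover have "E - (E - ?B) = ?B" using B by blast
  hence "frame_monom Gs = (\<Prod>e\<in>E - (E - ?B). cvar e)"
    using prod.distinct_set_conv_list[OF Gs(3), of cvar] by (simp add: frame_monom_def)
  ultimately show ?thesis using that T by blast
qed

text \<open>All complements of spanning trees have the same size, so the exponents add up to
  zero.\<close>

lemma tree_quotient_character:
  assumes "spanning_tree ends E T" "spanning_tree ends E T0"
  shows "(\<Prod>e\<in>E - T. cvar e) / (\<Prod>e\<in>E - T0. cvar e) \<in> characters E"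
proof -
  define n :: "'e \<Rightarrow> int" where "n e = of_bool (e \<notin> T) - of_bool (e \<notin> T0)" for e
  have c: "(\<Sum>e\<in>E. of_bool (e \<notin> U)) = int (card (E - U))" for U
    using finite_E by (simp add: of_bool_def sum.If_cases Int_def set_diff_eq)
  have "(\<Sum>e\<in>E. n e) = 0"
    unfolding n_def sum_subtractf c using assms by (simp add: card_spanning_tree_complement[OF finite_E])
  moreover have p: "(\<Prod>e\<in>E - U. cvar e) = (\<Prod>e\<in>E. cvar e powi (of_bool (e \<notin> U)))" for U
  proof -
    have "(\<Prod>e\<in>E. cvar e powi (of_bool (e \<notin> U))) = (\<Prod>e\<in>E. if e \<notin> U then cvar e else 1)"
      by (intro prod.cong) auto
    also have "\<dots> = (\<Prod>e\<in>E - U. cvar e)"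
      using finite_E by (simp add: prod.If_cases Int_def set_diff_eq)
    finally show ?thesis by simp
  qed
  have "(\<Prod>e\<in>E - T. cvar e) / (\<Prod>e\<in>E - T0. cvar e) = (\<Prod>e\<in>E. cvar e powi n e)"
    unfolding p n_def prod_dividef[symmetric] by (intro prod.cong refl) (simp add: power_int_diff)
  ultimately show ?thesis unfolding characters_def cvar_def[symmetric] by blast
qed

end

theorem corollary5p3:
  fixes E :: "'e::linorder set" and ends :: "'e \<Rightarrow> 'v \<times> 'v"
  assumes "finite E"
    and "core ends E"
  shows "\<forall>(S, \<phi>) \<in> nonneg_real_points E (blown_up_space ends E).
           S \<notin> strict_hypersurface ends E"
proof (clarify)
  fix S \<phi> assume real: "(S, \<phi>) \<in> nonneg_real_points E (blown_up_space ends E)"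
    and Y: "S \<in> strict_hypersurface ends E"
  interpret core_graph E ends using assms by unfold_locales
  let ?N = "num_stages ends E"
  have V: "blown_up_space ends E = space_at ?N" by (simp add: blown_up_space_def space_at_def)
  have "S \<in> strict_at ?N (graph_hypersurface ends E)"
    using Y by (simp add: strict_hypersurface_def strict_at_def)
  note hyp = hypersurface[OF this]
  hence SV: "S \<in> space_at ?N" by blast
  note ring = tower_invD(2)[OF tower_inv SV]
  obtain S0 where S0: "(S, \<phi>) \<in> positive_real_points E (torus_orbit (space_at ?N) S0)"
    using real unfolding nonneg_real_points_def V by blast
  hence orb: "S \<in> torus_orbit (space_at ?N) S0"
    and hom: "\<phi> \<in> ring_hom (ring_on S) ring_of_type_algebra"
    and max0: "\<And>f. f \<in> max_ideal S \<Longrightarrow> \<phi> f = 0"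
    and pos: "\<And>m. m \<in> orbit_lattice E (torus_orbit (space_at ?N) S0) \<Longrightarrow> \<phi> m > 0"
    unfolding positive_real_points_def real_points_def by auto
  have \<phi>_one: "\<phi> 1 = 1" using ring_hom_one[OF hom] by simp
  have \<phi>_add: "\<phi> (x + y) = \<phi> x + \<phi> y" if "x \<in> S" "y \<in> S" for x y
    using ring_hom_add[OF hom, of x y] that by simp
  have \<phi>_sum: "\<phi> (sum f A) = (\<Sum>i\<in>A. \<phi> (f i))" if "\<And>i. i \<in> A \<Longrightarrow> f i \<in> S" for f and A :: "'e set set"
    using that
  proof (induction A rule: infinite_finite_induct)
    case (insert i A)
    have "\<phi> (f i + sum f A) = \<phi> (f i) + \<phi> (sum f A)"
      using insert.prems by (intro \<phi>_add subring_on_sum[OF ring]) auto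
    thus ?case using insert by simp
  qed (use max0[OF max_ideal_zero[OF ring]] in simp_all)
  \<comment> \<open>A nonunit has value 0. A character that is a unit at \<open>S\<close> is one on
    the whole orbit, hence belongs to the orbit lattice and has a positive value.\<close>
  have nonneg: "\<phi> m \<ge> 0" if m: "m \<in> characters E" "m \<in> S" for m
  proof (cases "m \<in> max_ideal S")
    case False
    hence inv: "inverse m \<in> S" using m(2) max_ideal_iff by blast
    have "m \<in> orbit_lattice E (torus_orbit (space_at ?N) S0)"
      unfolding orbit_lattice_def
      using m(1) unit_orbit[OF orb _ character_semi_invariant[OF m(1)] m(2) inv] by blast
    thus ?thesis using pos by force
  qed (simp add: max0)
  obtain Gs T0 where fr: "frame ?N S Gs" and T0: "spanning_tree ends E T0"
    and mon: "frame_monom Gs = (\<Prod>e\<in>E - T0. cvar e)"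
    using frame_exists[OF SV] .
  let ?term = "\<lambda>T. (\<Prod>e\<in>E - T. cvar e) / frame_monom Gs"
  have termS: "?term T \<in> S" if "spanning_tree ends E T" for T
    by (rule tree_term[OF ring frameD(1,2)[OF fr] that])
  have "\<phi> (local_eq Gs) = (\<Sum>T | spanning_tree ends E T. \<phi> (?term T))"
    unfolding local_eq_sum by (rule \<phi>_sum) (simp add: termS)
  \<comment> \<open>The other terms are non-negative, so the sum is at least the term of
    \<open>T0\<close>, whose monomial is the frame monomial itself.\<close>
  also have "\<dots> \<ge> \<phi> (?term T0)"
  proof (rule member_le_sum)
    show "T0 \<in> {T. spanning_tree ends E T}" using T0 by simp
    show "finite {T. spanning_tree ends E T}" by (rule finite_trees)
    fix T assume "T \<in> {T. spanning_tree ends E T} - {T0}"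
    hence T: "spanning_tree ends E T" by simp
    show "0 \<le> \<phi> (?term T)"
      using tree_quotient_character[OF T T0] termS[OF T] unfolding mon by (rule nonneg)
  qed
  also have "?term T0 = 1" unfolding mon using mon frame_monom_nonzero[of Gs] by simp
  finally have "\<phi> (local_eq Gs) \<ge> 1" by (simp add: \<phi>_one)
  moreover have "\<phi> (local_eq Gs) = 0" using hyp fr max0 by blast
  ultimately show False by simp
qed

end
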